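(* Let $g$ be a metric on the pullback tangent bundle $\pi^*(TM)\to E$. There is only one Finsler connection $\nabla$ with the following properties: ($\hat\alpha$) "$\nabla$ is regular and $y^ag_{ab}T^b=0$" or "$\nabla$ is strongly regular"; ($\hat\beta$) $g_{ab}T^a\wedge\omega^b=0$ (almost no horizontal torsion); ($\hat\gamma$) $g_{ab}T^a\wedge Dy^b=0$ (horizontal torsion symmetry); ($\hat\delta$) $Dg=0$ (metricity). Moreover, under these conditions $g$ is the vertical Hessian of a function $\mathscr{L}\colon E\to\mathbb{R}$ positive homogeneous of degree 2, and the connection is the Cartan connection (of $\mathscr{L}$). Finally, under the option "$\nabla$ is regular and $y^ag_{ab}T^b=0$" in ($\hat\alpha$), one can replace ($\hat\gamma$) with ($\hat\gamma'$) $y^ag_{ab}R^b{}_c\wedge\omega^c=0$.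
   Context: Setting. $M$ is a connected smooth $n$-dimensional manifold, $E=TM\setminus 0$ its slit tangent bundle, $\pi\colon E\to M$ the projection; all objects are smooth. A metric $g$ is a symmetric non-degenerate (of any signature) section of $\pi^*(T^*M\otimes_M T^*M)$ over $E$. A Finsler connection is a Koszul (linear) connection $\nabla$ on the vector bundle $\pi^*(TM)\to E$. It extends to pullback tensor bundles and defines the covariant exterior differential $D$ on forms on $E$ with values in pullback tensor bundles, by $D(S\otimes\beta)=\nabla S\wedge\beta+S\otimes d\beta$. Local coordinates $\{x^a\}$ on $M$ induce $\{x^a,y^a\}$ on $E$; $e_a=\partial/\partial x^a$, $e^a=dx^a$. The connection 1-forms $\omega^a{}_b$ on $E$ are defined by $\nabla e_b=\omega^a{}_be_a$. The Liouville section is $y=y^ae_a$ (its value at $X\in E$ is $X$). Set $\omega=\omega^ae_a$ with $\omega^a=\pi^*dx^a$, and $\bar\omega=Dy$, with components $\bar\omega^a=Dy^a=dy^a+\omega^a{}_by^b$. $Dg_{ab}=dg_{ab}-\omega^c{}_ag_{cb}-\omega^c{}_bg_{ac}$. The horizontal torsion is $T=D\omega$, $T^a=\omega^a{}_b\wedge\omega^b$. The curvature is the endomorphism-valued 2-form on $E$ with components $R^a{}_b=d\omega^a{}_b+\omega^a{}_c\wedge\omega^c{}_b$. $VE=\ker\pi_*$ is the vertical bundle. $\nabla$ is regular if for every $X\in E$ the map $V_XE\to T_{\pi(X)}M$, $Z\mapsto\nabla_Zy$, is injective (equivalently $\{\omega^a,\bar\omega^a\}$ is a basis of $T^*E$ at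 each point); it is strongly regular if this map is the identity under the canonical identification $V_XE\cong T_{\pi(X)}M$, $\partial/\partial y^a\leftrightarrow e_a$. For regular $\nabla$, write uniquely $\omega^a{}_b=H^a{}_{bc}\omega^c+V^a{}_{bc}\bar\omega^c$. "$g$ is the vertical Hessian of $\mathscr{L}$" means $g_{ab}=\partial^2\mathscr{L}/\partial y^a\partial y^b$; positive homogeneous of degree 2 means $\mathscr{L}(sy)=s^2\mathscr{L}(y)$ for all $s>0$. For such $\mathscr{L}$ (with $g$ non-degenerate), let $2G^a=g^{ad}\big(\frac{\partial^2\mathscr{L}}{\partial x^c\partial y^d}y^c-\frac{\partial\mathscr{L}}{\partial x^d}\big)$, $N^a_c=\partial G^a/\partial y^c$ (Barthel non-linear connection), $\frac{\delta}{\delta x^a}=\frac{\partial}{\partial x^a}-N^b_a\frac{\partial}{\partial y^b}$, $\Gamma^a{}_{bc}=\tfrac12g^{an}\big[\tfrac{\delta}{\delta x^b}g_{nc}+\tfrac{\delta}{\delta x^c}g_{nb}-\tfrac{\delta}{\delta x^n}g_{bc}\big]$ and $C^a{}_{bc}=\frac12g^{ad}\partial g_{db}/\partial y^c$. The Cartan connection of $\mathscr{L}$ is the Finsler connection with $H^a{}_{bc}=\Gamma^a{}_{bc}$, $V^a{}_{bc}=C^a{}_{bc}$, i.e. $\omega^a{}_b=\Gamma^a{}_{bc}dx^c+C^a{}_{bc}(dy^c+N^c_ddx^d)$. *)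

theory Defs
  imports "HOL-Analysis.Analysis"
begin

section \<open>Smooth maps between Euclidean spaces\<close>

(* To be used on open sets S only, since the derivative is taken at x and not within S. *)
primrec Ck_on :: "nat \<Rightarrow> 'a::real_normed_vector set \<Rightarrow> ('a \<Rightarrow> 'b::real_normed_vector) \<Rightarrow> bool" where
  "Ck_on 0 S f \<longleftrightarrow> continuous_on S f"
| "Ck_on (Suc k) S f \<longleftrightarrow>
     (\<forall>x\<in>S. f differentiable (at x)) \<and> (\<forall>v. Ck_on k S (\<lambda>x. frechet_derivative f (at x) v))"

definition smooth_on :: "'a::real_normed_vector set \<Rightarrow> ('a \<Rightarrow> 'b::real_normed_vector) \<Rightarrow> bool" where
  "smooth_on S f \<longleftrightarrow> (\<forall>k. Ck_on k S f)"


section \<open>Smooth manifolds\<close>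

text \<open>A manifold is given by an atlas; its point set is the union of the chart domains, and its
  topology is the one determined by the charts.\<close>

type_synonym ('p, 'e) chart = "'p set \<times> ('p \<Rightarrow> 'e)"

definition chart_inv :: "('p, 'e) chart \<Rightarrow> 'e \<Rightarrow> 'p" where
  "chart_inv c = inv_into (fst c) (snd c)"

definition chart_image :: "('p, 'e) chart \<Rightarrow> 'e set" where
  "chart_image c = snd c ` fst c"

definition atlas_carrier :: "('p, 'e) chart set \<Rightarrow> 'p set" where
  "atlas_carrier A = (\<Union>c\<in>A. fst c)"

definition smooth_atlas :: "('p, 'e::euclidean_space) chart set \<Rightarrow> bool" where
  "smooth_atlas A \<longleftrightarrow>
     (\<forall>c\<in>A. inj_on (snd c) (fst c) \<and> open (chart_image c)) \<and>
     (\<forall>c\<in>A. \<forall>c'\<in>A. open (snd c ` (fst c \<inter> fst c')) \<and>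
        smooth_on (snd c ` (fst c \<inter> fst c')) (snd c' \<circ> chart_inv c))"

definition atlas_open :: "('p, 'e::euclidean_space) chart set \<Rightarrow> 'p set \<Rightarrow> bool" where
  "atlas_open A W \<longleftrightarrow> W \<subseteq> atlas_carrier A \<and> (\<forall>c\<in>A. open (snd c ` (W \<inter> fst c)))"

definition atlas_topology :: "('p, 'e::euclidean_space) chart set \<Rightarrow> 'p topology" where
  "atlas_topology A = topology (atlas_open A)"

lemma istopology_atlas_open:
  assumes "smooth_atlas A"
  shows "istopology (atlas_open A)"
  unfolding istopology_def
proof (intro conjI allI impI)
  fix S T assume S: "atlas_open A S" and T: "atlas_open A T"
  have "open (snd c ` (S \<inter> T \<inter> fst c))" if c: "c \<in> A" for c
  proof -
    have "inj_on (snd c) (fst c)" using assms c by (auto simp: smooth_atlas_def)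
    then have "snd c ` (S \<inter> T \<inter> fst c) = snd c ` (S \<inter> fst c) \<inter> snd c ` (T \<inter> fst c)"
      by (auto simp: inj_on_def)
    then show ?thesis using S T c by (auto simp: atlas_open_def)
  qed
  then show "atlas_open A (S \<inter> T)" using S by (auto simp: atlas_open_def)
next
  fix K assume K: "\<forall>S\<in>K. atlas_open A S"
  have "open (snd c ` (\<Union>K \<inter> fst c))" if "c \<in> A" for c
  proof -
    have "snd c ` (\<Union>K \<inter> fst c) = (\<Union>S\<in>K. snd c ` (S \<inter> fst c))"
      by auto
    then show ?thesis using K that by (auto simp: atlas_open_def simp del: UN_simps intro!: open_UN)
  qed
  then show "atlas_open A (\<Union>K)" using K unfolding atlas_open_def by blast
qed

lemma openin_atlas_topology:
  "smooth_atlas A \<Longrightarrow> openin (atlas_topology A) W \<longleftrightarrow> atlas_open A W"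
  unfolding atlas_topology_def by (simp add: istopology_atlas_open topology_inverse')

definition smooth_manifold :: "('p, 'e::euclidean_space) chart set \<Rightarrow> bool" where
  "smooth_manifold A \<longleftrightarrow> smooth_atlas A \<and>
     Hausdorff_space (atlas_topology A) \<and> second_countable (atlas_topology A)"

definition smooth_map_on ::
  "('p, 'e::euclidean_space) chart set \<Rightarrow> 'p set \<Rightarrow> ('p \<Rightarrow> 'b::real_normed_vector) \<Rightarrow> bool" where
  "smooth_map_on A W f \<longleftrightarrow> (\<forall>c\<in>A. smooth_on (snd c ` (W \<inter> fst c)) (f \<circ> chart_inv c))"


section \<open>Tangent vectors\<close>

text \<open>A tangent vector at \<open>p\<close> is a family of coordinate vectors, one for each chart around \<open>p\<close>, which
  transforms by the derivatives of the coordinate changes. It is set to \<open>0\<close> at the remaining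
  charts, so that the vector space operations are pointwise.\<close>

type_synonym ('p, 'e) tangent = "('p, 'e) chart \<Rightarrow> 'e"

definition tangent_space ::
  "('p, 'e::euclidean_space) chart set \<Rightarrow> 'p \<Rightarrow> ('p, 'e) tangent set" where
  "tangent_space A p = {v.
     (\<forall>c\<in>A. \<forall>c'\<in>A. p \<in> fst c \<longrightarrow> p \<in> fst c' \<longrightarrow>
        v c' = frechet_derivative (snd c' \<circ> chart_inv c) (at (snd c p)) (v c)) \<and>
     (\<forall>c. \<not> (c \<in> A \<and> p \<in> fst c) \<longrightarrow> v c = 0)}"

(* The tangent vector at p whose coordinates in the chart c are w. *)
definition coord_vector ::
  "('p, 'e::euclidean_space) chart set \<Rightarrow> ('p, 'e) chart \<Rightarrow> 'p \<Rightarrow> 'e \<Rightarrow> ('p, 'e) tangent" where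
  "coord_vector A c p w = (\<lambda>c'. if c' \<in> A \<and> p \<in> fst c'
     then frechet_derivative (snd c' \<circ> chart_inv c) (at (snd c p)) w else 0)"

(* The derivative of f along the tangent vector v; it does not depend on the chart chosen. *)
definition tangent_deriv ::
  "('p, 'e::euclidean_space) chart set \<Rightarrow> 'p \<Rightarrow> ('p, 'e) tangent \<Rightarrow>
   ('p \<Rightarrow> 'b::real_normed_vector) \<Rightarrow> 'b" where
  "tangent_deriv A p v f =
     (let c = (SOME c. c \<in> A \<and> p \<in> fst c)
      in frechet_derivative (f \<circ> chart_inv c) (at (snd c p)) (v c))"

definition pushforward ::
  "('p, 'e::euclidean_space) chart set \<Rightarrow> ('q, 'f::euclidean_space) chart set \<Rightarrow> ('p \<Rightarrow> 'q) \<Rightarrow>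
   'p \<Rightarrow> ('p, 'e) tangent \<Rightarrow> ('q, 'f) tangent" where
  "pushforward A B F p v = (\<lambda>c. if c \<in> B \<and> F p \<in> fst c then tangent_deriv A p v (snd c \<circ> F) else 0)"

definition smooth_vector_field_on ::
  "('p, 'e::euclidean_space) chart set \<Rightarrow> 'p set \<Rightarrow> ('p \<Rightarrow> ('p, 'e) tangent) \<Rightarrow> bool" where
  "smooth_vector_field_on A W Z \<longleftrightarrow>
     (\<forall>p\<in>W. Z p \<in> tangent_space A p) \<and>
     (\<forall>c\<in>A. smooth_on (snd c ` (W \<inter> fst c)) (\<lambda>z. Z (chart_inv c z) c))"


section \<open>The slit tangent bundle\<close>

type_synonym ('m, 'n) mchart = "('m, real^'n) chart"
type_synonym ('m, 'n) mtangent = "('m, real^'n) tangent"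
type_synonym ('m, 'n) epoint = "'m \<times> ('m, 'n) mtangent"
type_synonym ('m, 'n) echart = "(('m, 'n) epoint, (real^'n) \<times> (real^'n)) chart"
type_synonym ('m, 'n) etangent = "(('m, 'n) epoint, (real^'n) \<times> (real^'n)) tangent"

definition slit_bundle :: "('m, 'n::finite) mchart set \<Rightarrow> ('m, 'n) epoint set" where
  "slit_bundle A = {(p, v). p \<in> atlas_carrier A \<and> v \<in> tangent_space A p \<and> v \<noteq> (\<lambda>_. 0)}"

(* The coordinates (x, y) on E induced by the coordinates x on M. *)
definition lift_chart ::
  "('m, 'n::finite) mchart set \<Rightarrow> ('m, 'n) mchart \<Rightarrow> ('m, 'n) echart" where
  "lift_chart A c = ({X \<in> slit_bundle A. fst X \<in> fst c}, \<lambda>X. (snd c (fst X), snd X c))"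

definition slit_atlas :: "('m, 'n::finite) mchart set \<Rightarrow> ('m, 'n) echart set" where
  "slit_atlas A = lift_chart A ` A"

abbreviation E_domain ::
  "('m, 'n::finite) mchart set \<Rightarrow> ('m, 'n) mchart \<Rightarrow> ((real^'n) \<times> (real^'n)) set" where
  "E_domain A c \<equiv> chart_image (lift_chart A c)"

abbreviation E_point ::
  "('m, 'n::finite) mchart set \<Rightarrow> ('m, 'n) mchart \<Rightarrow> (real^'n) \<times> (real^'n) \<Rightarrow> ('m, 'n) epoint" where
  "E_point A c \<equiv> chart_inv (lift_chart A c)"

definition vertical_space ::
  "('m, 'n::finite) mchart set \<Rightarrow> ('m, 'n) epoint \<Rightarrow> ('m, 'n) etangent set" where
  "vertical_space A X =
     {Z \<in> tangent_space (slit_atlas A) X. pushforward (slit_atlas A) A fst X Z = (\<lambda>_. 0)}"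

(* For vertical Z, the canonical identification sending d/dy^a to e_a. *)
definition vertical_to_base ::
  "('m, 'n::finite) mchart set \<Rightarrow> ('m, 'n) epoint \<Rightarrow> ('m, 'n) etangent \<Rightarrow> ('m, 'n) mtangent" where
  "vertical_to_base A X Z =
     (\<lambda>c. if c \<in> A \<and> fst X \<in> fst c then snd (Z (lift_chart A c)) else 0)"

(* Sections over W of the pullback of TM to E. *)
definition smooth_section_on ::
  "('m, 'n::finite) mchart set \<Rightarrow> ('m, 'n) epoint set \<Rightarrow>
   (('m, 'n) epoint \<Rightarrow> ('m, 'n) mtangent) \<Rightarrow> bool" where
  "smooth_section_on A W S \<longleftrightarrow>
     (\<forall>X\<in>W. S X \<in> tangent_space A (fst X)) \<and>
     (\<forall>c\<in>A. smooth_on (snd (lift_chart A c) ` (W \<inter> fst (lift_chart A c)))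
        (\<lambda>z. S (E_point A c z) c))"

abbreviation liouville :: "('m, 'n::finite) epoint \<Rightarrow> ('m, 'n) mtangent" where
  "liouville \<equiv> snd"

definition coord_frame ::
  "('m, 'n::finite) mchart set \<Rightarrow> ('m, 'n) mchart \<Rightarrow> 'n \<Rightarrow> ('m, 'n) epoint \<Rightarrow> ('m, 'n) mtangent" where
  "coord_frame A c a = (\<lambda>X. coord_vector A c (fst X) (axis a 1))"


section \<open>Metrics and Finsler connections\<close>

type_synonym ('m, 'n) metric =
  "('m, 'n) epoint \<Rightarrow> ('m, 'n) mtangent \<Rightarrow> ('m, 'n) mtangent \<Rightarrow> real"

definition metric_comp ::
  "('m, 'n::finite) mchart set \<Rightarrow> ('m, 'n) metric \<Rightarrow> ('m, 'n) mchart \<Rightarrow> 'n \<Rightarrow> 'n \<Rightarrow>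
   (real^'n) \<times> (real^'n) \<Rightarrow> real" where
  "metric_comp A g c a b z =
     (let X = E_point A c z in g X (coord_frame A c a X) (coord_frame A c b X))"

definition pullback_metric :: "('m, 'n::finite) mchart set \<Rightarrow> ('m, 'n) metric \<Rightarrow> bool" where
  "pullback_metric A g \<longleftrightarrow>
     (\<forall>X\<in>slit_bundle A.
        (\<forall>u\<in>tangent_space A (fst X). \<forall>v\<in>tangent_space A (fst X). \<forall>w\<in>tangent_space A (fst X). \<forall>r.
           g X (\<lambda>c. r *\<^sub>R u c + v c) w = r * g X u w + g X v w) \<and>
        (\<forall>u\<in>tangent_space A (fst X). \<forall>v\<in>tangent_space A (fst X). g X u v = g X v u) \<and>
        (\<forall>u\<in>tangent_space A (fst X).
           (\<forall>v\<in>tangent_space A (fst X). g X u v = 0) \<longrightarrow> u = (\<lambda>_. 0))) \<and>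
     (\<forall>c\<in>A. \<forall>a b. smooth_on (E_domain A c) (metric_comp A g c a b))"

(* nab X Z S is the derivative at X of the section S along Z. *)
type_synonym ('m, 'n) connection =
  "('m, 'n) epoint \<Rightarrow> ('m, 'n) etangent \<Rightarrow> (('m, 'n) epoint \<Rightarrow> ('m, 'n) mtangent) \<Rightarrow> ('m, 'n) mtangent"

text \<open>Koszul connections are taken to act on smooth sections over arbitrary open subsets of \<open>E\<close>,
  compatibly with restriction; this makes \<open>\<nabla> e\<^sub>b\<close> meaningful for a local frame. The values at
  arguments other than those quantified over below are irrelevant.\<close>

definition finsler_connection :: "('m, 'n::finite) mchart set \<Rightarrow> ('m, 'n) connection \<Rightarrow> bool" where
  "finsler_connection A nab \<longleftrightarrow>
    (\<forall>W. openin (atlas_topology (slit_atlas A)) W \<longrightarrow>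
      (\<forall>S. smooth_section_on A W S \<longrightarrow>
        (\<forall>X\<in>W. \<forall>Z\<in>tangent_space (slit_atlas A) X.
           nab X Z S \<in> tangent_space A (fst X)) \<and>
        (\<forall>X\<in>W. \<forall>Z\<in>tangent_space (slit_atlas A) X. \<forall>Z'\<in>tangent_space (slit_atlas A) X. \<forall>r.
           nab X (\<lambda>c. r *\<^sub>R Z c + Z' c) S = (\<lambda>c. r *\<^sub>R nab X Z S c + nab X Z' S c)) \<and>
        (\<forall>S'. smooth_section_on A W S' \<longrightarrow>
           (\<forall>X\<in>W. \<forall>Z\<in>tangent_space (slit_atlas A) X.
              nab X Z (\<lambda>Y c. S Y c + S' Y c) = (\<lambda>c. nab X Z S c + nab X Z S' c))) \<and>
        (\<forall>f :: _ \<Rightarrow> real. smooth_map_on (slit_atlas A) W f \<longrightarrow>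
           (\<forall>X\<in>W. \<forall>Z\<in>tangent_space (slit_atlas A) X.
              nab X Z (\<lambda>Y c. f Y *\<^sub>R S Y c) =
                (\<lambda>c. tangent_deriv (slit_atlas A) X Z f *\<^sub>R S X c + f X *\<^sub>R nab X Z S c))) \<and>
        (\<forall>S'. smooth_section_on A W S' \<and> (\<forall>Y\<in>W. S Y = S' Y) \<longrightarrow>
           (\<forall>X\<in>W. \<forall>Z\<in>tangent_space (slit_atlas A) X. nab X Z S = nab X Z S')) \<and>
        (\<forall>Z. smooth_vector_field_on (slit_atlas A) W Z \<longrightarrow>
           smooth_section_on A W (\<lambda>X. nab X (Z X) S))))"

definition same_connection ::
  "('m, 'n::finite) mchart set \<Rightarrow> ('m, 'n) connection \<Rightarrow> ('m, 'n) connection \<Rightarrow> bool" where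
  "same_connection A nab nab' \<longleftrightarrow>
    (\<forall>W S. openin (atlas_topology (slit_atlas A)) W \<and> smooth_section_on A W S \<longrightarrow>
      (\<forall>X\<in>W. \<forall>Z\<in>tangent_space (slit_atlas A) X. nab X Z S = nab' X Z S))"

definition regular_connection :: "('m, 'n::finite) mchart set \<Rightarrow> ('m, 'n) connection \<Rightarrow> bool" where
  "regular_connection A nab \<longleftrightarrow>
     (\<forall>X\<in>slit_bundle A. inj_on (\<lambda>Z. nab X Z liouville) (vertical_space A X))"

definition strongly_regular :: "('m, 'n::finite) mchart set \<Rightarrow> ('m, 'n) connection \<Rightarrow> bool" where
  "strongly_regular A nab \<longleftrightarrow>
     (\<forall>X\<in>slit_bundle A. \<forall>Z\<in>vertical_space A X. nab X Z liouville = vertical_to_base A X Z)"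


section \<open>Forms in local coordinates\<close>

text \<open>Differential forms on a coordinate domain of \<open>E\<close>, with arguments the point \<open>z = (x, y)\<close>
  followed by tangent vectors \<open>u\<close>, \<open>v\<close>, \<open>w\<close>; so \<open>fst u\<close> and \<open>snd u\<close> are the \<open>\<partial>/\<partial>x\<close>- and
  \<open>\<partial>/\<partial>y\<close>-parts of \<open>u\<close>.\<close>

type_synonym 'v form1 = "'v \<Rightarrow> 'v \<Rightarrow> real"
type_synonym 'v form2 = "'v \<Rightarrow> 'v \<Rightarrow> 'v \<Rightarrow> real"
type_synonym 'v form3 = "'v \<Rightarrow> 'v \<Rightarrow> 'v \<Rightarrow> 'v \<Rightarrow> real"

definition wedge11 :: "'v form1 \<Rightarrow> 'v form1 \<Rightarrow> 'v form2" where
  "wedge11 \<alpha> \<beta> z u v = \<alpha> z u * \<beta> z v - \<alpha> z v * \<beta> z u"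

definition wedge21 :: "'v form2 \<Rightarrow> 'v form1 \<Rightarrow> 'v form3" where
  "wedge21 \<tau> \<beta> z u v w = \<tau> z u v * \<beta> z w + \<tau> z v w * \<beta> z u + \<tau> z w u * \<beta> z v"

definition ext_deriv0 :: "('v::real_normed_vector \<Rightarrow> real) \<Rightarrow> 'v form1" where
  "ext_deriv0 f z u = frechet_derivative f (at z) u"

definition ext_deriv1 :: "('v::real_normed_vector) form1 \<Rightarrow> 'v form2" where
  "ext_deriv1 \<alpha> z u v =
     frechet_derivative (\<lambda>z. \<alpha> z v) (at z) u - frechet_derivative (\<lambda>z. \<alpha> z u) (at z) v"

definition dx :: "'n \<Rightarrow> ((real^'n) \<times> (real^'n)) form1" where
  "dx a z u = fst u $ a"

definition dy :: "'n \<Rightarrow> ((real^'n) \<times> (real^'n)) form1" where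
  "dy a z u = snd u $ a"

(* conn_form A nab c a b has upper index a and lower index b: nab e_b = (conn_form a b) e_a. *)
definition conn_form ::
  "('m, 'n::finite) mchart set \<Rightarrow> ('m, 'n) connection \<Rightarrow> ('m, 'n) mchart \<Rightarrow> 'n \<Rightarrow> 'n \<Rightarrow>
   ((real^'n) \<times> (real^'n)) form1" where
  "conn_form A nab c a b z u =
     nab (E_point A c z) (coord_vector (slit_atlas A) (lift_chart A c) (E_point A c z) u)
       (coord_frame A c b) c $ a"

definition Dy_form ::
  "('m, 'n::finite) mchart set \<Rightarrow> ('m, 'n) connection \<Rightarrow> ('m, 'n) mchart \<Rightarrow> 'n \<Rightarrow>
   ((real^'n) \<times> (real^'n)) form1" where
  "Dy_form A nab c a z u = dy a z u + (\<Sum>b\<in>UNIV. conn_form A nab c a b z u * snd z $ b)"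

definition Dg_form ::
  "('m, 'n::finite) mchart set \<Rightarrow> ('m, 'n) metric \<Rightarrow> ('m, 'n) connection \<Rightarrow> ('m, 'n) mchart \<Rightarrow>
   'n \<Rightarrow> 'n \<Rightarrow> ((real^'n) \<times> (real^'n)) form1" where
  "Dg_form A g nab c a b z u = ext_deriv0 (metric_comp A g c a b) z u
     - (\<Sum>d\<in>UNIV. conn_form A nab c d a z u * metric_comp A g c d b z)
     - (\<Sum>d\<in>UNIV. conn_form A nab c d b z u * metric_comp A g c a d z)"

definition torsion ::
  "('m, 'n::finite) mchart set \<Rightarrow> ('m, 'n) connection \<Rightarrow> ('m, 'n) mchart \<Rightarrow> 'n \<Rightarrow>
   ((real^'n) \<times> (real^'n)) form2" where
  "torsion A nab c a z u v = (\<Sum>b\<in>UNIV. wedge11 (conn_form A nab c a b) (dx b) z u v)"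

definition curvature ::
  "('m, 'n::finite) mchart set \<Rightarrow> ('m, 'n) connection \<Rightarrow> ('m, 'n) mchart \<Rightarrow> 'n \<Rightarrow> 'n \<Rightarrow>
   ((real^'n) \<times> (real^'n)) form2" where
  "curvature A nab c a b z u v = ext_deriv1 (conn_form A nab c a b) z u v
     + (\<Sum>d\<in>UNIV. wedge11 (conn_form A nab c a d) (conn_form A nab c d b) z u v)"


section \<open>The conditions on the connection\<close>

definition radial_torsion_free ::
  "('m, 'n::finite) mchart set \<Rightarrow> ('m, 'n) metric \<Rightarrow> ('m, 'n) connection \<Rightarrow> bool" where
  "radial_torsion_free A g nab \<longleftrightarrow> (\<forall>c\<in>A. \<forall>z\<in>E_domain A c. \<forall>u v.
     (\<Sum>a\<in>UNIV. \<Sum>b\<in>UNIV. snd z $ a * metric_comp A g c a b z * torsion A nab c b z u v) = 0)"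

definition almost_torsion_free ::
  "('m, 'n::finite) mchart set \<Rightarrow> ('m, 'n) metric \<Rightarrow> ('m, 'n) connection \<Rightarrow> bool" where
  "almost_torsion_free A g nab \<longleftrightarrow> (\<forall>c\<in>A. \<forall>z\<in>E_domain A c. \<forall>u v w.
     (\<Sum>a\<in>UNIV. \<Sum>b\<in>UNIV. metric_comp A g c a b z *
        wedge21 (torsion A nab c a) (dx b) z u v w) = 0)"

definition torsion_symmetric ::
  "('m, 'n::finite) mchart set \<Rightarrow> ('m, 'n) metric \<Rightarrow> ('m, 'n) connection \<Rightarrow> bool" where
  "torsion_symmetric A g nab \<longleftrightarrow> (\<forall>c\<in>A. \<forall>z\<in>E_domain A c. \<forall>u v w.
     (\<Sum>a\<in>UNIV. \<Sum>b\<in>UNIV. metric_comp A g c a b z *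
        wedge21 (torsion A nab c a) (Dy_form A nab c b) z u v w) = 0)"

definition radial_curvature_condition ::
  "('m, 'n::finite) mchart set \<Rightarrow> ('m, 'n) metric \<Rightarrow> ('m, 'n) connection \<Rightarrow> bool" where
  "radial_curvature_condition A g nab \<longleftrightarrow> (\<forall>c\<in>A. \<forall>z\<in>E_domain A c. \<forall>u v w.
     (\<Sum>a\<in>UNIV. \<Sum>b\<in>UNIV. \<Sum>d\<in>UNIV. snd z $ a * metric_comp A g c a b z *
        wedge21 (curvature A nab c b d) (dx d) z u v w) = 0)"

definition metric_compatible ::
  "('m, 'n::finite) mchart set \<Rightarrow> ('m, 'n) metric \<Rightarrow> ('m, 'n) connection \<Rightarrow> bool" where
  "metric_compatible A g nab \<longleftrightarrow> (\<forall>c\<in>A. \<forall>z\<in>E_domain A c. \<forall>a b u. Dg_form A g nab c a b z u = 0)"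


section \<open>The Cartan connection\<close>

definition pdx :: "'n \<Rightarrow> ((real^'n::finite) \<times> (real^'n) \<Rightarrow> real) \<Rightarrow> (real^'n) \<times> (real^'n) \<Rightarrow> real" where
  "pdx a f z = frechet_derivative f (at z) (axis a 1, 0)"

definition pdy :: "'n \<Rightarrow> ((real^'n::finite) \<times> (real^'n) \<Rightarrow> real) \<Rightarrow> (real^'n) \<times> (real^'n) \<Rightarrow> real" where
  "pdy a f z = frechet_derivative f (at z) (0, axis a 1)"

context
  fixes F :: "(real^'n::finite) \<times> (real^'n) \<Rightarrow> real"
begin

definition hess :: "'n \<Rightarrow> 'n \<Rightarrow> (real^'n) \<times> (real^'n) \<Rightarrow> real" where
  "hess a b = pdy a (pdy b F)"

definition hess_inv :: "'n \<Rightarrow> 'n \<Rightarrow> (real^'n) \<times> (real^'n) \<Rightarrow> real" where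
  "hess_inv a b z = matrix_inv (\<chi> i j. hess i j z) $ a $ b"

definition spray_coeff :: "'n \<Rightarrow> (real^'n) \<times> (real^'n) \<Rightarrow> real" where
  "spray_coeff a z =
     (1/2) * (\<Sum>d\<in>UNIV. hess_inv a d z * ((\<Sum>c\<in>UNIV. pdx c (pdy d F) z * snd z $ c) - pdx d F z))"

definition barthel :: "'n \<Rightarrow> 'n \<Rightarrow> (real^'n) \<times> (real^'n) \<Rightarrow> real" where
  "barthel a c = pdy c (spray_coeff a)"

definition hdelta :: "'n \<Rightarrow> ((real^'n) \<times> (real^'n) \<Rightarrow> real) \<Rightarrow> (real^'n) \<times> (real^'n) \<Rightarrow> real" where
  "hdelta a f z = pdx a f z - (\<Sum>b\<in>UNIV. barthel b a z * pdy b f z)"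

definition cartan_H :: "'n \<Rightarrow> 'n \<Rightarrow> 'n \<Rightarrow> (real^'n) \<times> (real^'n) \<Rightarrow> real" where
  "cartan_H a b c z = (1/2) * (\<Sum>n\<in>UNIV. hess_inv a n z *
     (hdelta b (hess n c) z + hdelta c (hess n b) z - hdelta n (hess b c) z))"

definition cartan_V :: "'n \<Rightarrow> 'n \<Rightarrow> 'n \<Rightarrow> (real^'n) \<times> (real^'n) \<Rightarrow> real" where
  "cartan_V a b c z = (1/2) * (\<Sum>d\<in>UNIV. hess_inv a d z * pdy c (hess d b) z)"

definition cartan_form :: "'n \<Rightarrow> 'n \<Rightarrow> ((real^'n) \<times> (real^'n)) form1" where
  "cartan_form a b z u =
     (\<Sum>c\<in>UNIV. cartan_H a b c z * dx c z u) +
     (\<Sum>c\<in>UNIV. cartan_V a b c z * (dy c z u + (\<Sum>d\<in>UNIV. barthel c d z * dx d z u)))"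

end

definition is_vertical_hessian ::
  "('m, 'n::finite) mchart set \<Rightarrow> ('m, 'n) metric \<Rightarrow> (('m, 'n) epoint \<Rightarrow> real) \<Rightarrow> bool" where
  "is_vertical_hessian A g L \<longleftrightarrow> (\<forall>c\<in>A. \<forall>z\<in>E_domain A c. \<forall>a b.
     metric_comp A g c a b z = hess (L \<circ> E_point A c) a b z)"

definition pos_homogeneous2 ::
  "('m, 'n::finite) mchart set \<Rightarrow> (('m, 'n) epoint \<Rightarrow> real) \<Rightarrow> bool" where
  "pos_homogeneous2 A L \<longleftrightarrow>
     (\<forall>(p, v)\<in>slit_bundle A. \<forall>s>0. L (p, \<lambda>c. s *\<^sub>R v c) = s\<^sup>2 * L (p, v))"

definition is_cartan_connection ::
  "('m, 'n::finite) mchart set \<Rightarrow> (('m, 'n) epoint \<Rightarrow> real) \<Rightarrow> ('m, 'n) connection \<Rightarrow> bool" where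
  "is_cartan_connection A L nab \<longleftrightarrow> finsler_connection A nab \<and>
     (\<forall>c\<in>A. \<forall>z\<in>E_domain A c. \<forall>a b u.
        conn_form A nab c a b z u = cartan_form (L \<circ> E_point A c) a b z u)"

definition finsler_lagrangian ::
  "('m, 'n::finite) mchart set \<Rightarrow> ('m, 'n) metric \<Rightarrow> (('m, 'n) epoint \<Rightarrow> real) \<Rightarrow> bool" where
  "finsler_lagrangian A g L \<longleftrightarrow> smooth_map_on (slit_atlas A) (slit_bundle A) L \<and>
     pos_homogeneous2 A L \<and> is_vertical_hessian A g L"


section \<open>The two systems of conditions\<close>

definition cartan_conditions ::
  "('m, 'n::finite) mchart set \<Rightarrow> ('m, 'n) metric \<Rightarrow> ('m, 'n) connection \<Rightarrow> bool" where
  "cartan_conditions A g nab \<longleftrightarrow>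
     ((regular_connection A nab \<and> radial_torsion_free A g nab) \<or> strongly_regular A nab) \<and>
     almost_torsion_free A g nab \<and> torsion_symmetric A g nab \<and> metric_compatible A g nab"

definition cartan_curvature_conditions ::
  "('m, 'n::finite) mchart set \<Rightarrow> ('m, 'n) metric \<Rightarrow> ('m, 'n) connection \<Rightarrow> bool" where
  "cartan_curvature_conditions A g nab \<longleftrightarrow>
     (regular_connection A nab \<and> radial_torsion_free A g nab) \<and>
     almost_torsion_free A g nab \<and> radial_curvature_condition A g nab \<and> metric_compatible A g nab"

end

(* Let V_abc and H_abc be the components of g_ad w^d_b along the vertical vectors and along the
   kernel of Dy. The radial condition on the torsion T, or strong regularity, forces V_abc y^b = 0
   once V_abc is symmetric in a and b, which is part of the vanishing of g_ab T^a wedge dx^b; the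
   torsion symmetry then makes V totally symmetric and the horizontal part of T vanish. With Dg = 0
   this says 2 V_abc = dg_ab/dy^c, whence g is the vertical Hessian of g_ab y^a y^b / 2, and H is
   given by the Christoffel formula for the non-linear connection N^a_c = H^a_bc y^b. Contracting
   that formula once and twice with y, and differentiating the second contraction in y, shows that N
   is the Barthel connection. Differentiating y_a T^a = 0 exchanges the torsion symmetry with the
   curvature condition. *)
theory Submission
  imports Defs
begin

section \<open>Calculus of smooth maps\<close>

text \<open>The Christoffel formula is only implicit: its horizontal derivatives contain N, which is
  itself a contraction of H. Contraction with y breaks the circle, because a vertical derivative of
  g vanishes as soon as one of its arguments is y: after one contraction the only unknown on the
  right is N y, after two none is left, and N y turns out to be twice the spray of g(y,y)/2. No
  inverse of g is ever differentiated: N y is characterised by its inner products, the product rule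
  is applied to these, and equal vectors are recognised by nondegeneracy. The factor 1/2 in the
  potential is Euler's: a function of degree 2 with vertical Hessian g must be g(y,y)/2. This
  expression is built from g and y without a choice of coordinates, so the potential is global at
  once and depends on g only; uniqueness then falls out of the identification with the Cartan
  connection. The same chartwise normal form, \<open>cartan_like\<close>, is used in reverse to show
  that the Cartan connection of any homogeneous potential of g satisfies all the conditions, hence
  that both systems have the same solutions.\<close>

lemma frechet_derivative_eqI: "(f has_derivative f') (at x) \<Longrightarrow> frechet_derivative f (at x) v = f' v"
  using frechet_derivative_at by metis

lemma frechet_derivative_cong_open:
  assumes "open S" "x \<in> S" "\<And>z. z \<in> S \<Longrightarrow> f z = g z"
  shows "frechet_derivative f (at x) = frechet_derivative g (at x)"
proof -
  have "(f has_derivative D) (at x) \<longleftrightarrow> (g has_derivative D) (at x)" for D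
    using assms by (metis has_derivative_transform_within_open)
  then show ?thesis
    by (simp add: frechet_derivative_def)
qed

lemma differentiable_cong_open:
  assumes "open S" "x \<in> S" "\<And>z. z \<in> S \<Longrightarrow> f z = g z"
  shows "f differentiable (at x) \<longleftrightarrow> g differentiable (at x)"
  unfolding differentiable_def using assms by (metis has_derivative_transform_within_open)

lemma Ck_on_cong:
  assumes "open S" "\<And>x. x \<in> S \<Longrightarrow> f x = g x"
  shows "Ck_on k S f \<longleftrightarrow> Ck_on k S g"
  using assms(2)
proof (induction k arbitrary: f g)
  case 0
  then show ?case by (auto intro: continuous_on_cong)
next
  case (Suc k)
  have d: "frechet_derivative f (at x) = frechet_derivative g (at x)" if "x \<in> S" for x
    using assms(1) that Suc.prems by (rule frechet_derivative_cong_open)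
  have "f differentiable at x \<longleftrightarrow> g differentiable at x" if "x \<in> S" for x
    using assms(1) that Suc.prems by (rule differentiable_cong_open)
  moreover have "Ck_on k S (\<lambda>x. frechet_derivative f (at x) v) \<longleftrightarrow>
      Ck_on k S (\<lambda>x. frechet_derivative g (at x) v)" for v
    by (rule Suc.IH) (simp add: d)
  ultimately show ?case by auto
qed

lemma Ck_on_subset: "Ck_on k S f \<Longrightarrow> T \<subseteq> S \<Longrightarrow> Ck_on k T f"
  by (induction k arbitrary: f) (auto intro: continuous_on_subset)

lemma Ck_on_Suc_imp: "Ck_on (Suc k) S f \<Longrightarrow> Ck_on k S f"
proof (induction k arbitrary: f)
  case 0
  then show ?case
    by (auto intro!: continuous_at_imp_continuous_on differentiable_imp_continuous_within)
next
  case (Suc k)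
  have "Ck_on k S (\<lambda>x. frechet_derivative f (at x) v)" for v
    using Suc.prems by (intro Suc.IH) (subst (asm) Ck_on.simps(2), blast)
  moreover have "\<forall>x\<in>S. f differentiable at x"
    using Suc.prems by simp
  ultimately show ?case by simp
qed

lemma Ck_on_const: "Ck_on k S (\<lambda>_. c)"
proof (induction k arbitrary: c)
  case (Suc k)
  then show ?case by simp
qed simp

lemma Ck_on_linear:
  assumes "bounded_linear h"
  shows "Ck_on k S h"
proof (cases k)
  case 0
  then show ?thesis using assms by (simp add: linear_continuous_on)
next
  case (Suc j)
  have "frechet_derivative h (at x) v = h v" for x v
    using assms by (intro frechet_derivative_eqI bounded_linear_imp_has_derivative)
  moreover have "h differentiable at x" for x
    using assms by (rule bounded_linear_imp_differentiable)
  ultimately show ?thesis using Suc by (simp add: Ck_on_const)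
qed

lemma Ck_on_add:
  assumes "open S" "Ck_on k S f" "Ck_on k S g"
  shows "Ck_on k S (\<lambda>x. f x + g x)"
  using assms(2,3)
proof (induction k arbitrary: f g)
  case 0
  then show ?case by (auto intro: continuous_intros)
next
  case (Suc k)
  have D: "f differentiable at x" "g differentiable at x" if "x \<in> S" for x
    using Suc.prems that by auto
  have "frechet_derivative (\<lambda>x. f x + g x) (at x) v =
      frechet_derivative f (at x) v + frechet_derivative g (at x) v" if "x \<in> S" for x v
    using D[OF that] by (intro frechet_derivative_eqI has_derivative_add) (simp_all add: frechet_derivative_works)
  then have "Ck_on k S (\<lambda>x. frechet_derivative (\<lambda>x. f x + g x) (at x) v)" for v
    using Suc by (subst Ck_on_cong[OF assms(1)]) auto
  then show ?case using D by auto
qed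

lemma (in bounded_bilinear) Ck_on_prod:
  assumes "open S" "Ck_on k S f" "Ck_on k S g"
  shows "Ck_on k S (\<lambda>x. prod (f x) (g x))"
  using assms(2,3)
proof (induction k arbitrary: f g)
  case 0
  then show ?case by (auto intro: continuous_on)
next
  case (Suc k)
  have D: "(f has_derivative frechet_derivative f (at x)) (at x)"
       "(g has_derivative frechet_derivative g (at x)) (at x)" if "x \<in> S" for x
    using Suc.prems that by (auto simp: frechet_derivative_works)
  have "frechet_derivative (\<lambda>x. prod (f x) (g x)) (at x) v =
      prod (f x) (frechet_derivative g (at x) v) + prod (frechet_derivative f (at x) v) (g x)"
    if "x \<in> S" for x v
    by (rule frechet_derivative_eqI[OF FDERIV[OF D[OF that]]])
  moreover have "Ck_on k S f" "Ck_on k S g" using Suc.prems by (auto intro: Ck_on_Suc_imp)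
  ultimately have "Ck_on k S (\<lambda>x. frechet_derivative (\<lambda>x. prod (f x) (g x)) (at x) v)" for v
    using Suc by (subst Ck_on_cong[OF assms(1)]) (auto intro!: Ck_on_add assms(1))
  moreover have "(\<lambda>x. prod (f x) (g x)) differentiable at x" if "x \<in> S" for x
    using FDERIV[OF D[OF that]] by (auto simp: differentiable_def)
  ultimately show ?case by auto
qed

lemma Ck_on_sum:
  assumes "open S" "\<And>i. i \<in> I \<Longrightarrow> Ck_on k S (f i)"
  shows "Ck_on k S (\<lambda>x. \<Sum>i\<in>I. f i x)"
  using assms(2)
  by (induction I rule: infinite_finite_induct) (auto intro: Ck_on_const Ck_on_add assms(1))

lemma Ck_on_linear_comp:
  assumes "open S" "bounded_linear h" "Ck_on k S f"
  shows "Ck_on k S (\<lambda>x. h (f x))"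
  using assms(3)
proof (induction k arbitrary: f)
  case 0
  then show ?case
    using assms(2) by (auto intro: bounded_linear.continuous_on)
next
  case (Suc k)
  have D: "((\<lambda>x. h (f x)) has_derivative (\<lambda>v. h (frechet_derivative f (at x) v))) (at x)" if "x \<in> S" for x
    using Suc.prems that
    by (auto simp: frechet_derivative_works intro!: bounded_linear.has_derivative[OF assms(2)])
  have "frechet_derivative (\<lambda>x. h (f x)) (at x) v = h (frechet_derivative f (at x) v)"
    if "x \<in> S" for x v
    by (rule frechet_derivative_eqI[OF D[OF that]])
  then have "Ck_on k S (\<lambda>x. frechet_derivative (\<lambda>x. h (f x)) (at x) v)" for v
    using Suc by (subst Ck_on_cong[OF assms(1)]) auto
  then show ?case using D by (auto simp: differentiable_def)
qed

lemma Ck_on_euclidean: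
  fixes f :: "'a::real_normed_vector \<Rightarrow> 'b::euclidean_space"
  assumes "open S" "\<And>b. b \<in> Basis \<Longrightarrow> Ck_on k S (\<lambda>x. f x \<bullet> b)"
  shows "Ck_on k S f"
proof -
  have "Ck_on k S (\<lambda>x. \<Sum>b\<in>Basis. (f x \<bullet> b) *\<^sub>R b)"
    using assms by (intro Ck_on_sum Ck_on_linear_comp[where h = "\<lambda>r. r *\<^sub>R _"] bounded_linear_scaleR_left)
  then show ?thesis by (simp add: euclidean_representation)
qed

text \<open>In the chain rule the direction \<open>g'(x) v\<close> varies with x, while the
  induction hypothesis speaks of derivatives of f in constant directions only. Expanding the
  direction over a basis of the intermediate space separates the two, which is why that space is
  Euclidean.\<close>

lemma Ck_on_compose:
  fixes g :: "'a::real_normed_vector \<Rightarrow> 'b::euclidean_space"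
  assumes "open S" "open T" "g ` S \<subseteq> T" "Ck_on k T f" "Ck_on k S g"
  shows "Ck_on k S (\<lambda>x. f (g x))"
  using assms(4,5)
proof (induction k arbitrary: f)
  case 0
  then show ?case
    using assms(3) by (auto intro: continuous_on_compose2)
next
  case (Suc k)
  have gD: "(g has_derivative frechet_derivative g (at x)) (at x)" if "x \<in> S" for x
    using Suc.prems that by (auto simp: frechet_derivative_works)
  have fD: "(f has_derivative frechet_derivative f (at (g x))) (at (g x))" if "x \<in> S" for x
    using Suc.prems that assms(3) by (auto simp: frechet_derivative_works)
  have D: "((\<lambda>x. f (g x)) has_derivative (\<lambda>v. frechet_derivative f (at (g x)) (frechet_derivative g (at x) v))) (at x)"
    if "x \<in> S" for x
    using has_derivative_compose[OF gD fD] that by blast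
  have "frechet_derivative (\<lambda>x. f (g x)) (at x) v =
      (\<Sum>b\<in>Basis. (frechet_derivative g (at x) v \<bullet> b) *\<^sub>R frechet_derivative f (at (g x)) b)"
    if "x \<in> S" for x v
  proof -
    have lin: "linear (frechet_derivative f (at (g x)))"
      using fD[OF that] by (auto intro: has_derivative_linear)
    have "frechet_derivative (\<lambda>x. f (g x)) (at x) v = frechet_derivative f (at (g x)) (frechet_derivative g (at x) v)"
      by (rule frechet_derivative_eqI[OF D[OF that]])
    also have "\<dots> = frechet_derivative f (at (g x)) (\<Sum>b\<in>Basis. (frechet_derivative g (at x) v \<bullet> b) *\<^sub>R b)"
      by (simp add: euclidean_representation)
    finally show ?thesis
      by (simp add: linear_sum[OF lin] linear_scale[OF lin])
  qed
  moreover have "Ck_on k S (\<lambda>x. \<Sum>b\<in>Basis. (frechet_derivative g (at x) v \<bullet> b) *\<^sub>R frechet_derivative f (at (g x)) b)" for v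
  proof (intro Ck_on_sum bounded_bilinear.Ck_on_prod[OF bounded_bilinear_scaleR] assms(1))
    fix b :: 'b
    show "Ck_on k S (\<lambda>x. frechet_derivative g (at x) v \<bullet> b)"
      using Suc.prems by (intro Ck_on_linear_comp[OF assms(1) bounded_linear_inner_left]) auto
    show "Ck_on k S (\<lambda>x. frechet_derivative f (at (g x)) b)"
      using Suc.prems Ck_on_Suc_imp by (intro Suc.IH) auto
  qed
  ultimately have "Ck_on k S (\<lambda>x. frechet_derivative (\<lambda>x. f (g x)) (at x) v)" for v
    by (subst Ck_on_cong[OF assms(1)]) auto
  then show ?case using D by (auto simp: differentiable_def)
qed

lemma smooth_on_eq:
  "open S \<Longrightarrow> smooth_on S g \<Longrightarrow> (\<And>x. x \<in> S \<Longrightarrow> f x = g x) \<Longrightarrow> smooth_on S f"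
  unfolding smooth_on_def using Ck_on_cong by metis

lemma smooth_on_subset: "smooth_on S f \<Longrightarrow> T \<subseteq> S \<Longrightarrow> smooth_on T f"
  unfolding smooth_on_def using Ck_on_subset by blast

lemma smooth_on_const: "smooth_on S (\<lambda>_. c)"
  by (simp add: smooth_on_def Ck_on_const)

lemma smooth_on_linear: "bounded_linear h \<Longrightarrow> smooth_on S h"
  by (simp add: smooth_on_def Ck_on_linear)

lemma smooth_on_linear_comp: "open S \<Longrightarrow> bounded_linear h \<Longrightarrow> smooth_on S f \<Longrightarrow> smooth_on S (\<lambda>x. h (f x))"
  by (simp add: smooth_on_def Ck_on_linear_comp)

lemma smooth_on_add: "open S \<Longrightarrow> smooth_on S f \<Longrightarrow> smooth_on S g \<Longrightarrow> smooth_on S (\<lambda>x. f x + g x)"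
  by (simp add: smooth_on_def Ck_on_add)

lemma smooth_on_scaleR: "open S \<Longrightarrow> smooth_on S f \<Longrightarrow> smooth_on S g \<Longrightarrow> smooth_on S (\<lambda>x. f x *\<^sub>R g x)"
  by (simp add: smooth_on_def bounded_bilinear.Ck_on_prod[OF bounded_bilinear_scaleR])

lemma smooth_on_mult:
  fixes f :: "_ \<Rightarrow> 'b::real_normed_algebra"
  shows "open S \<Longrightarrow> smooth_on S f \<Longrightarrow> smooth_on S g \<Longrightarrow> smooth_on S (\<lambda>x. f x * g x)"
  by (simp add: smooth_on_def bounded_bilinear.Ck_on_prod[OF bounded_bilinear_mult])

lemma smooth_on_sum:
  "open S \<Longrightarrow> (\<And>i. i \<in> I \<Longrightarrow> smooth_on S (f i)) \<Longrightarrow> smooth_on S (\<lambda>x. \<Sum>i\<in>I. f i x)"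
  by (simp add: smooth_on_def Ck_on_sum)

lemma smooth_on_compose:
  fixes g :: "'a::real_normed_vector \<Rightarrow> 'b::euclidean_space"
  shows "open S \<Longrightarrow> open T \<Longrightarrow> g ` S \<subseteq> T \<Longrightarrow> smooth_on T f \<Longrightarrow> smooth_on S g \<Longrightarrow> smooth_on S (\<lambda>x. f (g x))"
  unfolding smooth_on_def using Ck_on_compose by blast

lemma smooth_on_Pair:
  assumes "open S" "smooth_on S f" "smooth_on S g"
  shows "smooth_on S (\<lambda>x. (f x, g x))"
proof -
  have "smooth_on S (\<lambda>x. (f x, 0) + (0, g x))"
    using assms by (intro smooth_on_add smooth_on_linear_comp[where h = "\<lambda>u. (u, 0)"]
        smooth_on_linear_comp[where h = "\<lambda>u. (0, u)"] bounded_linear_Pair bounded_linear_ident bounded_linear_zero)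
  then show ?thesis by simp
qed

lemma smooth_on_differentiable: "smooth_on S f \<Longrightarrow> x \<in> S \<Longrightarrow> f differentiable (at x)"
  unfolding smooth_on_def by (metis Ck_on.simps(2))

lemma smooth_on_has_derivative:
  "smooth_on S f \<Longrightarrow> x \<in> S \<Longrightarrow> (f has_derivative frechet_derivative f (at x)) (at x)"
  using smooth_on_differentiable frechet_derivative_works by blast

lemma smooth_on_deriv: "smooth_on S f \<Longrightarrow> smooth_on S (\<lambda>x. frechet_derivative f (at x) v)"
  unfolding smooth_on_def by (metis Ck_on.simps(2))

lemma smooth_on_continuous_on: "smooth_on S f \<Longrightarrow> continuous_on S f"
  unfolding smooth_on_def by (metis Ck_on.simps(1))

lemma smooth_on_vec_nth: "open S \<Longrightarrow> smooth_on S f \<Longrightarrow> smooth_on S (\<lambda>x. f x $ i)"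
  by (rule smooth_on_linear_comp[OF _ bounded_linear_vec_nth])

lemma smooth_on_vecI:
  fixes f :: "'a::real_normed_vector \<Rightarrow> real^'n"
  assumes "open S" "\<And>i. smooth_on S (\<lambda>x. f x $ i)"
  shows "smooth_on S f"
  unfolding smooth_on_def
proof (rule allI, rule Ck_on_euclidean[OF assms(1)])
  fix k and b :: "real^'n" assume "b \<in> Basis"
  then obtain i where "b = axis i 1" by (auto simp: Basis_vec_def)
  then show "Ck_on k S (\<lambda>x. f x \<bullet> b)"
    using assms(2)[of i] by (simp add: smooth_on_def inner_axis)
qed

lemma smooth_on_snd_nth: "smooth_on S (\<lambda>z. snd z $ b)"
  by (rule smooth_on_linear[OF bounded_linear_compose[OF bounded_linear_vec_nth bounded_linear_snd]])

section \<open>Symmetry of second derivatives\<close>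

lemma directional_mvt:
  fixes f :: "'a::real_normed_vector \<Rightarrow> real"
  assumes "0 < s" "\<And>t. 0 \<le> t \<Longrightarrow> t \<le> s \<Longrightarrow> f differentiable at (p + t *\<^sub>R u)"
  obtains t where "0 < t" "t < s" "f (p + s *\<^sub>R u) - f p = s * frechet_derivative f (at (p + t *\<^sub>R u)) u"
proof -
  have "((\<lambda>t. f (p + t *\<^sub>R u)) has_real_derivative frechet_derivative f (at (p + t *\<^sub>R u)) u) (at t)"
    if "0 \<le> t" "t \<le> s" for t
  proof -
    have f: "(f has_derivative frechet_derivative f (at (p + t *\<^sub>R u))) (at (p + t *\<^sub>R u))"
      using assms(2)[OF that] by (simp add: frechet_derivative_works)
    have "((\<lambda>t. p + t *\<^sub>R u) has_derivative (\<lambda>h. h *\<^sub>R u)) (at t)"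
      by (auto intro!: derivative_eq_intros)
    from has_derivative_compose[OF this f] show ?thesis
      by (simp add: has_field_derivative_def linear_scale[OF has_derivative_linear[OF f]] mult.commute[of _ "frechet_derivative _ _ _"])
  qed
  from MVT2[OF assms(1), of "\<lambda>t. f (p + t *\<^sub>R u)", OF this] that show ?thesis
    by auto
qed

text \<open>The mean value theorem is used twice: in direction u for the increment
  \<open>f (z + s v) - f z\<close>, then in direction v for the derivative of f along u.\<close>

lemma second_difference:
  fixes f :: "'a::real_normed_vector \<Rightarrow> real"
  assumes s: "0 < s" and f: "smooth_on S f"
    and sub: "\<And>t r. 0 \<le> t \<Longrightarrow> t \<le> s \<Longrightarrow> 0 \<le> r \<Longrightarrow> r \<le> s \<Longrightarrow> x + t *\<^sub>R u + r *\<^sub>R v \<in> S"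
  obtains t r where "0 < t" "t < s" "0 < r" "r < s"
    "f (x + s *\<^sub>R u + s *\<^sub>R v) - f (x + s *\<^sub>R u) - f (x + s *\<^sub>R v) + f x
      = s\<^sup>2 * frechet_derivative (\<lambda>z. frechet_derivative f (at z) u) (at (x + t *\<^sub>R u + r *\<^sub>R v)) v"
proof -
  let ?h = "\<lambda>z. f (z + s *\<^sub>R v) - f z"
  have d: "(?h has_derivative (\<lambda>w. frechet_derivative f (at (x + t *\<^sub>R u + s *\<^sub>R v)) w
       - frechet_derivative f (at (x + t *\<^sub>R u)) w)) (at (x + t *\<^sub>R u))" if "0 \<le> t" "t \<le> s" for t
  proof (intro has_derivative_diff)
    show "(f has_derivative frechet_derivative f (at (x + t *\<^sub>R u))) (at (x + t *\<^sub>R u))"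
      using sub[of t 0] that s by (intro smooth_on_has_derivative[OF f]) auto
    have "(f has_derivative frechet_derivative f (at (x + t *\<^sub>R u + s *\<^sub>R v))) (at (x + t *\<^sub>R u + s *\<^sub>R v))"
      using sub[of t s] that s by (intro smooth_on_has_derivative[OF f]) auto
    moreover have "((\<lambda>z. z + s *\<^sub>R v) has_derivative (\<lambda>w. w)) (at (x + t *\<^sub>R u))"
      by (auto intro!: derivative_eq_intros)
    ultimately show "((\<lambda>z. f (z + s *\<^sub>R v)) has_derivative
        frechet_derivative f (at (x + t *\<^sub>R u + s *\<^sub>R v))) (at (x + t *\<^sub>R u))"
      using has_derivative_compose by fastforce
  qed
  obtain t where t: "0 < t" "t < s"
    and 1: "?h (x + s *\<^sub>R u) - ?h x = s * frechet_derivative ?h (at (x + t *\<^sub>R u)) u"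
    using d by (rule_tac directional_mvt[OF s, of ?h x u]) (auto simp: differentiable_def)
  let ?k = "\<lambda>z. frechet_derivative f (at z) u"
  have 2: "frechet_derivative ?h (at (x + t *\<^sub>R u)) u = ?k (x + t *\<^sub>R u + s *\<^sub>R v) - ?k (x + t *\<^sub>R u)"
    using t by (intro frechet_derivative_eqI d) auto
  obtain r where r: "0 < r" "r < s"
    and 3: "?k (x + t *\<^sub>R u + s *\<^sub>R v) - ?k (x + t *\<^sub>R u) = s * frechet_derivative ?k (at (x + t *\<^sub>R u + r *\<^sub>R v)) v"
    using t sub by (rule_tac directional_mvt[OF s, of ?k "x + t *\<^sub>R u" v])
      (auto intro: smooth_on_differentiable[OF smooth_on_deriv[OF f]])
  show ?thesis
    using that[OF t r] 1 unfolding 2 3 by (simp add: power2_eq_square algebra_simps)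
qed

text \<open>The second difference over a parallelogram is symmetric in u and v, and by
  \<open>second_difference\<close> it equals s^2 times either mixed derivative at some nearby point.
  Continuity of both mixed derivatives brings them back to x.\<close>

lemma frechet_derivative_commute:
  fixes f :: "'a::real_normed_vector \<Rightarrow> real"
  assumes S: "open S" "x \<in> S" and f: "smooth_on S f"
  shows "frechet_derivative (\<lambda>z. frechet_derivative f (at z) u) (at x) v =
    frechet_derivative (\<lambda>z. frechet_derivative f (at z) v) (at x) u"
proof -
  define P where "P u v z = frechet_derivative (\<lambda>z. frechet_derivative f (at z) u) (at z) v" for u v z
  have "continuous_on S (P u v)" for u v
    unfolding P_def by (intro smooth_on_continuous_on smooth_on_deriv f)
  then have cont: "isCont (P u v) x" for u v
    using S by (simp add: continuous_on_eq_continuous_at)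
  have bound: "\<bar>P u v x - P v u x\<bar> \<le> 2 * e" if e: "e > 0" for e
  proof -
    have "eventually (\<lambda>z. z \<in> S \<and> dist (P u v z) (P u v x) < e \<and> dist (P v u z) (P v u x) < e) (at x)"
      using S cont e unfolding isCont_def
      by (intro eventually_conj tendstoD eventually_at_in_open') auto
    then obtain d where d: "d > 0"
      and near: "\<And>z. z \<noteq> x \<Longrightarrow> dist z x < d \<Longrightarrow> z \<in> S \<and> dist (P u v z) (P u v x) < e \<and> dist (P v u z) (P v u x) < e"
      by (auto simp: eventually_at)
    \<comment> \<open>The summand 1 keeps K positive when u and v both vanish; side length
      \<open>d / (2 * K)\<close> puts the whole parallelogram within distance d of x.\<close>
    define K where "K = norm u + norm v + 1"
    have K: "K > 0" unfolding K_def by (intro add_nonneg_pos) auto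
    define s where "s = d / (2 * K)"
    have s: "s > 0" using d K by (simp add: s_def)
    have *: "dist (x + t *\<^sub>R a + r *\<^sub>R b) x < d"
      if "{a, b} = {u, v}" "0 \<le> t" "t \<le> s" "0 \<le> r" "r \<le> s" for t r a b
    proof -
      have "dist (x + t *\<^sub>R a + r *\<^sub>R b) x \<le> t * norm a + r * norm b"
        using that norm_triangle_ineq[of "t *\<^sub>R a" "r *\<^sub>R b"] by (simp add: dist_norm add.assoc)
      also have "\<dots> \<le> s * norm a + s * norm b"
        using that by (intro add_mono mult_right_mono) auto
      also have "\<dots> < 2 * s * K"
      proof -
        have "norm a + norm b \<le> 2 * (norm u + norm v)"
          using \<open>{a, b} = {u, v}\<close> by (auto simp: doubleton_eq_iff)
        then have "s * (norm a + norm b) < s * (2 * K)"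
          using s by (intro mult_strict_left_mono) (auto simp: K_def)
        then show ?thesis by (simp add: algebra_simps)
      qed
      also have "\<dots> = d" using K by (simp add: s_def)
      finally show ?thesis .
    qed
    \<comment> \<open>The choice of d says nothing about x itself, and the displaced point can
      coincide with x for nonzero t and r, for example if b = - a. Hence the case distinction here
      and in the next claim.\<close>
    have sub: "x + t *\<^sub>R a + r *\<^sub>R b \<in> S"
      if "{a, b} = {u, v}" "0 \<le> t" "t \<le> s" "0 \<le> r" "r \<le> s" for t r a b
    proof (cases "x + t *\<^sub>R a + r *\<^sub>R b = x")
      case True
      show ?thesis unfolding True by (rule S(2))
    qed (use near[OF _ *[OF that]] in blast)
    have close: "dist (P a b (x + t *\<^sub>R a + r *\<^sub>R b)) (P a b x) < e"
      if "{a, b} = {u, v}" "0 \<le> t" "t \<le> s" "0 \<le> r" "r \<le> s" for t r a b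
    proof (cases "x + t *\<^sub>R a + r *\<^sub>R b = x")
      case True
      show ?thesis unfolding True using e by simp
    next
      case False
      then show ?thesis
        using near[OF False *[OF that]] that(1) unfolding doubleton_eq_iff by blast
    qed
    obtain t r where tr: "0 < t" "t < s" "0 < r" "r < s"
      and 1: "f (x + s *\<^sub>R u + s *\<^sub>R v) - f (x + s *\<^sub>R u) - f (x + s *\<^sub>R v) + f x = s\<^sup>2 * P u v (x + t *\<^sub>R u + r *\<^sub>R v)"
      by (rule second_difference[OF s f sub[of u v, OF refl], folded P_def])
    obtain t' r' where tr': "0 < t'" "t' < s" "0 < r'" "r' < s"
      and 2: "f (x + s *\<^sub>R v + s *\<^sub>R u) - f (x + s *\<^sub>R v) - f (x + s *\<^sub>R u) + f x = s\<^sup>2 * P v u (x + t' *\<^sub>R v + r' *\<^sub>R u)"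
      by (rule second_difference[OF s f sub[of v u, OF insert_commute], folded P_def])
    have "s\<^sup>2 * P u v (x + t *\<^sub>R u + r *\<^sub>R v) = s\<^sup>2 * P v u (x + t' *\<^sub>R v + r' *\<^sub>R u)"
      unfolding 1[symmetric] 2[symmetric] by (simp add: add.commute add.left_commute)
    then have "P u v (x + t *\<^sub>R u + r *\<^sub>R v) = P v u (x + t' *\<^sub>R v + r' *\<^sub>R u)"
      using s by simp
    moreover have "dist (P u v (x + t *\<^sub>R u + r *\<^sub>R v)) (P u v x) < e"
      using tr by (intro close) auto
    moreover have "dist (P v u (x + t' *\<^sub>R v + r' *\<^sub>R u)) (P v u x) < e"
      using tr' by (intro close) auto
    ultimately show ?thesis
      by (simp add: dist_real_def)
  qed
  have "\<bar>P u v x - P v u x\<bar> \<le> 0 + e" if "e > 0" for e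
    using bound[of "e / 2"] that by simp
  then have "\<bar>P u v x - P v u x\<bar> \<le> 0"
    by (rule field_le_epsilon)
  then show ?thesis by (simp add: P_def)
qed

section \<open>Charts and tangent vectors\<close>

lemma chart_inv_image:
  assumes "z \<in> chart_image c"
  shows chart_inv_in: "chart_inv c z \<in> fst c" and chart_inv_right: "snd c (chart_inv c z) = z"
  using assms unfolding chart_image_def chart_inv_def by (auto intro: inv_into_into f_inv_into_f)

locale atlas =
  fixes A :: "('p, 'e::euclidean_space) chart set"
  assumes smooth_atlas: "smooth_atlas A"
begin

abbreviation transition :: "('p, 'e) chart \<Rightarrow> ('p, 'e) chart \<Rightarrow> 'e \<Rightarrow> 'e" where
  "transition c c' \<equiv> snd c' \<circ> chart_inv c"

abbreviation transition_deriv :: "('p, 'e) chart \<Rightarrow> ('p, 'e) chart \<Rightarrow> 'p \<Rightarrow> 'e \<Rightarrow> 'e" where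
  "transition_deriv c c' p \<equiv> frechet_derivative (transition c c') (at (snd c p))"

lemma chart_inv_left: "c \<in> A \<Longrightarrow> p \<in> fst c \<Longrightarrow> chart_inv c (snd c p) = p"
  using smooth_atlas by (simp add: smooth_atlas_def chart_inv_def)

lemma open_chart_image: "c \<in> A \<Longrightarrow> open (chart_image c)"
  using smooth_atlas by (simp add: smooth_atlas_def)

lemma open_overlap: "c \<in> A \<Longrightarrow> c' \<in> A \<Longrightarrow> open (snd c ` (fst c \<inter> fst c'))"
  using smooth_atlas by (simp add: smooth_atlas_def)

lemma smooth_transition:
  "c \<in> A \<Longrightarrow> c' \<in> A \<Longrightarrow> smooth_on (snd c ` (fst c \<inter> fst c')) (transition c c')"
  using smooth_atlas by (simp add: smooth_atlas_def)

lemma transition_has_derivative: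
  assumes "c \<in> A" "c' \<in> A" "p \<in> fst c" "p \<in> fst c'"
  shows "(transition c c' has_derivative transition_deriv c c' p) (at (snd c p))"
  using smooth_transition[OF assms(1,2)] assms(3,4) by (intro smooth_on_has_derivative) auto

lemma linear_transition_deriv:
  "c \<in> A \<Longrightarrow> c' \<in> A \<Longrightarrow> p \<in> fst c \<Longrightarrow> p \<in> fst c' \<Longrightarrow> linear (transition_deriv c c' p)"
  using transition_has_derivative has_derivative_linear by blast

text \<open>Chain rule for the two local representatives of f. They are related by the transition
  map on the overlap only, but the overlap has open image, so the derivative does not see the
  difference.\<close>

lemma change_of_chart:
  assumes c: "c \<in> A" "c' \<in> A" "p \<in> fst c" "p \<in> fst c'"
    and f: "((f \<circ> chart_inv c') has_derivative D) (at (snd c' p))"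
  shows "((f \<circ> chart_inv c) has_derivative (\<lambda>w. D (transition_deriv c c' p w))) (at (snd c p))"
proof -
  have "transition c c' (snd c p) = snd c' p"
    using c by (simp add: chart_inv_left)
  with f have "((\<lambda>z. (f \<circ> chart_inv c') (transition c c' z)) has_derivative
      (\<lambda>w. D (transition_deriv c c' p w))) (at (snd c p))"
    using has_derivative_compose[OF transition_has_derivative[OF c]] by metis
  then show ?thesis
  proof (rule has_derivative_transform_within_open[OF _ open_overlap[OF c(1,2)]])
    show "snd c p \<in> snd c ` (fst c \<inter> fst c')" using c by blast
    show "(f \<circ> chart_inv c') (transition c c' z) = (f \<circ> chart_inv c) z"
      if "z \<in> snd c ` (fst c \<inter> fst c')" for z
      using that c by (auto simp: chart_inv_left)
  qed
qed

lemma transition_deriv_self: "c \<in> A \<Longrightarrow> p \<in> fst c \<Longrightarrow> transition_deriv c c p w = w"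
proof -
  assume c: "c \<in> A" "p \<in> fst c"
  have "(transition c c has_derivative (\<lambda>w. w)) (at (snd c p))"
  proof (rule has_derivative_transform_within_open[OF has_derivative_ident open_chart_image[OF c(1)]])
    show "snd c p \<in> chart_image c" using c by (auto simp: chart_image_def)
    show "z = transition c c z" if "z \<in> chart_image c" for z
      using that by (simp add: chart_inv_right)
  qed
  then show ?thesis by (rule frechet_derivative_eqI)
qed

lemma transition_deriv_cocycle:
  assumes "c \<in> A" "c' \<in> A" "c'' \<in> A" "p \<in> fst c" "p \<in> fst c'" "p \<in> fst c''"
  shows "transition_deriv c c'' p w = transition_deriv c' c'' p (transition_deriv c c' p w)"
  using assms by (intro frechet_derivative_eqI change_of_chart transition_has_derivative)

lemma coord_vector_in_tangent_space:
  assumes "c \<in> A" "p \<in> fst c"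
  shows "coord_vector A c p w \<in> tangent_space A p"
  using assms unfolding tangent_space_def coord_vector_def
  by (auto intro!: transition_deriv_cocycle)

lemma coord_vector_self: "c \<in> A \<Longrightarrow> p \<in> fst c \<Longrightarrow> coord_vector A c p w c = w"
  by (simp add: coord_vector_def transition_deriv_self)

lemma transition_deriv_component:
  assumes "v \<in> tangent_space A p" "c \<in> A" "c' \<in> A" "p \<in> fst c" "p \<in> fst c'"
  shows "transition_deriv c c' p (v c) = v c'"
proof -
  have "\<forall>c\<in>A. \<forall>c'\<in>A. p \<in> fst c \<longrightarrow> p \<in> fst c' \<longrightarrow> v c' = transition_deriv c c' p (v c)"
    using assms(1) unfolding tangent_space_def mem_Collect_eq by (rule conjunct1)
  with assms(2-5) show ?thesis by fastforce
qed

lemma tangent_component_outside: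
  "v \<in> tangent_space A p \<Longrightarrow> \<not> (c \<in> A \<and> p \<in> fst c) \<Longrightarrow> v c = 0"
  unfolding tangent_space_def mem_Collect_eq by blast

lemma coord_vector_of_component:
  assumes "v \<in> tangent_space A p" "c \<in> A" "p \<in> fst c"
  shows "coord_vector A c p (v c) = v"
  using assms transition_deriv_component[OF assms(1)] tangent_component_outside[OF assms(1)]
  by (intro ext) (simp add: coord_vector_def)

text \<open>One component determines all others by the transition derivatives, and the remaining
  charts carry 0. Global equations between tangent vectors are therefore checked in a single
  chart.\<close>

lemma tangent_eqI:
  assumes "v \<in> tangent_space A p" "w \<in> tangent_space A p" "c \<in> A" "p \<in> fst c" "v c = w c"
  shows "v = w"
  using assms coord_vector_of_component by metis

lemma coord_vector_linear:
  assumes "c \<in> A" "p \<in> fst c"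
  shows "coord_vector A c p (r *\<^sub>R u + v) = (\<lambda>c'. r *\<^sub>R coord_vector A c p u c' + coord_vector A c p v c')"
  using linear_transition_deriv[OF assms(1) _ assms(2)]
  by (intro ext) (simp add: coord_vector_def linear_add linear_scale)

lemma coord_vector_scaleR:
  assumes "c \<in> A" "p \<in> fst c"
  shows "coord_vector A c p (r *\<^sub>R u) = (\<lambda>c'. r *\<^sub>R coord_vector A c p u c')"
  using linear_transition_deriv[OF assms(1) _ assms(2)] by (intro ext) (simp add: coord_vector_def linear_scale)

lemma coord_vector_sum:
  assumes "c \<in> A" "p \<in> fst c"
  shows "coord_vector A c p (\<Sum>i\<in>I. f i) = (\<lambda>c'. \<Sum>i\<in>I. coord_vector A c p (f i) c')"
  using linear_transition_deriv[OF assms(1) _ assms(2)] by (intro ext, rename_tac c', case_tac "c' \<in> A \<and> p \<in> fst c'") (auto simp: coord_vector_def linear_sum intro!: sum.neutral)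

lemma tangent_space_linear:
  assumes "u \<in> tangent_space A p" "v \<in> tangent_space A p"
  shows "(\<lambda>c. r *\<^sub>R u c + v c) \<in> tangent_space A p"
proof -
  have "r *\<^sub>R u c' + v c' = transition_deriv c c' p (r *\<^sub>R u c + v c)"
    if c: "c \<in> A" "c' \<in> A" "p \<in> fst c" "p \<in> fst c'" for c c'
  proof -
    show ?thesis
      using linear_transition_deriv[OF c] assms c
      by (simp add: linear_add linear_scale transition_deriv_component)
  qed
  moreover have "r *\<^sub>R u c + v c = 0" if "\<not> (c \<in> A \<and> p \<in> fst c)" for c
    using assms that by (simp add: tangent_component_outside)
  ultimately show ?thesis unfolding tangent_space_def by blast
qed

lemma zero_in_tangent_space: "(\<lambda>_. 0) \<in> tangent_space A p"
  using linear_transition_deriv by (auto simp: tangent_space_def linear_0)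

lemma tangent_space_scaleR: "u \<in> tangent_space A p \<Longrightarrow> (\<lambda>c. r *\<^sub>R u c) \<in> tangent_space A p"
  using tangent_space_linear[OF _ zero_in_tangent_space, of u p r] by simp

lemma tangent_space_sum:
  assumes "\<And>i. i \<in> I \<Longrightarrow> v i \<in> tangent_space A p"
  shows "(\<lambda>c. \<Sum>i\<in>I. f i *\<^sub>R v i c) \<in> tangent_space A p"
  using assms
  by (induction I rule: infinite_finite_induct) (auto intro: zero_in_tangent_space tangent_space_linear)

text \<open>Removes the choice of chart from \<open>tangent_deriv\<close>: the components of v
  transform by exactly the derivative that the chain rule produces.\<close>

lemma tangent_deriv_chart:
  assumes v: "v \<in> tangent_space A p" and c: "c \<in> A" "p \<in> fst c"
    and f: "((f \<circ> chart_inv c) has_derivative D) (at (snd c p))"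
  shows "tangent_deriv A p v f = D (v c)"
proof -
  define c0 where "c0 = (SOME c. c \<in> A \<and> p \<in> fst c)"
  have c0: "c0 \<in> A" "p \<in> fst c0"
    using someI[of "\<lambda>c. c \<in> A \<and> p \<in> fst c", OF conjI[OF c]] unfolding c0_def by blast+
  have "frechet_derivative (f \<circ> chart_inv c0) (at (snd c0 p)) (v c0) = D (transition_deriv c0 c p (v c0))"
    by (rule frechet_derivative_eqI[OF change_of_chart[OF c0(1) c(1) c0(2) c(2) f]])
  also have "transition_deriv c0 c p (v c0) = v c"
    using v c c0 by (intro transition_deriv_component)
  finally show ?thesis unfolding tangent_deriv_def Let_def c0_def .
qed

lemma openin_iff: "openin (atlas_topology A) W \<longleftrightarrow> atlas_open A W"
  by (rule openin_atlas_topology[OF smooth_atlas])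

lemma openin_chart: "c \<in> A \<Longrightarrow> openin (atlas_topology A) (fst c)"
  unfolding openin_iff atlas_open_def atlas_carrier_def
  by (auto simp: Int_commute open_overlap)

lemma open_chart_image_Int: "c \<in> A \<Longrightarrow> openin (atlas_topology A) W \<Longrightarrow> open (snd c ` (W \<inter> fst c))"
  by (simp add: openin_iff atlas_open_def)

end

section \<open>The induced atlas of the slit tangent bundle\<close>

lemma fst_lift_chart: "fst (lift_chart A c) = {X \<in> slit_bundle A. fst X \<in> fst c}"
  and snd_lift_chart: "snd (lift_chart A c) X = (snd c (fst X), snd X c)"
  by (simp_all add: lift_chart_def)

locale slit = atlas A for A :: "('m, 'n::finite) mchart set"
begin

lemma slit_point:
  assumes "c \<in> A" "x \<in> chart_image c" "y \<noteq> 0"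
  defines "p \<equiv> chart_inv c x"
  shows "(p, coord_vector A c p y) \<in> fst (lift_chart A c)"
    and "snd (lift_chart A c) (p, coord_vector A c p y) = (x, y)"
proof -
  have p: "p \<in> fst c" "snd c p = x"
    using assms by (auto simp: p_def chart_inv_in chart_inv_right)
  have y: "coord_vector A c p y c = y"
    using assms(1) p by (simp add: coord_vector_self)
  then have "coord_vector A c p y \<noteq> (\<lambda>_. 0)" using assms(3) by auto
  then show "(p, coord_vector A c p y) \<in> fst (lift_chart A c)"
    using assms(1) p
    by (auto simp: fst_lift_chart slit_bundle_def atlas_carrier_def coord_vector_in_tangent_space)
  show "snd (lift_chart A c) (p, coord_vector A c p y) = (x, y)"
    using p y by (simp add: snd_lift_chart)
qed

lemma lift_component_nonzero:
  assumes "c \<in> A" "X \<in> fst (lift_chart A c)"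
  shows "snd X c \<noteq> 0"
proof
  assume "snd X c = 0"
  with assms have "snd X = (\<lambda>_. 0)"
    by (intro tangent_eqI[of "snd X" "fst X" "\<lambda>_. 0" c])
      (auto simp: fst_lift_chart slit_bundle_def zero_in_tangent_space)
  with assms(2) show False by (simp add: fst_lift_chart slit_bundle_def case_prod_unfold)
qed

lemma inj_on_lift_chart: "c \<in> A \<Longrightarrow> inj_on (snd (lift_chart A c)) (fst (lift_chart A c))"
proof (rule inj_onI)
  fix X Y assume c: "c \<in> A" and X: "X \<in> fst (lift_chart A c)" and Y: "Y \<in> fst (lift_chart A c)"
    and eq: "snd (lift_chart A c) X = snd (lift_chart A c) Y"
  have "chart_inv c (snd c (fst X)) = chart_inv c (snd c (fst Y))"
    using eq by (simp add: snd_lift_chart)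
  then have "fst X = fst Y"
    using X Y chart_inv_left[OF c] by (simp add: fst_lift_chart)
  moreover have "snd X = snd Y"
    using X Y eq c \<open>fst X = fst Y\<close>
    by (intro tangent_eqI[of "snd X" "fst X" "snd Y" c]) (auto simp: fst_lift_chart snd_lift_chart slit_bundle_def)
  ultimately show "X = Y" by (simp add: prod_eq_iff)
qed

text \<open>Over an overlap the fibre coordinate runs through all nonzero vectors: it cannot be 0,
  since a tangent vector with one vanishing component is zero, and each nonzero value is attained by
  a coordinate vector. Chart domains of E are thus products, in particular cones in y.\<close>

lemma lift_overlap_image:
  assumes "c \<in> A" "c' \<in> A"
  shows "snd (lift_chart A c) ` (fst (lift_chart A c) \<inter> fst (lift_chart A c')) =
    snd c ` (fst c \<inter> fst c') \<times> (- {0})" (is "?L = ?R")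
proof
  show "?L \<subseteq> ?R"
    using lift_component_nonzero[OF assms(1)] by (auto simp: fst_lift_chart snd_lift_chart)
  show "?R \<subseteq> ?L"
  proof
    fix z assume "z \<in> ?R"
    then obtain p y where z: "z = (snd c p, y)" "p \<in> fst c" "p \<in> fst c'" "y \<noteq> 0" by auto
    have x: "snd c p \<in> chart_image c" using z by (auto simp: chart_image_def)
    let ?X = "(chart_inv c (snd c p), coord_vector A c (chart_inv c (snd c p)) y)"
    have "?X \<in> fst (lift_chart A c)" "snd (lift_chart A c) ?X = z"
      using slit_point[OF assms(1) x z(4)] z(1) by auto
    moreover from this have "?X \<in> fst (lift_chart A c')"
      using z assms by (auto simp: fst_lift_chart chart_inv_left)
    ultimately show "z \<in> ?L" by (metis Int_iff image_eqI)
  qed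
qed

lemma E_domain_eq: "c \<in> A \<Longrightarrow> E_domain A c = chart_image c \<times> (- {0})"
  using lift_overlap_image[of c c] by (simp add: chart_image_def)

lemma E_point_eq:
  assumes "c \<in> A" "x \<in> chart_image c" "y \<noteq> 0"
  shows "E_point A c (x, y) = (chart_inv c x, coord_vector A c (chart_inv c x) y)"
proof -
  have z: "(x, y) \<in> E_domain A c" using assms by (simp add: E_domain_eq)
  show ?thesis
    using inj_on_lift_chart[OF assms(1)] slit_point[OF assms] chart_inv_image[OF z]
    by (intro inj_onD[of "snd (lift_chart A c)" "fst (lift_chart A c)"]) auto
qed

text \<open>The coordinate change on E is \<open>(x, y) \<mapsto> (\<phi> x, \<phi>'(x) y)\<close>.
  Expanding y over a basis reduces joint smoothness to that of the derivatives of \<phi> in fixed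
  directions.\<close>

lemma smooth_lift_transition:
  assumes "c \<in> A" "c' \<in> A"
  shows "smooth_on (snd c ` (fst c \<inter> fst c') \<times> (- {0})) (snd (lift_chart A c') \<circ> E_point A c)"
proof -
  let ?O = "snd c ` (fst c \<inter> fst c')" and ?D = "snd c ` (fst c \<inter> fst c') \<times> (- {0::real^'n})"
  have O: "open ?O" using assms by (rule open_overlap)
  then have D: "open ?D" by (intro open_Times) auto
  let ?F = "\<lambda>z. (transition c c' (fst z),
      \<Sum>b\<in>Basis. (snd z \<bullet> b) *\<^sub>R frechet_derivative (transition c c') (at (fst z)) b)"
  have eq: "(snd (lift_chart A c') \<circ> E_point A c) z = ?F z" if "z \<in> ?D" for z
  proof -
    from that obtain p y where z: "z = (snd c p, y)" "p \<in> fst c" "p \<in> fst c'" "y \<noteq> 0"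
      by auto
    have x: "snd c p \<in> chart_image c" using z by (auto simp: chart_image_def)
    have "transition_deriv c c' p y = transition_deriv c c' p (\<Sum>b\<in>Basis. (y \<bullet> b) *\<^sub>R b)"
      by (simp add: euclidean_representation)
    then have "transition_deriv c c' p y = (\<Sum>b\<in>Basis. (y \<bullet> b) *\<^sub>R transition_deriv c c' p b)"
      using linear_transition_deriv[OF assms z(2,3)] by (simp add: linear_sum linear_scale)
    then show ?thesis
      using z assms by (simp add: E_point_eq[OF assms(1) x z(4)] snd_lift_chart chart_inv_left coord_vector_def)
  qed
  have fst: "smooth_on ?D (\<lambda>z. f (fst z))" if "smooth_on ?O f" for f :: "real^'n \<Rightarrow> real^'n"
    by (rule smooth_on_compose[OF D O _ that smooth_on_linear[OF bounded_linear_fst]]) auto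
  have summand: "smooth_on ?D (\<lambda>z. (snd z \<bullet> b) *\<^sub>R frechet_derivative (transition c c') (at (fst z)) b)" for b
  proof (rule smooth_on_scaleR[OF D])
    show "smooth_on ?D (\<lambda>z. snd z \<bullet> b)"
      by (rule smooth_on_linear[OF bounded_linear_compose[OF bounded_linear_inner_left bounded_linear_snd]])
    show "smooth_on ?D (\<lambda>z. frechet_derivative (transition c c') (at (fst z)) b)"
      by (rule fst[OF smooth_on_deriv[OF smooth_transition[OF assms]]])
  qed
  have "smooth_on ?D ?F"
  proof (rule smooth_on_Pair[OF D])
    show "smooth_on ?D (\<lambda>z. transition c c' (fst z))"
      by (rule fst[OF smooth_transition[OF assms]])
    show "smooth_on ?D (\<lambda>z. \<Sum>b\<in>Basis. (snd z \<bullet> b) *\<^sub>R frechet_derivative (transition c c') (at (fst z)) b)"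
      by (rule smooth_on_sum[OF D]) (rule summand)
  qed
  then show ?thesis by (rule smooth_on_eq[OF D]) (rule eq)
qed

lemma smooth_atlas_slit: "smooth_atlas (slit_atlas A)"
  unfolding smooth_atlas_def slit_atlas_def
  using open_overlap smooth_lift_transition
  by (auto simp: inj_on_lift_chart E_domain_eq lift_overlap_image open_chart_image
      intro!: open_Times)

sublocale slit: atlas "slit_atlas A"
  by unfold_locales (rule smooth_atlas_slit)

end

section \<open>Smoothness tested through a single chart\<close>

context atlas
begin

lemma transition_image:
  assumes "c \<in> A" "c' \<in> A"
  shows "transition c c' ` (snd c ` (fst c \<inter> fst c')) \<subseteq> snd c' ` (fst c \<inter> fst c')"
  using assms by (auto simp: chart_inv_left)

text \<open>Serves both manifolds: on M for the frames \<open>e_b\<close>, on E for the coordinate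
  fields along which connection forms are evaluated.\<close>

lemma smooth_coord_vector:
  assumes c: "c \<in> A" "c' \<in> A"
  shows "smooth_on (snd c' ` (fst c \<inter> fst c')) (\<lambda>z. coord_vector A c (chart_inv c' z) w c')"
proof -
  have O: "open (snd c' ` (fst c \<inter> fst c'))" "open (snd c ` (fst c \<inter> fst c'))"
    using open_overlap[OF c] open_overlap[OF c(2,1)] by (simp_all add: Int_commute)
  have "smooth_on (snd c' ` (fst c \<inter> fst c'))
      (\<lambda>z. frechet_derivative (transition c c') (at (transition c' c z)) w)"
  proof (rule smooth_on_compose[OF O, where g = "transition c' c"])
    show "transition c' c ` snd c' ` (fst c \<inter> fst c') \<subseteq> snd c ` (fst c \<inter> fst c')"
      using transition_image[OF c(2,1)] by (simp add: Int_commute)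
    show "smooth_on (snd c' ` (fst c \<inter> fst c')) (transition c' c)"
      using smooth_transition[OF c(2,1)] by (simp add: Int_commute)
    show "smooth_on (snd c ` (fst c \<inter> fst c')) (\<lambda>x. frechet_derivative (transition c c') (at x) w)"
      by (rule smooth_on_deriv[OF smooth_transition[OF c]])
  qed
  then show ?thesis
  proof (rule smooth_on_eq[OF O(1)])
    fix z assume "z \<in> snd c' ` (fst c \<inter> fst c')"
    then obtain p where "z = snd c' p" "p \<in> fst c" "p \<in> fst c'" by blast
    then show "coord_vector A c (chart_inv c' z) w c' =
        frechet_derivative (transition c c') (at (transition c' c z)) w"
      using c by (simp add: coord_vector_def chart_inv_left)
  qed
qed

lemma smooth_map_onI_chart:
  assumes c: "c \<in> A" and W: "openin (atlas_topology A) W" "W \<subseteq> fst c"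
    and f: "smooth_on (snd c ` W) (f \<circ> chart_inv c)"
  shows "smooth_map_on A W f"
  unfolding smooth_map_on_def
proof
  fix c' assume c': "c' \<in> A"
  have O: "open (snd c' ` (W \<inter> fst c'))" "open (snd c ` W)"
    using open_chart_image_Int[OF c' W(1)] open_chart_image_Int[OF c W(1)] W(2) by (simp_all add: Int_absorb2)
  have "smooth_on (snd c' ` (W \<inter> fst c')) (\<lambda>z. (f \<circ> chart_inv c) (transition c' c z))"
  proof (rule smooth_on_compose[OF O, where g = "transition c' c"])
    show "transition c' c ` snd c' ` (W \<inter> fst c') \<subseteq> snd c ` W"
      using W c c' by (auto simp: chart_inv_left)
    show "smooth_on (snd c' ` (W \<inter> fst c')) (transition c' c)"
      using W by (intro smooth_on_subset[OF smooth_transition[OF c' c]]) auto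
    show "smooth_on (snd c ` W) (f \<circ> chart_inv c)" by (rule f)
  qed
  then show "smooth_on (snd c' ` (W \<inter> fst c')) (f \<circ> chart_inv c')"
    by (rule smooth_on_eq[OF O(1)]) (use W c c' in \<open>auto simp: chart_inv_left\<close>)
qed

end

section \<open>Finsler connections in coordinates\<close>

context slit
begin

lemma lift_in_slit_atlas [simp]: "c \<in> A \<Longrightarrow> lift_chart A c \<in> slit_atlas A"
  by (simp add: slit_atlas_def)

lemma E_point_in: "z \<in> E_domain A c \<Longrightarrow> E_point A c z \<in> fst (lift_chart A c)"
  by (rule chart_inv_in)

lemma E_point_coords: "z \<in> E_domain A c \<Longrightarrow> snd (lift_chart A c) (E_point A c z) = z"
  by (rule chart_inv_right)

lemma fst_E_point: "z \<in> E_domain A c \<Longrightarrow> fst (E_point A c z) \<in> fst c"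
  using E_point_in[of z c] by (simp add: fst_lift_chart)

lemma E_point_components:
  assumes "z \<in> E_domain A c"
  shows "snd c (fst (E_point A c z)) = fst z" "snd (E_point A c z) c = snd z"
  using E_point_coords[OF assms] by (auto simp: snd_lift_chart prod_eq_iff)

lemma open_E_domain: "c \<in> A \<Longrightarrow> open (E_domain A c)"
  by (rule slit.open_chart_image) simp

lemma fst_E_point_eq:
  assumes "c \<in> A" "z \<in> E_domain A c"
  shows "fst (E_point A c z) = chart_inv c (fst z)"
  using chart_inv_left[OF assms(1) fst_E_point[OF assms(2)]] E_point_components[OF assms(2)] by simp

lemma slit_bundle_chart:
  assumes "X \<in> slit_bundle A"
  obtains c where "c \<in> A" "X \<in> fst (lift_chart A c)"
  using assms by (auto simp: slit_bundle_def atlas_carrier_def fst_lift_chart)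

lemma lift_overlap_subset_E_domain:
  "snd (lift_chart A c) ` (W \<inter> fst (lift_chart A c)) \<subseteq> E_domain A c"
  by (auto simp: chart_image_def)

lemma smooth_section_on_subset:
  "smooth_section_on A W S \<Longrightarrow> W' \<subseteq> W \<Longrightarrow> smooth_section_on A W' S"
  unfolding smooth_section_on_def
  by (intro conjI ballI) (blast, rule smooth_on_subset, blast, blast)

lemma smooth_section_on_add:
  assumes W: "openin (atlas_topology (slit_atlas A)) W"
    and S: "smooth_section_on A W S" "smooth_section_on A W S'"
  shows "smooth_section_on A W (\<lambda>X c. S X c + S' X c)"
  unfolding smooth_section_on_def
proof (intro conjI ballI)
  show "(\<lambda>c. S X c + S' X c) \<in> tangent_space A (fst X)" if "X \<in> W" for X
    using S that tangent_space_linear[of "S X" "fst X" "S' X" 1] by (simp add: smooth_section_on_def)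
  show "smooth_on (snd (lift_chart A c) ` (W \<inter> fst (lift_chart A c)))
      (\<lambda>z. S (E_point A c z) c + S' (E_point A c z) c)" if c: "c \<in> A" for c
    using S c unfolding smooth_section_on_def
    by (intro smooth_on_add slit.open_chart_image_Int[OF _ W]) auto
qed

lemma smooth_section_on_scaleR:
  assumes W: "openin (atlas_topology (slit_atlas A)) W"
    and f: "smooth_map_on (slit_atlas A) W f" and S: "smooth_section_on A W S"
  shows "smooth_section_on A W (\<lambda>X c. f X *\<^sub>R S X c)"
  unfolding smooth_section_on_def
proof (intro conjI ballI)
  show "(\<lambda>c. f X *\<^sub>R S X c) \<in> tangent_space A (fst X)" if "X \<in> W" for X
    using S that by (simp add: smooth_section_on_def tangent_space_scaleR)
  fix c assume c: "c \<in> A"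
  let ?D = "snd (lift_chart A c) ` (W \<inter> fst (lift_chart A c))"
  have "smooth_on ?D (f \<circ> E_point A c)"
    using f c by (auto simp: smooth_map_on_def)
  then have "smooth_on ?D (\<lambda>z. f (E_point A c z))" by (simp add: o_def)
  moreover have "smooth_on ?D (\<lambda>z. S (E_point A c z) c)"
    using S c by (auto simp: smooth_section_on_def)
  ultimately show "smooth_on ?D (\<lambda>z. f (E_point A c z) *\<^sub>R S (E_point A c z) c)"
    using c by (intro smooth_on_scaleR slit.open_chart_image_Int[OF _ W]) auto
qed

lemma smooth_section_on_zero: "smooth_section_on A W (\<lambda>X c. 0)"
  by (simp add: smooth_section_on_def zero_in_tangent_space smooth_on_const)

lemma smooth_section_on_sum:
  assumes W: "openin (atlas_topology (slit_atlas A)) W"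
    and "\<And>b. b \<in> I \<Longrightarrow> smooth_map_on (slit_atlas A) W (f b)" "\<And>b. b \<in> I \<Longrightarrow> smooth_section_on A W (S b)"
  shows "smooth_section_on A W (\<lambda>X c. \<Sum>b\<in>I. f b X *\<^sub>R S b X c)"
  using assms(2,3)
  by (induction I rule: infinite_finite_induct)
    (auto simp: smooth_section_on_zero intro!: smooth_section_on_add[OF W] smooth_section_on_scaleR[OF W])

lemma smooth_coord_frame:
  assumes c: "c \<in> A"
  shows "smooth_section_on A (fst (lift_chart A c)) (coord_frame A c b)"
  unfolding smooth_section_on_def
proof (intro conjI ballI)
  show "coord_frame A c b X \<in> tangent_space A (fst X)" if "X \<in> fst (lift_chart A c)" for X
    using c that by (simp add: coord_frame_def fst_lift_chart coord_vector_in_tangent_space)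
  fix c' assume c': "c' \<in> A"
  let ?O = "snd c' ` (fst c \<inter> fst c')"
  have D: "snd (lift_chart A c') ` (fst (lift_chart A c) \<inter> fst (lift_chart A c')) = ?O \<times> (- {0})"
    using lift_overlap_image[OF c' c] by (simp add: Int_commute)
  have O: "open ?O" using open_overlap[OF c' c] by (simp add: Int_commute)
  then have OD: "open (?O \<times> (- {0::real^'n}))" by (intro open_Times) auto
  have "smooth_on (?O \<times> (- {0::real^'n})) (\<lambda>z. coord_vector A c (chart_inv c' (fst z)) (axis b 1) c')"
    by (rule smooth_on_compose[OF OD O _ smooth_coord_vector[OF c c'] smooth_on_linear[OF bounded_linear_fst]]) auto
  then show "smooth_on (snd (lift_chart A c') ` (fst (lift_chart A c) \<inter> fst (lift_chart A c')))
      (\<lambda>z. coord_frame A c b (E_point A c' z) c')"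
    unfolding D
  proof (rule smooth_on_eq[OF OD])
    fix z :: "(real^'n) \<times> (real^'n)" assume "z \<in> ?O \<times> (- {0})"
    then have "z \<in> E_domain A c'"
      unfolding E_domain_eq[OF c'] by (auto simp: chart_image_def)
    then show "coord_frame A c b (E_point A c' z) c' = coord_vector A c (chart_inv c' (fst z)) (axis b 1) c'"
      using c' by (simp add: coord_frame_def fst_E_point_eq)
  qed
qed

lemma frame_expansion:
  assumes c: "c \<in> A" "fst X \<in> fst c" and v: "v \<in> tangent_space A (fst X)"
  shows "v = (\<lambda>c'. \<Sum>b\<in>UNIV. (v c $ b) *\<^sub>R coord_frame A c b X c')"
proof -
  have "v = coord_vector A c (fst X) (\<Sum>b\<in>UNIV. (v c $ b) *\<^sub>R axis b 1)"
    using coord_vector_of_component[OF v c] basis_expansion[of "v c"] by (simp add: scalar_mult_eq_scaleR)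
  then show ?thesis
    by (simp add: coord_vector_sum[OF c] coord_vector_scaleR[OF c] coord_frame_def)
qed

text \<open>In lifted charts the projection is \<open>(x, y) \<mapsto> x\<close>, so the pushforward
  of Z is read off from the first half of its coordinates.\<close>

lemma vertical_space_iff:
  assumes c: "c \<in> A" "X \<in> fst (lift_chart A c)" and Z: "Z \<in> tangent_space (slit_atlas A) X"
  shows "Z \<in> vertical_space A X \<longleftrightarrow> fst (Z (lift_chart A c)) = 0"
proof -
  have p: "fst X \<in> fst c" using c by (simp add: fst_lift_chart)
  have *: "pushforward (slit_atlas A) A fst X Z c' = transition_deriv c c' (fst X) (fst (Z (lift_chart A c)))"
    if c': "c' \<in> A" "fst X \<in> fst c'" for c'
  proof -
    have "((\<lambda>z. transition c c' (fst z)) has_derivative (\<lambda>u. transition_deriv c c' (fst X) (fst u)))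
        (at (snd (lift_chart A c) X))"
      using has_derivative_compose[OF has_derivative_fst[OF has_derivative_ident], of "transition c c'"
          "transition_deriv c c' (fst X)" "snd (lift_chart A c) X"] transition_has_derivative[OF c(1) c'(1) p c'(2)]
      by (simp add: snd_lift_chart)
    then have "((snd c' \<circ> fst) \<circ> E_point A c has_derivative (\<lambda>u. transition_deriv c c' (fst X) (fst u)))
        (at (snd (lift_chart A c) X))"
    proof (rule has_derivative_transform_within_open[OF _ open_E_domain[OF c(1)]])
      show "snd (lift_chart A c) X \<in> E_domain A c" using c(2) by (auto simp: chart_image_def)
      show "transition c c' (fst z) = ((snd c' \<circ> fst) \<circ> E_point A c) z" if "z \<in> E_domain A c" for z
        using fst_E_point_eq[OF c(1) that] by simp
    qed
    from slit.tangent_deriv_chart[OF Z lift_in_slit_atlas[OF c(1)] c(2) this] c' show ?thesis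
      by (simp add: pushforward_def)
  qed
  show ?thesis
  proof
    assume "Z \<in> vertical_space A X"
    then have "pushforward (slit_atlas A) A fst X Z c = 0" by (simp add: vertical_space_def)
    then show "fst (Z (lift_chart A c)) = 0"
      using *[OF c(1) p] transition_deriv_self[OF c(1) p] by simp
  next
    assume "fst (Z (lift_chart A c)) = 0"
    then have "pushforward (slit_atlas A) A fst X Z c' = 0" for c'
      using *[of c'] linear_0[OF linear_transition_deriv[OF c(1) _ p]]
      by (cases "c' \<in> A \<and> fst X \<in> fst c'") (auto simp: pushforward_def)
    then show "Z \<in> vertical_space A X" using Z by (auto simp: vertical_space_def)
  qed
qed

end

locale finsler = slit A for A :: "('m, 'n::finite) mchart set" +
  fixes nab :: "('m, 'n) connection"
  assumes connection: "finsler_connection A nab"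
begin

context
  fixes W S
  assumes W: "openin (atlas_topology (slit_atlas A)) W" and S: "smooth_section_on A W S"
begin

lemmas connection_conj = connection[unfolded finsler_connection_def, THEN spec, THEN mp, OF W, THEN spec, THEN mp, OF S]

lemmas nab_in_tangent_space = connection_conj[THEN conjunct1, rule_format]
  and nab_linear = connection_conj[THEN conjunct2, THEN conjunct1, rule_format]
  and nab_add = connection_conj[THEN conjunct2, THEN conjunct2, THEN conjunct1, rule_format]
  and nab_leibniz = connection_conj[THEN conjunct2, THEN conjunct2, THEN conjunct2, THEN conjunct1, rule_format]
  and nab_cong = connection_conj[THEN conjunct2, THEN conjunct2, THEN conjunct2, THEN conjunct2, THEN conjunct1, rule_format]
  and nab_smooth = connection_conj[THEN conjunct2, THEN conjunct2, THEN conjunct2, THEN conjunct2, THEN conjunct2, rule_format]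

end

lemma nab_sum:
  assumes W: "openin (atlas_topology (slit_atlas A)) W" and X: "X \<in> W" "Z \<in> tangent_space (slit_atlas A) X"
    and f: "\<And>b. b \<in> I \<Longrightarrow> smooth_map_on (slit_atlas A) W (f b)"
    and S: "\<And>b. b \<in> I \<Longrightarrow> smooth_section_on A W (S b)"
  shows "nab X Z (\<lambda>Y c. \<Sum>b\<in>I. f b Y *\<^sub>R S b Y c) =
    (\<lambda>c. \<Sum>b\<in>I. tangent_deriv (slit_atlas A) X Z (f b) *\<^sub>R S b X c + f b X *\<^sub>R nab X Z (S b) c)"
proof -
  have 0: "nab X Z (\<lambda>Y c. 0) = (\<lambda>c. 0)"
    using nab_add[OF W smooth_section_on_zero smooth_section_on_zero X] by (simp add: fun_eq_iff)
  show ?thesis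
    using f S
  proof (induction I rule: infinite_finite_induct)
    case (insert b I)
    have "smooth_section_on A W (\<lambda>Y c. f b Y *\<^sub>R S b Y c)"
      using insert.prems by (intro smooth_section_on_scaleR W) auto
    moreover have "smooth_section_on A W (\<lambda>Y c. \<Sum>b\<in>I. f b Y *\<^sub>R S b Y c)"
      using insert.prems by (intro smooth_section_on_sum W) auto
    ultimately have "nab X Z (\<lambda>Y c. f b Y *\<^sub>R S b Y c + (\<Sum>b\<in>I. f b Y *\<^sub>R S b Y c)) =
        (\<lambda>c. nab X Z (\<lambda>Y c. f b Y *\<^sub>R S b Y c) c + nab X Z (\<lambda>Y c. \<Sum>b\<in>I. f b Y *\<^sub>R S b Y c) c)"
      by (rule nab_add[OF W _ _ X])
    also have "nab X Z (\<lambda>Y c. f b Y *\<^sub>R S b Y c) =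
        (\<lambda>c. tangent_deriv (slit_atlas A) X Z (f b) *\<^sub>R S b X c + f b X *\<^sub>R nab X Z (S b) c)"
      using insert.prems by (intro nab_leibniz[OF W _ _ X]) auto
    finally show ?case
      using insert by simp
  qed (simp_all add: 0)
qed

lemma conn_form_eq:
  assumes "c \<in> A" "X \<in> fst (lift_chart A c)" "Z \<in> tangent_space (slit_atlas A) X"
  shows "conn_form A nab c a b (snd (lift_chart A c) X) (Z (lift_chart A c)) = nab X Z (coord_frame A c b) c $ a"
  using assms by (simp add: conn_form_def slit.chart_inv_left slit.coord_vector_of_component)

lemma smooth_conn_form:
  assumes c: "c \<in> A"
  shows "smooth_on (E_domain A c) (\<lambda>z. conn_form A nab c a b z u)"
proof -
  let ?U = "fst (lift_chart A c)"
  let ?Z = "\<lambda>X. coord_vector (slit_atlas A) (lift_chart A c) X u"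
  have U: "openin (atlas_topology (slit_atlas A)) ?U"
    using c by (intro slit.openin_chart) simp
  have "smooth_vector_field_on (slit_atlas A) ?U ?Z"
    unfolding smooth_vector_field_on_def
    using c by (auto intro!: slit.coord_vector_in_tangent_space slit.smooth_coord_vector)
  then have "smooth_section_on A ?U (\<lambda>X. nab X (?Z X) (coord_frame A c b))"
    by (rule nab_smooth[OF U smooth_coord_frame[OF c]])
  then have "smooth_on (snd (lift_chart A c) ` (?U \<inter> ?U)) (\<lambda>z. nab (E_point A c z) (?Z (E_point A c z)) (coord_frame A c b) c)"
    using c unfolding smooth_section_on_def by blast
  then have "smooth_on (E_domain A c) (\<lambda>z. nab (E_point A c z) (?Z (E_point A c z)) (coord_frame A c b) c)"
    by (simp add: chart_image_def)
  from smooth_on_vec_nth[OF open_E_domain[OF c] this] show ?thesis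
    by (simp add: conn_form_def)
qed

lemma linear_conn_form:
  assumes c: "c \<in> A" and z: "z \<in> E_domain A c"
  shows "linear (conn_form A nab c a b z)"
proof -
  let ?X = "E_point A c z"
  have X: "?X \<in> fst (lift_chart A c)" by (rule E_point_in[OF z])
  have *: "conn_form A nab c a b z (r *\<^sub>R u + v) = r * conn_form A nab c a b z u + conn_form A nab c a b z v" for r u v
    using nab_linear[OF slit.openin_chart smooth_coord_frame[OF c] X, of "coord_vector (slit_atlas A) (lift_chart A c) ?X u"
        "coord_vector (slit_atlas A) (lift_chart A c) ?X v" r b] c X
    by (simp add: conn_form_def slit.coord_vector_linear slit.coord_vector_in_tangent_space)
  have 0: "conn_form A nab c a b z 0 = 0"
    using *[of 1 0 0] by simp
  show ?thesis
    using *[of 1] *[of _ _ 0] 0 by (intro linearI) auto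
qed

text \<open>A section is a combination of frame fields only inside a chart, so S is first replaced
  on the smaller open set \<open>W \<inter> fst (lift_chart A c)\<close> by its frame expansion,
  using compatibility with restriction; additivity and the Leibniz rule do the rest. This is the
  formula by which connection forms determine a connection.\<close>

lemma nab_component:
  assumes c: "c \<in> A" "X \<in> fst (lift_chart A c)"
    and W: "openin (atlas_topology (slit_atlas A)) W" "X \<in> W"
    and Z: "Z \<in> tangent_space (slit_atlas A) X" and S: "smooth_section_on A W S"
  defines "z \<equiv> snd (lift_chart A c) X" and "u \<equiv> Z (lift_chart A c)"
  shows "nab X Z S c $ a = frechet_derivative (\<lambda>z. S (E_point A c z) c $ a) (at z) u +
    (\<Sum>b\<in>UNIV. conn_form A nab c a b z u * S X c $ b)"
proof -
  let ?U = "fst (lift_chart A c)" and ?V = "W \<inter> fst (lift_chart A c)"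
  let ?f = "\<lambda>b Y. S Y c $ b"
  have U: "openin (atlas_topology (slit_atlas A)) ?U"
    using c by (intro slit.openin_chart) simp
  have V: "openin (atlas_topology (slit_atlas A)) ?V" using W U by blast
  have XV: "X \<in> ?V" using W c by blast
  have OV: "open (snd (lift_chart A c) ` ?V)"
    using c by (intro slit.open_chart_image_Int W) simp
  have SV: "smooth_section_on A ?V S" by (rule smooth_section_on_subset[OF S]) auto
  have eV: "smooth_section_on A ?V (coord_frame A c b)" for b
    by (rule smooth_section_on_subset[OF smooth_coord_frame[OF c(1)]]) auto
  have Sc: "smooth_on (snd (lift_chart A c) ` ?V) (\<lambda>z. S (E_point A c z) c)"
    using S c unfolding smooth_section_on_def by auto
  have fc: "smooth_on (snd (lift_chart A c) ` ?V) (?f b \<circ> E_point A c)" for b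
    unfolding o_def by (rule smooth_on_vec_nth[OF OV Sc])
  have f: "smooth_map_on (slit_atlas A) ?V (?f b)" for b
    using c by (intro slit.smooth_map_onI_chart[OF _ V _ fc]) auto
  have exp: "S Y = (\<lambda>c'. \<Sum>b\<in>UNIV. ?f b Y *\<^sub>R coord_frame A c b Y c')" if "Y \<in> ?V" for Y
    using that SV c by (intro frame_expansion) (auto simp: smooth_section_on_def fst_lift_chart)
  have td: "tangent_deriv (slit_atlas A) X Z (?f b) = frechet_derivative (\<lambda>z. S (E_point A c z) c $ b) (at z) u" for b
  proof -
    have "(?f b \<circ> E_point A c has_derivative frechet_derivative (\<lambda>z. S (E_point A c z) c $ b) (at z)) (at z)"
      using smooth_on_has_derivative[OF fc, of z b] XV by (simp add: z_def o_def)
    from slit.tangent_deriv_chart[OF Z _ c(2) this[unfolded z_def]] c(1) show ?thesis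
      by (simp add: z_def u_def)
  qed
  have "nab X Z S = nab X Z (\<lambda>Y c'. \<Sum>b\<in>UNIV. ?f b Y *\<^sub>R coord_frame A c b Y c')"
    by (rule nab_cong[OF V SV _ XV Z]) (intro conjI ballI smooth_section_on_sum[OF V f eV] exp)
  also have "\<dots> = (\<lambda>c'. \<Sum>b\<in>UNIV. tangent_deriv (slit_atlas A) X Z (?f b) *\<^sub>R coord_frame A c b X c' +
      ?f b X *\<^sub>R nab X Z (coord_frame A c b) c')"
    by (rule nab_sum[OF V XV Z f eV])
  finally have "nab X Z S c $ a = (\<Sum>b\<in>UNIV. tangent_deriv (slit_atlas A) X Z (?f b) * coord_frame A c b X c $ a +
      S X c $ b * nab X Z (coord_frame A c b) c $ a)"
    by simp
  also have "\<dots> = (\<Sum>b\<in>UNIV. tangent_deriv (slit_atlas A) X Z (?f b) * (if a = b then 1 else 0)) +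
      (\<Sum>b\<in>UNIV. conn_form A nab c a b z u * S X c $ b)"
    using c by (simp add: sum.distrib coord_frame_def coord_vector_self fst_lift_chart axis_def z_def u_def
        conn_form_eq[OF c Z] mult.commute)
  finally show ?thesis
    by (simp add: td if_distrib cong: if_cong)
qed

lemma smooth_liouville:
  assumes "c \<in> A"
  shows "smooth_section_on A (fst (lift_chart A c)) liouville"
  unfolding smooth_section_on_def
proof (intro conjI ballI)
  show "liouville X \<in> tangent_space A (fst X)" if "X \<in> fst (lift_chart A c)" for X
    using that by (auto simp: fst_lift_chart slit_bundle_def)
  fix c' assume c': "c' \<in> A"
  show "smooth_on (snd (lift_chart A c') ` (fst (lift_chart A c) \<inter> fst (lift_chart A c')))
      (\<lambda>z. liouville (E_point A c' z) c')"
  proof (rule smooth_on_eq[OF _ smooth_on_linear[OF bounded_linear_snd]])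
    show "open (snd (lift_chart A c') ` (fst (lift_chart A c) \<inter> fst (lift_chart A c')))"
      using assms c' by (intro slit.open_chart_image_Int slit.openin_chart) auto
    show "liouville (E_point A c' z) c' = snd z"
      if "z \<in> snd (lift_chart A c') ` (fst (lift_chart A c) \<inter> fst (lift_chart A c'))" for z
      using that lift_overlap_subset_E_domain by (intro E_point_components) blast
  qed
qed

text \<open>The representative of the Liouville section is \<open>(x, y) \<mapsto> y\<close>, whose
  derivative supplies the summand \<open>dy\<close>. This links the regularity conditions, stated on
  E, with the form Dy in coordinates.\<close>

lemma nab_liouville:
  assumes c: "c \<in> A" "X \<in> fst (lift_chart A c)" and Z: "Z \<in> tangent_space (slit_atlas A) X"
  shows "nab X Z liouville c $ a = Dy_form A nab c a (snd (lift_chart A c) X) (Z (lift_chart A c))"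
proof -
  have z: "snd (lift_chart A c) X \<in> E_domain A c" using c(2) by (auto simp: chart_image_def)
  have "((\<lambda>z. snd (E_point A c z) c $ a) has_derivative (\<lambda>u. snd u $ a)) (at (snd (lift_chart A c) X))"
  proof (rule has_derivative_transform_within_open[OF _ open_E_domain[OF c(1)] z])
    show "((\<lambda>z. snd z $ a) has_derivative (\<lambda>u. snd u $ a)) (at (snd (lift_chart A c) X))"
      by (auto intro!: derivative_eq_intros bounded_linear.has_derivative[OF bounded_linear_vec_nth])
  qed (simp add: E_point_components)
  moreover have "openin (atlas_topology (slit_atlas A)) (fst (lift_chart A c))"
    using c by (intro slit.openin_chart) simp
  ultimately show ?thesis
    using nab_component[OF c _ c(2) Z smooth_liouville[OF c(1)], of a]
    by (simp add: Dy_form_def dy_def snd_lift_chart frechet_derivative_eqI)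
qed

lemma strongly_regular_iff:
  "strongly_regular A nab \<longleftrightarrow> (\<forall>c\<in>A. \<forall>z\<in>E_domain A c. \<forall>w a. Dy_form A nab c a z (0, w) = w $ a)"
proof (intro iffI ballI allI)
  fix c z w a assume strong: "strongly_regular A nab" and c: "c \<in> A" and z: "z \<in> E_domain A c"
  let ?X = "E_point A c z"
  let ?Z = "coord_vector (slit_atlas A) (lift_chart A c) ?X (0, w)"
  have X: "?X \<in> fst (lift_chart A c)" by (rule E_point_in[OF z])
  have Z: "?Z \<in> tangent_space (slit_atlas A) ?X" "?Z (lift_chart A c) = (0, w)"
    using c X by (simp_all add: slit.coord_vector_in_tangent_space slit.coord_vector_self)
  have "nab ?X ?Z liouville = vertical_to_base A ?X ?Z"
    using strong vertical_space_iff[OF c X Z(1)] Z(2) X unfolding strongly_regular_def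
    by (auto simp: fst_lift_chart)
  then show "Dy_form A nab c a z (0, w) = w $ a"
    using nab_liouville[OF c X Z(1), of a] Z(2) fst_E_point[OF z] c
    by (simp add: E_point_coords[OF z] vertical_to_base_def)
next
  assume Dy: "\<forall>c\<in>A. \<forall>z\<in>E_domain A c. \<forall>w a. Dy_form A nab c a z (0, w) = w $ a"
  show "strongly_regular A nab"
    unfolding strongly_regular_def
  proof (intro ballI ext)
    fix X Z c assume X: "X \<in> slit_bundle A" and Z: "Z \<in> vertical_space A X"
    have TZ: "Z \<in> tangent_space (slit_atlas A) X" using Z by (simp add: vertical_space_def)
    show "nab X Z liouville c = vertical_to_base A X Z c"
    proof (cases "c \<in> A \<and> fst X \<in> fst c")
      case True
      then have c: "c \<in> A" "X \<in> fst (lift_chart A c)" using X by (auto simp: fst_lift_chart)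
      have "Z (lift_chart A c) = (0, snd (Z (lift_chart A c)))"
        using vertical_space_iff[OF c TZ] Z by (simp add: prod_eq_iff)
      then have "Dy_form A nab c a (snd (lift_chart A c) X) (Z (lift_chart A c)) = snd (Z (lift_chart A c)) $ a" for a
        using Dy c by (metis chart_image_def imageI)
      then show ?thesis
        using nab_liouville[OF c TZ] True by (simp add: vec_eq_iff vertical_to_base_def)
    next
      case False
      \<comment> \<open>At a chart that does not contain the base point both sides are 0 by
        convention; a chart around X is used to see that the left side is a genuine tangent
        vector.\<close>
      obtain c0 where c0: "c0 \<in> A" "X \<in> fst (lift_chart A c0)" using slit_bundle_chart[OF X] .
      have "nab X Z liouville \<in> tangent_space A (fst X)"
        using c0 by (intro nab_in_tangent_space[OF slit.openin_chart smooth_liouville _ TZ]) auto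
      with False show ?thesis
        using tangent_component_outside by (auto simp: vertical_to_base_def)
    qed
  qed
qed

lemma strongly_regular_imp_regular:
  assumes "strongly_regular A nab"
  shows "regular_connection A nab"
  unfolding regular_connection_def
proof (intro ballI inj_onI)
  fix X Z Z' assume X: "X \<in> slit_bundle A" and Z: "Z \<in> vertical_space A X" "Z' \<in> vertical_space A X"
    and eq: "nab X Z liouville = nab X Z' liouville"
  obtain c where c: "c \<in> A" "X \<in> fst (lift_chart A c)" using slit_bundle_chart[OF X] .
  have T: "Z \<in> tangent_space (slit_atlas A) X" "Z' \<in> tangent_space (slit_atlas A) X"
    using Z by (auto simp: vertical_space_def)
  have "vertical_to_base A X Z c = vertical_to_base A X Z' c"
    using assms X Z eq unfolding strongly_regular_def by metis
  then have "snd (Z (lift_chart A c)) = snd (Z' (lift_chart A c))"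
    using c by (simp add: vertical_to_base_def fst_lift_chart)
  moreover have "fst (Z (lift_chart A c)) = fst (Z' (lift_chart A c))"
    using vertical_space_iff[OF c] T Z by simp
  ultimately show "Z = Z'"
    using c by (intro slit.tangent_eqI[OF T _ c(2)]) (auto simp: prod_eq_iff)
qed

end

lemma same_connectionI:
  assumes "finsler A nab" "finsler A nab'"
    and eq: "\<And>c z a b u. c \<in> A \<Longrightarrow> z \<in> E_domain A c \<Longrightarrow> conn_form A nab c a b z u = conn_form A nab' c a b z u"
  shows "same_connection A nab nab'"
  unfolding same_connection_def
proof (intro allI impI ballI)
  fix W S X Z
  assume WS: "openin (atlas_topology (slit_atlas A)) W \<and> smooth_section_on A W S"
    and X: "X \<in> W" and Z: "Z \<in> tangent_space (slit_atlas A) X"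
  interpret N: finsler A nab by fact
  interpret N': finsler A nab' by fact
  have "X \<in> \<Union> (fst ` slit_atlas A)"
    using WS X by (auto simp: N.slit.openin_iff atlas_open_def atlas_carrier_def)
  then obtain c where c: "c \<in> A" "X \<in> fst (lift_chart A c)" by (auto simp: slit_atlas_def)
  have "snd (lift_chart A c) X \<in> E_domain A c" using c by (auto simp: chart_image_def)
  then have "nab X Z S c = nab' X Z S c"
    using WS N.nab_component[OF c _ X Z] N'.nab_component[OF c _ X Z] eq[OF c(1)] by (simp add: vec_eq_iff)
  then show "nab X Z S = nab' X Z S"
    using WS N.nab_in_tangent_space[OF _ _ X Z] N'.nab_in_tangent_space[OF _ _ X Z] c
    by (intro N.tangent_eqI[of _ "fst X" _ c]) (auto simp: fst_lift_chart)
qed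

section \<open>Bilinear forms and Hessians in coordinates\<close>

text \<open>Contraction with vectors instead of index notation: tensor identities become bilinear
  algebra for the simplifier, and \<open>linear_eq_on_axes\<close> translates from and to
  components.\<close>

definition bil :: "('n::finite \<Rightarrow> 'n \<Rightarrow> real) \<Rightarrow> real^'n \<Rightarrow> real^'n \<Rightarrow> real" where
  "bil m p q = (\<Sum>a\<in>UNIV. \<Sum>b\<in>UNIV. m a b * p $ a * q $ b)"

lemma bil_simps:
  "bil m (p + p') q = bil m p q + bil m p' q"
  "bil m p (q + q') = bil m p q + bil m p q'"
  "bil m (p - p') q = bil m p q - bil m p' q"
  "bil m p (q - q') = bil m p q - bil m p q'"
  "bil m (r *\<^sub>R p) q = r * bil m p q"
  "bil m p (r *\<^sub>R q) = r * bil m p q"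
  "bil m (- p) q = - bil m p q"
  "bil m p (- q) = - bil m p q"
  "bil m 0 q = 0"
  "bil m p 0 = 0"
  by (simp_all add: bil_def algebra_simps sum.distrib sum_subtractf sum_distrib_left sum_negf)

lemma sum_axis:
  fixes f :: "'n::finite \<Rightarrow> real"
  shows "(\<Sum>i\<in>UNIV. f i * axis a 1 $ i) = f a" and "(\<Sum>i\<in>UNIV. axis a 1 $ i * f i) = f a"
  by (simp_all add: axis_def if_distrib if_distribR cong: if_cong)

lemma bil_axis_right: "bil m p (axis b 1) = (\<Sum>a\<in>UNIV. m a b * p $ a)"
  by (simp add: bil_def sum_axis)

lemma bil_axis_left: "bil m (axis a 1) q = (\<Sum>b\<in>UNIV. m a b * q $ b)"
proof -
  have "bil m (axis a 1) q = (\<Sum>i\<in>UNIV. (\<Sum>b\<in>UNIV. m i b * q $ b) * axis a 1 $ i)"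
    by (simp add: bil_def sum_distrib_left sum_distrib_right mult_ac)
  then show ?thesis by (simp only: sum_axis)
qed

lemma bil_expand_left: "bil m p q = (\<Sum>a\<in>UNIV. bil m (axis a 1) q * p $ a)"
  unfolding bil_axis_left by (simp add: bil_def sum_distrib_right sum_distrib_left mult_ac)

lemma bil_axis: "bil m (axis a 1) (axis b 1) = m a b"
  by (simp add: bil_axis_left sum_axis)

lemma linear_bil: "linear (\<lambda>p. bil m p q)" "linear (\<lambda>q. bil m p q)"
  by (rule linearI; simp add: bil_simps)+

lemma linear_eq_on_axes:
  fixes f g :: "real^'n::finite \<Rightarrow> 'b::real_vector"
  assumes "linear f" "linear g" "\<And>a. f (axis a 1) = g (axis a 1)"
  shows "f p = g p"
  by (rule linear_eq_stdbasis[THEN fun_cong, OF assms(1,2)])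
    (use assms(3) in \<open>auto simp: Basis_vec_def\<close>)

lemma linear_pair_expansion:
  fixes l :: "(real^'n::finite) \<times> (real^'n) \<Rightarrow> real"
  assumes "linear l"
  shows "l (p, q) = (\<Sum>c\<in>UNIV. l (axis c 1, 0) * p $ c) + (\<Sum>c\<in>UNIV. l (0, axis c 1) * q $ c)"
proof -
  have 1: "linear (\<lambda>p. l (p, 0))" "linear (\<lambda>q. l (0, q))"
    using linear_add[OF assms] linear_scale[OF assms]
    by (auto intro!: linearI) (metis add_Pair add_0, metis scaleR_Pair scaleR_zero_right,
      metis add_Pair add_0, metis scaleR_Pair scaleR_zero_right)
  have s: "linear (\<lambda>p. \<Sum>c\<in>UNIV. k c * p $ c)" for k :: "'n \<Rightarrow> real"
    by (rule linearI) (simp_all add: sum.distrib distrib_left sum_distrib_left mult_ac)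
  have "l (p, 0) = (\<Sum>c\<in>UNIV. l (axis c 1, 0) * p $ c)"
    by (rule linear_eq_on_axes[OF 1(1) s]) (simp add: sum_axis)
  moreover have "l (0, q) = (\<Sum>c\<in>UNIV. l (0, axis c 1) * q $ c)"
    by (rule linear_eq_on_axes[OF 1(2) s]) (simp add: sum_axis)
  moreover have "l (p, q) = l (p, 0) + l (0, q)"
    by (simp flip: linear_add[OF assms])
  ultimately show ?thesis by simp
qed

lemma linear_vec_lambda:
  assumes "\<And>a. linear (\<lambda>x. f x a)"
  shows "linear (\<lambda>x. (\<chi> a. f x a) :: real^'n)"
  using linear_add[OF assms] linear_scale[OF assms] by (auto intro!: linearI simp: vec_eq_iff)

text \<open>\<open>matrix_inv\<close> is a choice term; the trivial kernel yields an inverse, and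
  then the chosen matrix is one on both sides.\<close>

lemma hess_inv_left:
  assumes "\<And>p. (\<And>b. (\<Sum>a\<in>UNIV. hess F b a z * p $ a) = 0) \<Longrightarrow> p = 0"
  shows "(\<Sum>d\<in>UNIV. hess_inv F a d z * (\<Sum>b\<in>UNIV. hess F d b z * v $ b)) = v $ a"
    and "(\<Sum>d\<in>UNIV. hess F a d z * (\<Sum>b\<in>UNIV. hess_inv F d b z * v $ b)) = v $ a"
proof -
  let ?M = "\<chi> i j. hess F i j z"
  have "\<forall>p. ?M *v p = 0 \<longrightarrow> p = 0"
    using assms by (simp add: matrix_vector_mult_def vec_eq_iff)
  then have "invertible ?M"
    using matrix_left_invertible_ker invertible_left_inverse by blast
  then have "?M ** matrix_inv ?M = mat 1 \<and> matrix_inv ?M ** ?M = mat 1"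
    unfolding invertible_def matrix_inv_def by (rule someI_ex)
  then have "matrix_inv ?M ** ?M = mat 1" "?M ** matrix_inv ?M = mat 1"
    by simp_all
  then have "matrix_inv ?M *v (?M *v v) = v" "?M *v (matrix_inv ?M *v v) = v"
    by (simp_all only: matrix_vector_mul_assoc matrix_vector_mul_lid)
  then have "(matrix_inv ?M *v (?M *v v)) $ a = v $ a" "(?M *v (matrix_inv ?M *v v)) $ a = v $ a"
    by simp_all
  then show "(\<Sum>d\<in>UNIV. hess_inv F a d z * (\<Sum>b\<in>UNIV. hess F d b z * v $ b)) = v $ a"
    "(\<Sum>d\<in>UNIV. hess F a d z * (\<Sum>b\<in>UNIV. hess_inv F d b z * v $ b)) = v $ a"
    by (simp_all add: matrix_vector_mult_def hess_inv_def)
qed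

text \<open>Both the base point and the direction \<open>(y, 0)\<close> move with z, so a second
  term appears as in a product rule. It is needed for the expression \<open>y^c d/dx^c\<close> in
  the spray.\<close>

lemma has_derivative_along_snd:
  fixes f :: "(real^'n::finite) \<times> (real^'n) \<Rightarrow> real"
  assumes f: "smooth_on D f" and D: "open D" "z \<in> D"
  shows "((\<lambda>z. frechet_derivative f (at z) (snd z, 0)) has_derivative
    (\<lambda>u. frechet_derivative (\<lambda>z'. frechet_derivative f (at z') (snd z, 0)) (at z) u +
      frechet_derivative f (at z) (snd u, 0))) (at z)"
    (is "(?h has_derivative ?h') (at z)")
proof -
  let ?d = "\<lambda>z p. frechet_derivative f (at z) (p, 0)"
  have exp: "?d z p = (\<Sum>c\<in>UNIV. ?d z (axis c 1) * p $ c)" if "z \<in> D" for z p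
    using linear_pair_expansion[OF linear_frechet_derivative[OF smooth_on_differentiable[OF f that]], of p 0]
    by simp
  have d: "((\<lambda>z. ?d z p) has_derivative frechet_derivative (\<lambda>z. ?d z p) (at z)) (at z)" for p
    by (rule smooth_on_has_derivative[OF smooth_on_deriv[OF f] D(2)])
  have dd: "frechet_derivative (\<lambda>z. ?d z p) (at z) u = (\<Sum>c\<in>UNIV. frechet_derivative (\<lambda>z. ?d z (axis c 1)) (at z) u * p $ c)"
    for p u
  proof (rule frechet_derivative_eqI[OF has_derivative_transform_within_open[OF _ D]])
    show "((\<lambda>z. \<Sum>c\<in>UNIV. ?d z (axis c 1) * p $ c) has_derivative
        (\<lambda>u. \<Sum>c\<in>UNIV. frechet_derivative (\<lambda>z. ?d z (axis c 1)) (at z) u * p $ c)) (at z)"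
      by (rule has_derivative_sum, rule has_derivative_mult_left, rule d)
  qed (rule exp[symmetric])
  have "((\<lambda>z. \<Sum>c\<in>UNIV. ?d z (axis c 1) * snd z $ c) has_derivative
      (\<lambda>u. \<Sum>c\<in>UNIV. ?d z (axis c 1) * snd u $ c + frechet_derivative (\<lambda>z. ?d z (axis c 1)) (at z) u * snd z $ c)) (at z)"
    by (rule has_derivative_sum, rule has_derivative_mult, rule d)
      (rule bounded_linear.has_derivative[OF bounded_linear_vec_nth has_derivative_snd[OF has_derivative_ident]])
  moreover have "(\<lambda>u. \<Sum>c\<in>UNIV. ?d z (axis c 1) * snd u $ c + frechet_derivative (\<lambda>z. ?d z (axis c 1)) (at z) u * snd z $ c) = ?h'"
    by (rule ext) (simp only: dd[of "snd z"] exp[OF D(2), of "snd u" for u] sum.distrib add.commute)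
  ultimately have "((\<lambda>z. \<Sum>c\<in>UNIV. ?d z (axis c 1) * snd z $ c) has_derivative ?h') (at z)"
    by simp
  then show ?thesis
    by (rule has_derivative_transform_within_open[OF _ D]) (rule exp[symmetric])
qed

section \<open>The conditions on the connection in coordinates\<close>

text \<open>The vector \<open>Wv z u p\<close> is \<open>\<omega>\<^sup>a\<^sub>b(u) p\<^sup>b\<close>, and \<open>om\<close> is the form \<open>Dy\<close>. The vectors
  \<open>(p, - Nv z p)\<close> and \<open>(0, r)\<close> span the horizontal space (the kernel of \<open>Dy\<close>) and the vertical
  space.\<close>

locale finsler_coords =
  fixes D :: "((real^'n::finite) \<times> (real^'n)) set"
    and g :: "'n \<Rightarrow> 'n \<Rightarrow> (real^'n) \<times> (real^'n) \<Rightarrow> real"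
    and w :: "'n \<Rightarrow> 'n \<Rightarrow> (real^'n) \<times> (real^'n) \<Rightarrow> (real^'n) \<times> (real^'n) \<Rightarrow> real"
  assumes open_D: "open D"
    and g_smooth: "smooth_on D (g a b)"
    and g_sym: "z \<in> D \<Longrightarrow> g a b z = g b a z"
    and g_nondeg: "z \<in> D \<Longrightarrow> (\<And>b. (\<Sum>a\<in>UNIV. g a b z * p $ a) = 0) \<Longrightarrow> p = 0"
    and w_smooth: "smooth_on D (\<lambda>z. w a b z u)"
    and w_linear: "z \<in> D \<Longrightarrow> linear (w a b z)"
begin

abbreviation G where "G z \<equiv> bil (\<lambda>a b. g a b z)"

abbreviation dG where "dG z u \<equiv> bil (\<lambda>a b. frechet_derivative (g a b) (at z) u)"

definition Wv :: "(real^'n) \<times> (real^'n) \<Rightarrow> (real^'n) \<times> (real^'n) \<Rightarrow> real^'n \<Rightarrow> real^'n" where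
  "Wv z u p = (\<chi> a. \<Sum>b\<in>UNIV. w a b z u * p $ b)"

definition om where "om z u = snd u + Wv z u (snd z)"

text \<open>When vertical vectors contribute nothing against y, the value at \<open>(p, 0)\<close>
  equals the value at the horizontal lift of p, so this is the non-linear connection
  \<open>H^a_bc y^b\<close>.\<close>

definition Nv where "Nv z p = Wv z (p, 0) (snd z)"

definition tor where "tor z u v = Wv z u (fst v) - Wv z v (fst u)"

definition radial where "radial \<longleftrightarrow> (\<forall>z\<in>D. \<forall>u v. G z (snd z) (tor z u v) = 0)"

definition cyclic where
  "cyclic \<longleftrightarrow> (\<forall>z\<in>D. \<forall>u v x. G z (tor z u v) (fst x) + G z (tor z v x) (fst u) + G z (tor z x u) (fst v) = 0)"

definition symmetric where
  "symmetric \<longleftrightarrow> (\<forall>z\<in>D. \<forall>u v x. G z (tor z u v) (om z x) + G z (tor z v x) (om z u) + G z (tor z x u) (om z v) = 0)"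

definition metrical where
  "metrical \<longleftrightarrow> (\<forall>z\<in>D. \<forall>u p q. dG z u p q = G z (Wv z u p) q + G z p (Wv z u q))"

definition strong where "strong \<longleftrightarrow> (\<forall>z\<in>D. \<forall>r. om z (0, r) = r)"

text \<open>A normal form for the conditions: the two transpositions make the vertical coefficients
  totally symmetric, the last clause of the bracket is symmetry of the horizontal ones. Both systems
  lead to it, and each condition can be read off from it again.\<close>

definition cartan_like where
  "cartan_like \<longleftrightarrow> (\<forall>z\<in>D.
     (\<forall>p q r. G z (Wv z (0, r) p) q = G z (Wv z (0, r) q) p) \<and>
     (\<forall>p q r. G z (Wv z (0, r) p) q = G z (Wv z (0, q) p) r) \<and>
     (\<forall>r. Wv z (0, r) (snd z) = 0) \<and>
     (\<forall>p q. Wv z (p, - Nv z p) q = Wv z (q, - Nv z q) p)) \<and> metrical"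

lemma G_sym: "z \<in> D \<Longrightarrow> G z p q = G z q p"
  unfolding bil_def by (subst sum.swap) (simp add: g_sym[of z] mult_ac)

text \<open>Takes the place of raising an index: vectors are compared through their inner products
  with all q.\<close>

lemma G_eqI:
  assumes "z \<in> D" "\<And>q. G z p q = G z p' q"
  shows "p = p'"
proof -
  have "(\<Sum>a\<in>UNIV. g a b z * (p - p') $ a) = 0" for b
    using assms(2)[of "axis b 1"] by (simp add: bil_axis_right right_diff_distrib sum_subtractf)
  from g_nondeg[OF assms(1) this] show ?thesis by simp
qed

lemma G_eq0: "z \<in> D \<Longrightarrow> (\<And>q. G z p q = 0) \<Longrightarrow> p = 0"
  by (rule G_eqI) (simp_all add: bil_simps)

lemma Wv_right:
  "Wv z u (p + q) = Wv z u p + Wv z u q" "Wv z u (p - q) = Wv z u p - Wv z u q"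
  "Wv z u (c *\<^sub>R p) = c *\<^sub>R Wv z u p" "Wv z u (- p) = - Wv z u p" "Wv z u 0 = 0"
  by (simp_all add: Wv_def vec_eq_iff algebra_simps sum.distrib sum_subtractf sum_distrib_left sum_negf)

lemma linear_Wv: "z \<in> D \<Longrightarrow> linear (\<lambda>u. Wv z u p)"
  unfolding Wv_def using linear_add[OF w_linear] linear_scale[OF w_linear]
  by (intro linear_vec_lambda linearI) (simp_all add: algebra_simps sum.distrib sum_distrib_left)

lemma Wv_left:
  assumes "z \<in> D"
  shows "Wv z (u + v) p = Wv z u p + Wv z v p" "Wv z (u - v) p = Wv z u p - Wv z v p"
    "Wv z (c *\<^sub>R u) p = c *\<^sub>R Wv z u p" "Wv z (- u) p = - Wv z u p" "Wv z 0 p = 0"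
  using linear_add[OF linear_Wv[OF assms]] linear_diff[OF linear_Wv[OF assms]]
    linear_scale[OF linear_Wv[OF assms]] linear_neg[OF linear_Wv[OF assms]] linear_0[OF linear_Wv[OF assms]]
  by blast+

lemma Wv_Pair: "z \<in> D \<Longrightarrow> Wv z (p, q) r = Wv z (p, 0) r + Wv z (0, q) r"
  by (simp flip: Wv_left)

lemma linear_dg: "z \<in> D \<Longrightarrow> linear (frechet_derivative (g a b) (at z))"
  by (rule linear_frechet_derivative[OF smooth_on_differentiable[OF g_smooth]])

lemma linear_dG: "z \<in> D \<Longrightarrow> linear (\<lambda>u. dG z u p q)"
  unfolding bil_def using linear_add[OF linear_dg] linear_scale[OF linear_dg]
  by (intro linearI) (simp_all add: algebra_simps sum.distrib sum_distrib_left)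

lemma dG_left:
  assumes "z \<in> D"
  shows "dG z (u + v) p q = dG z u p q + dG z v p q" "dG z (c *\<^sub>R u) p q = c * dG z u p q"
    "dG z (- u) p q = - dG z u p q"
  using linear_add[OF linear_dG[OF assms]] linear_scale[OF linear_dG[OF assms]] linear_neg[OF linear_dG[OF assms]]
  by simp_all

lemma dG_Pair: "z \<in> D \<Longrightarrow> dG z (p, q) r s = dG z (p, 0) r s + dG z (0, q) r s"
  by (simp flip: dG_left)

lemma dG_snd_minus: "z \<in> D \<Longrightarrow> dG z (0, - q) r s = - dG z (0, q) r s"
  by (simp flip: dG_left)

lemma dg_sym: "z \<in> D \<Longrightarrow> frechet_derivative (g a b) (at z) = frechet_derivative (g b a) (at z)"
  by (rule frechet_derivative_cong_open[OF open_D]) (simp_all add: g_sym)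

lemma dG_sym: "z \<in> D \<Longrightarrow> dG z u p q = dG z u q p"
  unfolding bil_def by (subst sum.swap) (simp add: dg_sym[of z] mult_ac)

lemma G_has_derivative:
  assumes z: "z \<in> D" and P: "(P has_derivative P') (at z)" and Q: "(Q has_derivative Q') (at z)"
  shows "((\<lambda>z. G z (P z) (Q z)) has_derivative
    (\<lambda>u. dG z u (P z) (Q z) + G z (P' u) (Q z) + G z (P z) (Q' u))) (at z)"
proof -
  have "((\<lambda>z. g a b z * P z $ a * Q z $ b) has_derivative
      (\<lambda>u. frechet_derivative (g a b) (at z) u * P z $ a * Q z $ b + g a b z * P' u $ a * Q z $ b
        + g a b z * P z $ a * Q' u $ b)) (at z)" for a b
  proof -
    have "((\<lambda>z. g a b z * P z $ a * Q z $ b) has_derivative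
        (\<lambda>u. g a b z * P z $ a * Q' u $ b + (g a b z * P' u $ a + frechet_derivative (g a b) (at z) u * P z $ a) * Q z $ b)) (at z)"
      by (rule has_derivative_mult, rule has_derivative_mult, rule smooth_on_has_derivative[OF g_smooth z])
        (rule bounded_linear.has_derivative[OF bounded_linear_vec_nth] P Q)+
    then show ?thesis by (simp add: algebra_simps)
  qed
  then have "((\<lambda>z. G z (P z) (Q z)) has_derivative
    (\<lambda>u. \<Sum>a\<in>UNIV. \<Sum>b\<in>UNIV. frechet_derivative (g a b) (at z) u * P z $ a * Q z $ b + g a b z * P' u $ a * Q z $ b
        + g a b z * P z $ a * Q' u $ b)) (at z)"
    unfolding bil_def by (intro has_derivative_sum)
  then show ?thesis by (simp add: bil_def sum.distrib)
qed

lemma strongD: "strong \<Longrightarrow> z \<in> D \<Longrightarrow> Wv z (0, r) (snd z) = 0"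
  by (auto simp: strong_def om_def)

text \<open>On one vertical and two non-vertical vectors the torsion of the latter pair is wedged
  with the base part of the vertical vector, which is 0; the two surviving terms are the
  claim.\<close>

lemma Wv_vertical_sym:
  assumes "cyclic" "z \<in> D"
  shows "G z (Wv z (0, r) p) q = G z (Wv z (0, r) q) p"
proof -
  have "G z (tor z (0, r) (p, 0)) q + G z (tor z (p, 0) (q, 0)) 0 + G z (tor z (q, 0) (0, r)) p = 0"
    using assms unfolding cyclic_def by (metis fst_conv)
  then show ?thesis
    using assms(2) by (simp add: tor_def bil_simps Wv_right)
qed

text \<open>The radial condition on a vertical and a non-vertical vector says that
  \<open>V(r) q\<close> is orthogonal to y; the symmetry of V moves y into the argument, so
  \<open>V(r) y\<close> is orthogonal to every q.\<close>

lemma strong_if_radial: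
  assumes "radial" "cyclic"
  shows strong
  unfolding strong_def
proof (intro ballI allI)
  fix z r assume z: "z \<in> D"
  have "G z (Wv z (0, r) (snd z)) q = 0" for q
  proof -
    have "G z (snd z) (tor z (0, r) (q, 0)) = 0" using assms(1) z unfolding radial_def by blast
    then have "G z (Wv z (0, r) q) (snd z) = 0"
      using G_sym[OF z] by (simp add: tor_def Wv_right)
    then show ?thesis using Wv_vertical_sym[OF assms(2) z] by metis
  qed
  then have "Wv z (0, r) (snd z) = 0" by (rule G_eq0[OF z])
  then show "om z (0, r) = r" by (simp add: om_def)
qed

lemma om_horizontal:
  assumes "\<And>r. Wv z (0, r) (snd z) = 0" "z \<in> D"
  shows "om z (p, - Nv z p) = 0"
  using assms Wv_Pair[OF assms(2), of p "- Nv z p" "snd z"] by (simp add: om_def Nv_def)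

text \<open>Since \<open>om\<close> vanishes on horizontal and is the identity on vertical vectors,
  the torsion symmetry decouples: two vertical vectors and a horizontal one give the second symmetry
  of V, while two horizontal vectors and a vertical one leave only the torsion of the horizontal
  pair.\<close>

lemma cartan_likeI:
  assumes strong cyclic symmetric metrical
  shows cartan_like
  unfolding cartan_like_def
proof (intro conjI ballI allI)
  fix z assume z: "z \<in> D"
  note omH = om_horizontal[OF strongD[OF assms(1) z] z]
  have omV: "om z (0, r) = r" for r using assms(1) z by (simp add: strong_def)
  have sym: "G z (tor z u v) (om z x) + G z (tor z v x) (om z u) + G z (tor z x u) (om z v) = 0" for u v x
    using assms(3) z unfolding symmetric_def by blast
  show "G z (Wv z (0, r) p) q = G z (Wv z (0, r) q) p" for p q r
    by (rule Wv_vertical_sym[OF assms(2) z])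
  show "G z (Wv z (0, r) p) q = G z (Wv z (0, q) p) r" for p q r
    using sym[of "(0, r)" "(p, - Nv z p)" "(0, q)"] unfolding omH omV
    by (simp add: tor_def bil_simps Wv_right)
  show "Wv z (0, r) (snd z) = 0" for r by (rule strongD[OF assms(1) z])
  show "Wv z (p, - Nv z p) q = Wv z (q, - Nv z q) p" for p q
  proof -
    have "G z (tor z (p, - Nv z p) (q, - Nv z q)) s = 0" for s
      using sym[of "(p, - Nv z p)" "(q, - Nv z q)" "(0, s)"] unfolding omH omV
      by (simp add: bil_simps)
    then have "tor z (p, - Nv z p) (q, - Nv z q) = 0" by (rule G_eq0[OF z])
    then show ?thesis by (simp add: tor_def)
  qed
qed (rule assms(4))

lemma cartan_likeD:
  assumes "cartan_like" "z \<in> D"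
  shows "G z (Wv z (0, r) p) q = G z (Wv z (0, r) q) p"
    and "G z (Wv z (0, r) p) q = G z (Wv z (0, q) p) r"
    and "Wv z (0, r) (snd z) = 0"
    and "Wv z (p, - Nv z p) q = Wv z (q, - Nv z q) p"
  using assms unfolding cartan_like_def by blast+

lemma cartan_like_metrical:
  "cartan_like \<Longrightarrow> z \<in> D \<Longrightarrow> dG z u p q = G z (Wv z u p) q + G z p (Wv z u q)"
  unfolding cartan_like_def metrical_def by blast

text \<open>Each vector is split into its horizontal part and \<open>(0, om z u)\<close>. The
  horizontal contributions cancel by the symmetry of H, so the torsion is made of V alone, and in
  \<open>cartan_like_imp\<close> every condition becomes a sum of V-terms that cancel in
  pairs.\<close>

lemma cartan_like_tor:
  assumes "cartan_like" "z \<in> D"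
  shows "tor z u v = Wv z (0, om z u) (fst v) - Wv z (0, om z v) (fst u)"
proof -
  have split: "Wv z u p = Wv z (fst u, - Nv z (fst u)) p + Wv z (0, om z u) p" for u p
  proof -
    have "om z u = snd u + Nv z (fst u)"
      using Wv_Pair[OF assms(2), of "fst u" "snd u" "snd z"] cartan_likeD(3)[OF assms]
      by (simp add: om_def Nv_def)
    then have eq: "(fst u, - Nv z (fst u)) + (0, om z u) = u" by (simp add: prod_eq_iff)
    show ?thesis
      using Wv_left(1)[OF assms(2), of "(fst u, - Nv z (fst u))" "(0, om z u)" p] unfolding eq .
  qed
  show ?thesis
    unfolding tor_def split[of u "fst v"] split[of v "fst u"]
    using cartan_likeD(4)[OF assms, of "fst u" "fst v"] by simp
qed

lemma cartan_like_imp: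
  assumes cartan_like
  shows strong radial cyclic symmetric
proof -
  have S: "G z (Wv z (0, r) p) q = G z (Wv z (0, r) q) p" "G z (Wv z (0, r) p) q = G z (Wv z (0, q) p) r"
    if "z \<in> D" for z p q r
    using cartan_likeD[OF assms that] by blast+
  show strong
    using cartan_likeD(3)[OF assms] by (simp add: strong_def om_def)
  show radial
    unfolding radial_def
  proof (intro ballI allI)
    fix z u v assume z: "z \<in> D"
    have "G z (snd z) (Wv z (0, r) p) = 0" for r p
      using S(1)[OF z, of r p "snd z"] cartan_likeD(3)[OF assms z] G_sym[OF z] by (simp add: bil_simps)
    then show "G z (snd z) (tor z u v) = 0"
      by (simp add: cartan_like_tor[OF assms z] bil_simps)
  qed
  show cyclic
    unfolding cyclic_def
  proof (intro ballI allI)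
    fix z u v x assume z: "z \<in> D"
    show "G z (tor z u v) (fst x) + G z (tor z v x) (fst u) + G z (tor z x u) (fst v) = 0"
      using S(1)[OF z, of "om z u" "fst v" "fst x"] S(1)[OF z, of "om z v" "fst u" "fst x"]
        S(1)[OF z, of "om z x" "fst u" "fst v"]
      by (simp add: cartan_like_tor[OF assms z] bil_simps)
  qed
  show symmetric
    unfolding symmetric_def
  proof (intro ballI allI)
    fix z u v x assume z: "z \<in> D"
    show "G z (tor z u v) (om z x) + G z (tor z v x) (om z u) + G z (tor z x u) (om z v) = 0"
      using S(2)[OF z, of "om z u" "fst v" "om z x"] S(2)[OF z, of "om z v" "fst u" "om z x"]
        S(2)[OF z, of "om z v" "fst x" "om z u"]
      by (simp add: cartan_like_tor[OF assms z] bil_simps)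
  qed
qed

section \<open>Curvature and the contracted Bianchi identity\<close>

definition dW where
  "dW z h u p = (\<chi> a. \<Sum>b\<in>UNIV. frechet_derivative (\<lambda>z. w a b z u) (at z) h * p $ b)"

definition curv where
  "curv z u v p = dW z u v p - dW z v u p + Wv z u (Wv z v p) - Wv z v (Wv z u p)"

definition radial_curv where
  "radial_curv \<longleftrightarrow> (\<forall>z\<in>D. \<forall>u v x.
     G z (snd z) (curv z u v (fst x) + curv z v x (fst u) + curv z x u (fst v)) = 0)"

lemma Wv_has_derivative:
  "z \<in> D \<Longrightarrow> ((\<lambda>z. Wv z u p) has_derivative (\<lambda>h. dW z h u p)) (at z)"
  unfolding Wv_def dW_def has_derivative_componentwise_within[where f = "\<lambda>z. \<chi> a. _ z a"]
  by (auto simp: Basis_vec_def inner_axis intro!: has_derivative_sum has_derivative_mult_left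
      smooth_on_has_derivative[OF w_smooth])

text \<open>Differentiating \<open>y\<^sub>a T\<^sup>a = 0\<close>: this is the first Bianchi identity contracted with \<open>y\<close>.\<close>
lemma radial_bianchi:
  assumes radial metrical and z: "z \<in> D"
  shows "(G z (tor z u v) (om z x) + G z (tor z v x) (om z u) + G z (tor z x u) (om z v)) +
    G z (snd z) (curv z u v (fst x) + curv z v x (fst u) + curv z x u (fst v)) = 0"
proof -
  \<comment> \<open>Metricity splits the derivative along h of the inner product of y with the
    torsion: one part acts covariantly on y and gives \<open>om z h\<close>, the other acts
    covariantly on the torsion.\<close>
  have *: "G z (tor z u v) (om z h) + G z (snd z) (Wv z h (tor z u v) + (dW z h u (fst v) - dW z h v (fst u))) = 0"
    for u v h
  proof -
    have "((\<lambda>z. tor z u v) has_derivative (\<lambda>h. dW z h u (fst v) - dW z h v (fst u))) (at z)"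
      unfolding tor_def by (intro has_derivative_diff Wv_has_derivative z)
    from G_has_derivative[OF z has_derivative_snd[OF has_derivative_ident] this]
    have "frechet_derivative (\<lambda>z. G z (snd z) (tor z u v)) (at z) h = dG z h (snd z) (tor z u v)
        + G z (snd h) (tor z u v) + G z (snd z) (dW z h u (fst v) - dW z h v (fst u))"
      by (rule frechet_derivative_eqI)
    moreover have "frechet_derivative (\<lambda>z. G z (snd z) (tor z u v)) (at z) = frechet_derivative (\<lambda>z. 0) (at z)"
      using assms(1) by (intro frechet_derivative_cong_open[OF open_D z]) (auto simp only: radial_def)
    moreover have "dG z h (snd z) (tor z u v) = G z (Wv z h (snd z)) (tor z u v) + G z (snd z) (Wv z h (tor z u v))"
      using assms(2) z unfolding metrical_def by blast
    ultimately show ?thesis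
      using G_sym[OF z, of "tor z u v"] by (simp add: om_def bil_simps)
  qed
  \<comment> \<open>In the cyclic sum the terms ending in \<open>fst v\<close> are those of
    \<open>curv z x u (fst v)\<close>, and likewise for the other two.\<close>
  show ?thesis
    using *[of u v x] *[of v x u] *[of x u v]
    unfolding curv_def tor_def by (simp add: bil_simps Wv_right)
qed

lemma radial_curv_iff:
  assumes radial metrical
  shows "radial_curv \<longleftrightarrow> symmetric"
  unfolding radial_curv_def symmetric_def
  using radial_bianchi[OF assms] by (metis add_cancel_left_right add_cancel_right_right)

end

section \<open>The Cartan connection in coordinates\<close>

lemma linear_cartan_form: "linear (cartan_form F a b z)"
proof (rule linearI)
  show "cartan_form F a b z (u + v) = cartan_form F a b z u + cartan_form F a b z v" for u v
    by (simp add: cartan_form_def dx_def dy_def distrib_left sum.distrib algebra_simps)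
  show "cartan_form F a b z (r *\<^sub>R u) = r *\<^sub>R cartan_form F a b z u" for r u
    by (simp add: cartan_form_def dx_def dy_def sum_distrib_left distrib_left mult_ac)
qed

context finsler_coords
begin

text \<open>The Cartan tensor is totally symmetric and annihilated by y. The first is the
  integrability condition for a vertical Hessian; together they express that g has degree 0 in
  y.\<close>

definition hessian_like where
  "hessian_like \<longleftrightarrow> (\<forall>z\<in>D. (\<forall>p q r. dG z (0, r) p q = dG z (0, q) p r) \<and> (\<forall>p r. dG z (0, r) p (snd z) = 0))"

definition lag where "lag z = 1/2 * G z (snd z) (snd z)"

text \<open>For the spray coefficients \<open>G\<^sup>a\<close> of \<open>lag\<close>, the covector \<open>spray_form z\<close> is \<open>2 g\<^sub>a\<^sub>b G\<^sup>b\<close>.\<close>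
definition spray_form where
  "spray_form z p = dG z (snd z, 0) p (snd z) - 1/2 * dG z (p, 0) (snd z) (snd z)"

lemma hessian_likeD:
  assumes hessian_like "z \<in> D"
  shows "dG z (0, r) p q = dG z (0, q) p r" "dG z (0, r) p (snd z) = 0" "dG z (0, r) (snd z) p = 0"
proof -
  show "dG z (0, r) p q = dG z (0, q) p r" "dG z (0, r) p (snd z) = 0"
    using assms unfolding hessian_like_def by blast+
  then show "dG z (0, r) (snd z) p = 0"
    using dG_sym[OF assms(2)] by metis
qed

lemma smooth_G_snd: "smooth_on D (\<lambda>z. G z p (snd z))"
  unfolding bil_def
  by (intro smooth_on_sum[OF open_D] smooth_on_mult[OF open_D] smooth_on_const g_smooth smooth_on_snd_nth)

lemma smooth_lag: "smooth_on D lag"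
proof -
  have "lag = (\<lambda>z. 1/2 * (\<Sum>a\<in>UNIV. G z (axis a 1) (snd z) * snd z $ a))"
    by (rule ext) (simp only: lag_def flip: bil_expand_left)
  then show ?thesis
    by (simp only:) (intro smooth_on_sum[OF open_D] smooth_on_mult[OF open_D] smooth_on_const smooth_G_snd smooth_on_snd_nth)
qed

lemma G_snd_deriv:
  assumes "z \<in> D"
  shows "frechet_derivative (\<lambda>z. G z p (snd z)) (at z) u = dG z u p (snd z) + G z p (snd u)"
proof -
  have "((\<lambda>z. G z p (snd z)) has_derivative (\<lambda>u. dG z u p (snd z) + G z 0 (snd z) + G z p (snd u))) (at z)"
    by (rule G_has_derivative[OF assms has_derivative_const has_derivative_snd[OF has_derivative_ident]])
  then show ?thesis by (simp add: frechet_derivative_eqI bil_simps)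
qed

lemma G_const_deriv:
  assumes "z \<in> D"
  shows "frechet_derivative (\<lambda>z. G z p q) (at z) u = dG z u p q"
proof -
  have "((\<lambda>z. G z p q) has_derivative (\<lambda>u. dG z u p q + G z 0 q + G z p 0)) (at z)"
    by (rule G_has_derivative[OF assms has_derivative_const has_derivative_const])
  then show ?thesis by (simp add: frechet_derivative_eqI bil_simps)
qed

lemma lag_deriv:
  assumes "z \<in> D"
  shows "frechet_derivative lag (at z) u = 1/2 * dG z u (snd z) (snd z) + G z (snd u) (snd z)"
proof -
  have "(lag has_derivative (\<lambda>u. 1/2 * (dG z u (snd z) (snd z) + G z (snd u) (snd z) + G z (snd z) (snd u)))) (at z)"
    unfolding lag_def
    by (rule has_derivative_mult_right[OF G_has_derivative[OF assms has_derivative_snd[OF has_derivative_ident]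
            has_derivative_snd[OF has_derivative_ident]]])
  then show ?thesis using G_sym[OF assms, of "snd z" "snd u"] by (simp add: frechet_derivative_eqI)
qed

text \<open>Here \<open>G z p (snd z)\<close> is the derivative of \<open>lag\<close> along
  \<open>(0, p)\<close>, so this is the bracket in the definition of the spray coefficients. Written
  with derivatives of smooth functions, it can be differentiated in y and the order of
  differentiation interchanged.\<close>

lemma spray_form_eq:
  assumes hessian_like "z \<in> D"
  shows "spray_form z p = frechet_derivative (\<lambda>z. G z p (snd z)) (at z) (snd z, 0) - frechet_derivative lag (at z) (p, 0)"
  by (simp add: spray_form_def G_snd_deriv[OF assms(2)] lag_deriv[OF assms(2)] bil_simps)

text \<open>J is twice the spray vector. The product rule for \<open>G z (J z) p\<close> yields its
  vertical derivative without touching the inverse of g, in exactly the shape of the formula for N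
  obtained from the Christoffel formula.\<close>

lemma spray_vector_deriv:
  assumes h: hessian_like and z: "z \<in> D" and J: "J differentiable (at z)"
    and GJ: "\<And>z p. z \<in> D \<Longrightarrow> G z (J z) p = spray_form z p"
  shows "G z (frechet_derivative J (at z) (0, r)) p =
    dG z (snd z, 0) p r + dG z (r, 0) p (snd z) - dG z (p, 0) (snd z) r - dG z (0, r) (J z) p"
proof -
  let ?F = "\<lambda>z. G z p (snd z)"
  let ?A = "frechet_derivative (\<lambda>z'. frechet_derivative ?F (at z') (snd z, 0)) (at z) (0, r)"
  let ?B = "frechet_derivative (\<lambda>z'. frechet_derivative lag (at z') (p, 0)) (at z) (0, r)"
  have "((\<lambda>z. G z (J z) p) has_derivative (\<lambda>u. dG z u (J z) p + G z (frechet_derivative J (at z) u) p + G z (J z) 0)) (at z)"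
    using J by (intro G_has_derivative[OF z] has_derivative_const) (simp add: frechet_derivative_works)
  then have "frechet_derivative (\<lambda>z. G z (J z) p) (at z) (0, r) = dG z (0, r) (J z) p + G z (frechet_derivative J (at z) (0, r)) p"
    by (simp add: frechet_derivative_eqI bil_simps)
  moreover have "frechet_derivative (\<lambda>z. G z (J z) p) (at z) =
      frechet_derivative (\<lambda>z. frechet_derivative ?F (at z) (snd z, 0) - frechet_derivative lag (at z) (p, 0)) (at z)"
    by (rule frechet_derivative_cong_open[OF open_D z]) (simp only: GJ spray_form_eq[OF h])
  moreover have "frechet_derivative (\<lambda>z. frechet_derivative ?F (at z) (snd z, 0) - frechet_derivative lag (at z) (p, 0)) (at z) (0, r) =
      (?A + frechet_derivative ?F (at z) (r, 0)) - ?B"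
    using frechet_derivative_eqI[OF has_derivative_diff[OF has_derivative_along_snd[OF smooth_G_snd[of p] open_D z]
          smooth_on_has_derivative[OF smooth_on_deriv[OF smooth_lag, of "(p, 0)"] z]], of "(0, r)"] by simp
  \<comment> \<open>With the vertical derivative taken first, \<open>G z p (snd z)\<close> becomes
    \<open>G z p r\<close>, since the derivative of g is contracted with y and drops out. The same
    interchange treats \<open>lag\<close> below.\<close>
  moreover have "?A = dG z (snd z, 0) p r"
  proof -
    have "?A = frechet_derivative (\<lambda>z'. frechet_derivative ?F (at z') (0, r)) (at z) (snd z, 0)"
      by (rule frechet_derivative_commute[OF open_D z smooth_G_snd])
    also have "frechet_derivative (\<lambda>z'. frechet_derivative ?F (at z') (0, r)) (at z) = frechet_derivative (\<lambda>z'. G z' p r) (at z)"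
      by (rule frechet_derivative_cong_open[OF open_D z]) (simp add: G_snd_deriv hessian_likeD(2,3)[OF h])
    finally show ?thesis by (simp add: G_const_deriv[OF z])
  qed
  moreover have "?B = dG z (p, 0) (snd z) r"
  proof -
    have "?B = frechet_derivative (\<lambda>z'. frechet_derivative lag (at z') (0, r)) (at z) (p, 0)"
      by (rule frechet_derivative_commute[OF open_D z smooth_lag])
    also have "frechet_derivative (\<lambda>z'. frechet_derivative lag (at z') (0, r)) (at z) = frechet_derivative (\<lambda>z'. G z' r (snd z')) (at z)"
      by (rule frechet_derivative_cong_open[OF open_D z]) (simp add: lag_deriv hessian_likeD(2,3)[OF h])
    finally show ?thesis using dG_sym[OF z, of "(p, 0)" r] by (simp add: G_snd_deriv[OF z] bil_simps)
  qed
  moreover have "frechet_derivative ?F (at z) (r, 0) = dG z (r, 0) p (snd z)"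
    by (simp add: G_snd_deriv[OF z] bil_simps)
  ultimately show ?thesis by simp
qed

lemma Nv_snd_differentiable:
  assumes z: "z \<in> D"
  shows "(\<lambda>z. Nv z (snd z)) differentiable (at z)"
proof -
  have "smooth_on D (\<lambda>z. Nv z (snd z) $ a)" for a
  proof (rule smooth_on_eq[OF open_D])
    show "smooth_on D (\<lambda>z. \<Sum>b\<in>UNIV. (\<Sum>c\<in>UNIV. w a b z (axis c 1, 0) * snd z $ c) * snd z $ b)"
      by (intro smooth_on_sum[OF open_D] smooth_on_mult[OF open_D] w_smooth smooth_on_snd_nth)
    show "Nv z (snd z) $ a = (\<Sum>b\<in>UNIV. (\<Sum>c\<in>UNIV. w a b z (axis c 1, 0) * snd z $ c) * snd z $ b)"
      if "z \<in> D" for z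
      using linear_pair_expansion[OF w_linear[OF that], of _ _ "snd z" 0] by (simp add: Nv_def Wv_def)
  qed
  then have "smooth_on D (\<lambda>z. Nv z (snd z))" by (rule smooth_on_vecI[OF open_D])
  then show ?thesis using z by (rule smooth_on_differentiable)
qed

definition Bv where "Bv F z r = (\<chi> b. \<Sum>a\<in>UNIV. barthel F b a z * r $ a)"

definition CW where "CW F z u p = (\<chi> a. \<Sum>b\<in>UNIV. cartan_form F a b z u * p $ b)"

text \<open>The inner product of the Cartan coefficients \<open>\<Gamma>(p, r)\<close> with q; the
  derivation \<open>\<delta>/\<delta>x\<close> along p is the derivative in the direction
  \<open>(p, - Bv F z p)\<close>.\<close>

definition christoffel where
  "christoffel F z p r q = 1/2 * (dG z (p, - Bv F z p) q r + dG z (r, - Bv F z r) q p - dG z (q, - Bv F z q) p r)"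

lemma linear_Bv: "linear (Bv F z)"
  by (rule linearI) (simp_all add: Bv_def vec_eq_iff distrib_left sum.distrib sum_distrib_left mult_ac)

lemma linear_CW_left: "linear (\<lambda>u. CW F z u p)"
  by (rule linearI) (simp_all add: CW_def vec_eq_iff linear_add[OF linear_cartan_form] linear_scale[OF linear_cartan_form]
    distrib_left distrib_right sum.distrib sum_distrib_left mult_ac)

lemma linear_CW_right: "linear (CW F z u)"
  by (rule linearI) (simp_all add: CW_def vec_eq_iff distrib_left sum.distrib sum_distrib_left mult_ac)

lemma CW_axis: "CW F z u (axis b 1) $ a = cartan_form F a b z u"
  by (simp add: CW_def sum_axis)

lemma CW_split: "CW F z u p = CW F z (fst u, - Bv F z (fst u)) p + CW F z (0, snd u + Bv F z (fst u)) p"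
proof -
  have "(fst u, - Bv F z (fst u)) + (0, snd u + Bv F z (fst u)) = u" by (simp add: prod_eq_iff)
  then show ?thesis using linear_add[OF linear_CW_left, of F z "(fst u, - Bv F z (fst u))" "(0, snd u + Bv F z (fst u))" p]
    by simp
qed

section \<open>The Cartan form of a function equal to the energy on the chart domain\<close>

context
  fixes F
  assumes hess_like: hessian_like and F: "\<And>z. z \<in> D \<Longrightarrow> F z = lag z"
begin

lemma F_deriv: "z \<in> D \<Longrightarrow> frechet_derivative F (at z) = frechet_derivative lag (at z)"
  by (rule frechet_derivative_cong_open[OF open_D _ F])

lemma pdy_F: "z \<in> D \<Longrightarrow> pdy a F z = G z (axis a 1) (snd z)"
  by (simp add: pdy_def F_deriv lag_deriv hessian_likeD(2,3)[OF hess_like])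

lemma pdy_F_deriv:
  "z \<in> D \<Longrightarrow> frechet_derivative (pdy a F) (at z) u = dG z u (axis a 1) (snd z) + G z (axis a 1) (snd u)"
  using frechet_derivative_cong_open[OF open_D _ pdy_F] by (simp add: G_snd_deriv)

text \<open>Each vertical derivative passes over g, whose derivative is contracted with y and
  vanishes. So only the two copies of y are differentiated, which uses up the factor 1/2.\<close>

lemma hess_F: "z \<in> D \<Longrightarrow> hess F a b z = g a b z"
  unfolding hess_def
  by (subst pdy_def) (simp add: pdy_F_deriv hessian_likeD(2,3)[OF hess_like] bil_axis g_sym[of z])

lemma hess_F_deriv: "z \<in> D \<Longrightarrow> frechet_derivative (hess F a b) (at z) = frechet_derivative (g a b) (at z)"
  by (rule frechet_derivative_cong_open[OF open_D _ hess_F])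

lemma hess_inv_F:
  assumes z: "z \<in> D"
  shows "(\<Sum>d\<in>UNIV. hess_inv F a d z * G z v (axis d 1)) = v $ a"
    and "(\<Sum>a\<in>UNIV. g a m z * (\<Sum>n\<in>UNIV. hess_inv F a n z * X n)) = X m"
proof -
  have nd: "p = 0" if "\<And>b. (\<Sum>a\<in>UNIV. hess F b a z * p $ a) = 0" for p
    by (rule g_nondeg[OF z]) (use that g_sym[OF z] in \<open>simp add: hess_F[OF z]\<close>)
  show "(\<Sum>d\<in>UNIV. hess_inv F a d z * G z v (axis d 1)) = v $ a"
    using hess_inv_left(1)[of F z a v, OF nd] by (simp add: hess_F[OF z] G_sym[OF z, of v] bil_axis_left)
  show "(\<Sum>a\<in>UNIV. g a m z * (\<Sum>n\<in>UNIV. hess_inv F a n z * X n)) = X m"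
    using hess_inv_left(2)[of F z m "vec_lambda X", OF nd] by (simp add: hess_F[OF z] g_sym[OF z, of m])
qed

lemma hdelta_hess:
  assumes z: "z \<in> D"
  shows "hdelta F b (hess F m c) z = frechet_derivative (g m c) (at z) (axis b 1, - Bv F z (axis b 1))"
proof -
  have "Bv F z (axis b 1) $ d = barthel F d b z" for d by (simp add: Bv_def sum_axis)
  then show ?thesis
    using linear_pair_expansion[OF linear_dg[OF z], of m c "axis b 1" "- Bv F z (axis b 1)"]
    by (simp add: hdelta_def pdx_def pdy_def hess_F_deriv[OF z] sum_axis sum_negf mult.commute)
qed

text \<open>Lowering the index cancels \<open>hess_inv\<close>, which gives the formula on axes; it
  is then extended to vectors one argument at a time, and the six linearity facts are there for
  this.\<close>

lemma G_CW_vertical: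
  assumes z: "z \<in> D"
  shows "G z (CW F z (0, r) p) q = 1/2 * dG z (0, r) p q"
proof -
  have lin: "linear (\<lambda>r. G z (CW F z (0, r) p) q)" "linear (\<lambda>p. G z (CW F z (0, r) p) q)" "linear (\<lambda>q. G z (CW F z (0, r) p) q)"
    "linear (\<lambda>r. 1/2 * dG z (0, r) p q)" "linear (\<lambda>p. 1/2 * dG z (0, r) p q)" "linear (\<lambda>q. 1/2 * dG z (0, r) p q)" for p q r
  proof -
    have a: "CW F z (0, r + s) p = CW F z (0, r) p + CW F z (0, s) p" "CW F z (0, k *\<^sub>R r) p = k *\<^sub>R CW F z (0, r) p" for r s k
      using linear_add[OF linear_CW_left, of F z "(0, r)" "(0, s)" p] linear_scale[OF linear_CW_left, of F z k "(0, r)" p] by simp_all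
    show "linear (\<lambda>r. G z (CW F z (0, r) p) q)" by (rule linearI) (simp_all add: a bil_simps)
    have b: "dG z (0, r + s) p q = dG z (0, r) p q + dG z (0, s) p q" "dG z (0, k *\<^sub>R r) p q = k * dG z (0, r) p q" for r s k
      using dG_left(1)[OF z, of "(0, r)" "(0, s)" p q] dG_left(2)[OF z, of k "(0, r)" p q] by simp_all
    show "linear (\<lambda>r. 1/2 * dG z (0, r) p q)" by (rule linearI) (simp_all add: b)
  qed (rule linearI; simp add: bil_simps linear_add[OF linear_CW_right] linear_scale[OF linear_CW_right] distrib_left)+
  have "G z (CW F z (0, axis c 1) (axis b 1)) (axis m 1) = 1/2 * dG z (0, axis c 1) (axis b 1) (axis m 1)" for b c m
  proof -
    have "cartan_form F a b z (0, axis c 1) = (\<Sum>d\<in>UNIV. hess_inv F a d z * (1/2 * frechet_derivative (g d b) (at z) (0, axis c 1)))" for a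
      by (simp add: cartan_form_def dx_def dy_def sum_axis cartan_V_def pdy_def hess_F_deriv[OF z] sum_distrib_left)
    then have "G z (CW F z (0, axis c 1) (axis b 1)) (axis m 1) = 1/2 * frechet_derivative (g m b) (at z) (0, axis c 1)"
      by (simp only: bil_axis_right CW_axis hess_inv_F(2)[OF z])
    then show ?thesis by (simp add: bil_axis dg_sym[OF z, of m])
  qed
  then have "G z (CW F z (0, axis c 1) (axis b 1)) q = 1/2 * dG z (0, axis c 1) (axis b 1) q" for b c q
    by (rule linear_eq_on_axes[OF lin(3) lin(6)])
  then have "G z (CW F z (0, axis c 1) p) q = 1/2 * dG z (0, axis c 1) p q" for c p q
    by (rule linear_eq_on_axes[OF lin(2) lin(5)])
  then show ?thesis
    by (rule linear_eq_on_axes[OF lin(1) lin(4)])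
qed

text \<open>The forms \<open>dy + N dx\<close> in the second sum of \<open>cartan_form\<close>
  vanish on \<open>(r, - Bv F z r)\<close>, so only the Christoffel coefficients remain. The
  extension from axes is as in the vertical case.\<close>

lemma G_CW_horizontal:
  assumes z: "z \<in> D"
  shows "G z (CW F z (r, - Bv F z r) p) q = christoffel F z p r q"
proof -
  have a: "CW F z (r + s, - Bv F z (r + s)) p = CW F z (r, - Bv F z r) p + CW F z (s, - Bv F z s) p"
    "CW F z (k *\<^sub>R r, - Bv F z (k *\<^sub>R r)) p = k *\<^sub>R CW F z (r, - Bv F z r) p" for r s k p
    using linear_add[OF linear_CW_left, of F z "(r, - Bv F z r)" "(s, - Bv F z s)" p]
      linear_scale[OF linear_CW_left, of F z k "(r, - Bv F z r)" p]
    by (simp_all add: linear_add[OF linear_Bv] linear_scale[OF linear_Bv] add.commute)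
  have b: "dG z (r + s, - Bv F z (r + s)) p q = dG z (r, - Bv F z r) p q + dG z (s, - Bv F z s) p q"
    "dG z (k *\<^sub>R r, - Bv F z (k *\<^sub>R r)) p q = k * dG z (r, - Bv F z r) p q" for r s k p q
    using dG_left(1)[OF z, of "(r, - Bv F z r)" "(s, - Bv F z s)" p q] dG_left(2)[OF z, of k "(r, - Bv F z r)" p q]
    by (simp_all add: linear_add[OF linear_Bv] linear_scale[OF linear_Bv] add.commute)
  have lin: "linear (\<lambda>r. G z (CW F z (r, - Bv F z r) p) q)" "linear (\<lambda>p. G z (CW F z (r, - Bv F z r) p) q)"
    "linear (\<lambda>q. G z (CW F z (r, - Bv F z r) p) q)"
    "linear (\<lambda>r. christoffel F z p r q)" "linear (\<lambda>p. christoffel F z p r q)" "linear (\<lambda>q. christoffel F z p r q)" for p q r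
    by (rule linearI; simp add: christoffel_def a b bil_simps linear_add[OF linear_CW_right] linear_scale[OF linear_CW_right]
        algebra_simps)+
  have "G z (CW F z (axis c 1, - Bv F z (axis c 1)) (axis b 1)) (axis m 1) = christoffel F z (axis b 1) (axis c 1) (axis m 1)" for b c m
  proof -
    have Bv: "Bv F z (axis c 1) $ d = barthel F d c z" for d by (simp add: Bv_def sum_axis)
    have "cartan_form F a b z (axis c 1, - Bv F z (axis c 1)) = cartan_H F a b c z" for a
      by (simp add: cartan_form_def dx_def dy_def sum_axis Bv)
    then have "cartan_form F a b z (axis c 1, - Bv F z (axis c 1)) =
      (\<Sum>n\<in>UNIV. hess_inv F a n z * (1/2 * (hdelta F b (hess F n c) z + hdelta F c (hess F n b) z - hdelta F n (hess F b c) z)))" for a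
      by (simp add: cartan_H_def sum_distrib_left mult_ac)
    then have "G z (CW F z (axis c 1, - Bv F z (axis c 1)) (axis b 1)) (axis m 1) =
        1/2 * (hdelta F b (hess F m c) z + hdelta F c (hess F m b) z - hdelta F m (hess F b c) z)"
      by (simp only: bil_axis_right CW_axis hess_inv_F(2)[OF z])
    then show ?thesis
      by (simp add: hdelta_hess[OF z] christoffel_def bil_axis)
  qed
  then have "G z (CW F z (axis c 1, - Bv F z (axis c 1)) (axis b 1)) q = christoffel F z (axis b 1) (axis c 1) q" for b c q
    by (rule linear_eq_on_axes[OF lin(3) lin(6)])
  then have "G z (CW F z (axis c 1, - Bv F z (axis c 1)) p) q = christoffel F z p (axis c 1) q" for c p q
    by (rule linear_eq_on_axes[OF lin(2) lin(5)])
  then show ?thesis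
    by (rule linear_eq_on_axes[OF lin(1) lin(4)])
qed

lemma spray_coeff_F:
  assumes z: "z \<in> D" and v: "\<And>p. G z v p = spray_form z p"
  shows "spray_coeff F a z = 1/2 * v $ a"
proof -
  have "(\<Sum>c\<in>UNIV. pdx c (pdy d F) z * snd z $ c) - pdx d F z = spray_form z (axis d 1)" for d
  proof -
    have "(\<Sum>c\<in>UNIV. pdx c (pdy d F) z * snd z $ c) = dG z (snd z, 0) (axis d 1) (snd z)"
      using linear_pair_expansion[OF linear_dG[OF z, of "axis d 1" "snd z"], of "snd z" 0]
      by (simp add: pdx_def pdy_F_deriv[OF z] bil_simps)
    then show ?thesis
      by (simp add: spray_form_def pdx_def F_deriv[OF z] lag_deriv[OF z] bil_simps)
  qed
  then show ?thesis
    using hess_inv_F(1)[OF z, of a v] by (simp add: spray_coeff_def v)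
qed

text \<open>By \<open>spray_coeff_F\<close> the spray coefficients are J/2 throughout D, hence so
  are their vertical derivatives.\<close>

lemma Bv_eq:
  assumes z: "z \<in> D" and J: "J differentiable (at z)"
    and GJ: "\<And>z p. z \<in> D \<Longrightarrow> G z (J z) p = spray_form z p"
  shows "Bv F z r = (1/2) *\<^sub>R frechet_derivative J (at z) (0, r)"
proof -
  have J': "(J has_derivative frechet_derivative J (at z)) (at z)"
    using J by (simp add: frechet_derivative_works)
  have "barthel F b a z = 1/2 * frechet_derivative J (at z) (0, axis a 1) $ b" for a b
  proof -
    have "frechet_derivative (spray_coeff F b) (at z) = frechet_derivative (\<lambda>z. 1/2 * J z $ b) (at z)"
      by (rule frechet_derivative_cong_open[OF open_D z]) (rule spray_coeff_F[OF _ GJ])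
    moreover have "frechet_derivative (\<lambda>z. 1/2 * J z $ b) (at z) (0, axis a 1) = 1/2 * frechet_derivative J (at z) (0, axis a 1) $ b"
      by (rule frechet_derivative_eqI[OF has_derivative_mult_right[OF bounded_linear.has_derivative[OF bounded_linear_vec_nth J']]])
    ultimately show ?thesis by (simp add: barthel_def pdy_def)
  qed
  then have axes: "Bv F z (axis a 1) = (1/2) *\<^sub>R frechet_derivative J (at z) (0, axis a 1)" for a
    by (simp add: Bv_def sum_axis vec_eq_iff)
  have lin: "linear (\<lambda>r. (1/2) *\<^sub>R frechet_derivative J (at z) (0, r))"
  proof (rule linearI)
    note l = has_derivative_linear[OF J']
    show "(1/2) *\<^sub>R frechet_derivative J (at z) (0, r + s) = (1/2) *\<^sub>R frechet_derivative J (at z) (0, r) + (1/2) *\<^sub>R frechet_derivative J (at z) (0, s)" for r s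
      using linear_add[OF l, of "(0, r)" "(0, s)"] by (simp add: scaleR_add_right)
    show "(1/2) *\<^sub>R frechet_derivative J (at z) (0, k *\<^sub>R r) = k *\<^sub>R (1/2) *\<^sub>R frechet_derivative J (at z) (0, r)" for k r
      using linear_scale[OF l, of k "(0, r)"] by simp
  qed
  show ?thesis by (rule linear_eq_on_axes[OF linear_Bv lin axes])
qed

end

end

section \<open>From the normal form to the Cartan connection\<close>

context finsler_coords
begin

lemma cartan_like_vertical:
  assumes "cartan_like" "z \<in> D"
  shows "G z (Wv z (0, r) p) q = 1/2 * dG z (0, r) p q"
  using cartan_like_metrical[OF assms, of "(0, r)" p q] cartan_likeD(1)[OF assms, of r p q]
    G_sym[OF assms(2), of p "Wv z (0, r) q"] by simp

lemma cartan_like_hessian_like: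
  assumes "cartan_like"
  shows "hessian_like"
  unfolding hessian_like_def
proof (intro ballI conjI allI)
  fix z assume z: "z \<in> D"
  note V = cartan_like_vertical[OF assms z] and S = cartan_likeD[OF assms z]
  show "dG z (0, r) p q = dG z (0, q) p r" for p q r
    using V[of r p q] V[of q p r] S(2)[of r p q] by simp
  show "dG z (0, r) p (snd z) = 0" for p r
    using V[of r "snd z" p] S(3)[of r] dG_sym[OF z, of "(0, r)" p "snd z"] by (simp add: bil_simps)
qed

text \<open>The Koszul trick: three instances of metricity with alternating signs, where the missing
  horizontal torsion permits swapping arguments. The right side still contains N.\<close>

lemma cartan_like_horizontal:
  assumes "cartan_like" "z \<in> D"
  shows "2 * G z (Wv z (r, - Nv z r) q) p =
    dG z (q, - Nv z q) p r + dG z (r, - Nv z r) p q - dG z (p, - Nv z p) q r"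
proof -
  note C = cartan_likeD(4)[OF assms] and M = cartan_like_metrical[OF assms]
  show ?thesis
    unfolding M
    using C[of p q] C[of r p] C[of r q] G_sym[OF assms(2), of p] G_sym[OF assms(2), of q] by simp
qed

lemma Wv_horizontal_snd:
  assumes "z \<in> D" "\<And>r. Wv z (0, r) (snd z) = 0"
  shows "Wv z (p, q) (snd z) = Nv z p"
  using assms Wv_Pair[OF assms(1), of p q "snd z"] by (simp add: Nv_def)

text \<open>The Christoffel formula with argument y. Vertical derivatives of g with y among the
  arguments vanish, so N survives on the right only through \<open>Nv z (snd z)\<close>; total
  symmetry moves r into the derivative slot to match \<open>spray_vector_deriv\<close>.\<close>

lemma cartan_like_Nv:
  assumes "cartan_like" "z \<in> D"
  shows "2 * G z (Nv z r) p =
    dG z (snd z, 0) p r + dG z (r, 0) p (snd z) - dG z (p, 0) (snd z) r - dG z (0, r) (Nv z (snd z)) p"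
proof -
  note h = hessian_likeD[OF cartan_like_hessian_like[OF assms(1)] assms(2)]
  have "Wv z (r, - Nv z r) (snd z) = Nv z r"
    by (rule Wv_horizontal_snd[OF assms(2) cartan_likeD(3)[OF assms]])
  moreover have "dG z (0, Nv z (snd z)) p r = dG z (0, r) (Nv z (snd z)) p"
    using h(1)[of "Nv z (snd z)" p r] dG_sym[OF assms(2)] by metis
  ultimately show ?thesis
    using cartan_like_horizontal[OF assms, of r "snd z" p]
      dG_Pair[OF assms(2), of "snd z" "- Nv z (snd z)" p r] dG_Pair[OF assms(2), of r "- Nv z r" p "snd z"]
      dG_Pair[OF assms(2), of p "- Nv z p" "snd z" r]
    by (simp add: dG_snd_minus[OF assms(2)] h(2,3))
qed

lemma cartan_like_cartan_form:
  assumes C: "cartan_like" and F: "\<And>z. z \<in> D \<Longrightarrow> F z = lag z" and z: "z \<in> D"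
  shows "w a b z u = cartan_form F a b z u"
proof -
  note h = cartan_like_hessian_like[OF C]
  \<comment> \<open>For r = y the last term of \<open>cartan_like_Nv\<close> is a Cartan tensor with
    y in one slot, hence 0.\<close>
  have spray: "G z (Nv z (snd z)) p = spray_form z p" if z: "z \<in> D" for z p
    using cartan_like_Nv[OF C z, of "snd z" p] hessian_likeD(1)[OF h z, of "snd z" "Nv z (snd z)" p]
    by (simp add: spray_form_def hessian_likeD(2)[OF h z])
  have B: "Bv F z r = (1/2) *\<^sub>R frechet_derivative (\<lambda>z. Nv z (snd z)) (at z) (0, r)" for r
    by (rule Bv_eq[OF h F z Nv_snd_differentiable[OF z] spray])
  \<comment> \<open>With \<open>J = Nv z (snd z)\<close>, \<open>spray_vector_deriv\<close> and
    \<open>cartan_like_Nv\<close> have the same right side: one for twice the Barthel connection,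
    one for twice N.\<close>
  have Bv: "Bv F z r = Nv z r" for r
  proof (rule G_eqI[OF z])
    show "G z (Bv F z r) p = G z (Nv z r) p" for p
      unfolding B
      using spray_vector_deriv[OF h z Nv_snd_differentiable[OF z] spray, of r p] cartan_like_Nv[OF C z, of r p]
      by (simp add: bil_simps)
  qed
  have V: "Wv z (0, r) p = CW F z (0, r) p" for r p
    by (rule G_eqI[OF z]) (simp add: G_CW_vertical[OF h F z] cartan_like_vertical[OF C z])
  have H: "Wv z (r, - Nv z r) p = CW F z (r, - Nv z r) p" for r p
  proof (rule G_eqI[OF z])
    show "G z (Wv z (r, - Nv z r) p) q = G z (CW F z (r, - Nv z r) p) q" for q
      using G_CW_horizontal[OF h F z, of r p q] cartan_like_horizontal[OF C z, of r p q]
      by (simp add: Bv christoffel_def)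
  qed
  have "Wv z u p = CW F z u p" for p
  proof -
    have "(fst u, - Nv z (fst u)) + (0, snd u + Nv z (fst u)) = u" by (simp add: prod_eq_iff)
    then have "Wv z u p = Wv z (fst u, - Nv z (fst u)) p + Wv z (0, snd u + Nv z (fst u)) p"
      using Wv_left(1)[OF z, of "(fst u, - Nv z (fst u))" "(0, snd u + Nv z (fst u))" p] by simp
    then show ?thesis
      using CW_split[of F z u p] by (simp add: V H Bv)
  qed
  from arg_cong[OF this[of "axis b 1"], of "\<lambda>v. v $ a"] show ?thesis
    by (simp add: CW_axis Wv_def sum_axis)
qed

text \<open>Along the ray through y the number g(y,y), with y held fixed, has zero derivative and is
  constant; the square comes from the two vector arguments of \<open>lag\<close>.\<close>

lemma lag_homogeneous:
  assumes h: hessian_like and D: "\<And>t. t > 0 \<Longrightarrow> (x, t *\<^sub>R y) \<in> D" and s: "s > 0"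
  shows "lag (x, s *\<^sub>R y) = s\<^sup>2 * lag (x, y)"
proof -
  have "((\<lambda>t. G (x, t *\<^sub>R y) y y) has_derivative (\<lambda>_. 0)) (at t within {0<..})" if "t \<in> {0<..}" for t :: real
  proof -
    have t: "t > 0" using that by simp
    have "((\<lambda>z. G z y y) has_derivative (\<lambda>u. dG (x, t *\<^sub>R y) u y y + G (x, t *\<^sub>R y) 0 y + G (x, t *\<^sub>R y) y 0)) (at (x, t *\<^sub>R y))"
      by (rule G_has_derivative[OF D[OF t] has_derivative_const has_derivative_const])
    moreover have "((\<lambda>t. (x, t *\<^sub>R y)) has_derivative (\<lambda>t. (0, t *\<^sub>R y))) (at t)"
      by (auto intro!: derivative_eq_intros)
    ultimately have "((\<lambda>t. G (x, t *\<^sub>R y) y y) has_derivative (\<lambda>r. dG (x, t *\<^sub>R y) (0, r *\<^sub>R y) y y)) (at t)"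
      using has_derivative_compose by (fastforce simp: bil_simps)
    \<comment> \<open>The fibre coordinate at this point is \<open>t y\<close>, not y, so the
      vanishing is applied to \<open>t y\<close> and t > 0 is cancelled.\<close>
    moreover have "dG (x, t *\<^sub>R y) (0, r *\<^sub>R y) y y = 0" for r
      using hessian_likeD(2)[OF h D[OF t], of "r *\<^sub>R y" y] t by (simp add: bil_simps)
    ultimately show ?thesis by (simp add: has_derivative_at_withinI)
  qed
  then obtain k where "\<forall>t\<in>{0<..}. G (x, t *\<^sub>R y) y y = k"
    using has_derivative_zero_constant[of "{0<..}" "\<lambda>t. G (x, t *\<^sub>R y) y y"] by (auto simp: convex_real_interval)
  then have "G (x, s *\<^sub>R y) y y = G (x, 1 *\<^sub>R y) y y" using s by (metis greaterThan_iff zero_less_one)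
  then show ?thesis by (simp add: lag_def bil_simps power2_eq_square)
qed

section \<open>From a homogeneous potential back to the normal form\<close>

context
  fixes F
  assumes F_smooth: "smooth_on D F"
    and F_cone: "\<And>x y s. (x, y) \<in> D \<Longrightarrow> s > 0 \<Longrightarrow> F (x, s *\<^sub>R y) = s\<^sup>2 * F (x, y)"
    and F_hess: "\<And>z a b. z \<in> D \<Longrightarrow> hess F a b z = g a b z"
begin

lemma euler:
  assumes "z \<in> D"
  shows "frechet_derivative F (at z) (0, snd z) = 2 * F z"
proof -
  obtain x y where z_eq: "z = (x, y)" by (cases z)
  have F': "(F has_derivative frechet_derivative F (at (x, 1 *\<^sub>R y))) (at (x, 1 *\<^sub>R y))"
    using smooth_on_has_derivative[OF F_smooth assms] by (simp add: z_eq)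
  have "((\<lambda>t. (x, t *\<^sub>R y)) has_derivative (\<lambda>t. (0, t *\<^sub>R y))) (at 1)"
    by (auto intro!: derivative_eq_intros)
  from has_derivative_compose[OF this F']
  have "frechet_derivative (\<lambda>t. F (x, t *\<^sub>R y)) (at 1) 1 = frechet_derivative F (at z) (0, y)"
    by (simp add: frechet_derivative_eqI z_eq)
  moreover have "frechet_derivative (\<lambda>t. F (x, t *\<^sub>R y)) (at 1) = frechet_derivative (\<lambda>t. t\<^sup>2 * F (x, y)) (at 1)"
    by (rule frechet_derivative_cong_open[of "{0<..}"]) (use F_cone assms in \<open>auto simp: z_eq\<close>)
  moreover have "((\<lambda>t. t\<^sup>2 * F (x, y)) has_derivative (\<lambda>t. 2 * t * F (x, y))) (at 1)"
    by (auto intro!: derivative_eq_intros)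
  ultimately show ?thesis
    using frechet_derivative_eqI[of "\<lambda>t. t\<^sup>2 * F (x, y)" "\<lambda>t. 2 * t * F (x, y)" 1 1] by (simp add: z_eq)
qed

lemma pdy_smooth: "smooth_on D (pdy a F)"
  unfolding pdy_def by (rule smooth_on_deriv[OF F_smooth])

lemma snd_contraction_deriv:
  assumes f: "\<And>a. smooth_on D (f a)" and z: "z \<in> D"
  shows "frechet_derivative (\<lambda>z. \<Sum>a\<in>UNIV. f a z * snd z $ a) (at z) (0, axis c 1) =
    f c z + (\<Sum>a\<in>UNIV. frechet_derivative (f a) (at z) (0, axis c 1) * snd z $ a)"
proof -
  have "((\<lambda>z. \<Sum>a\<in>UNIV. f a z * snd z $ a) has_derivative
      (\<lambda>u. \<Sum>a\<in>UNIV. f a z * snd u $ a + frechet_derivative (f a) (at z) u * snd z $ a)) (at z)"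
    by (rule has_derivative_sum, rule has_derivative_mult, rule smooth_on_has_derivative[OF f z])
      (rule bounded_linear.has_derivative[OF bounded_linear_vec_nth has_derivative_snd[OF has_derivative_ident]])
  then show ?thesis
    by (simp add: frechet_derivative_eqI sum.distrib sum_axis)
qed

text \<open>Differentiating Euler's relation once more in \<open>y^c\<close> reproduces
  \<open>pdy c F\<close> on the left, so one of the two copies on the right cancels.\<close>

lemma euler_pdy:
  assumes z: "z \<in> D"
  shows "pdy c F z = (\<Sum>a\<in>UNIV. g c a z * snd z $ a)"
proof -
  have E: "(\<Sum>a\<in>UNIV. pdy a F z * snd z $ a) = 2 * F z" if "z \<in> D" for z
    using linear_pair_expansion[OF linear_frechet_derivative[OF smooth_on_differentiable[OF F_smooth that]], of 0 "snd z"]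
      euler[OF that] by (simp add: pdy_def)
  have "frechet_derivative (\<lambda>z. \<Sum>a\<in>UNIV. pdy a F z * snd z $ a) (at z) = frechet_derivative (\<lambda>z. 2 * F z) (at z)"
    by (rule frechet_derivative_cong_open[OF open_D z E])
  moreover have "frechet_derivative (\<lambda>z. 2 * F z) (at z) (0, axis c 1) = 2 * pdy c F z"
    unfolding pdy_def
    by (rule frechet_derivative_eqI[OF has_derivative_mult_right[OF smooth_on_has_derivative[OF F_smooth z]]])
  moreover have "frechet_derivative (pdy a F) (at z) (0, axis c 1) = g c a z" for a
    using F_hess[OF z, of c a] by (simp add: hess_def pdy_def[of c])
  ultimately show ?thesis
    using snd_contraction_deriv[of "\<lambda>a. pdy a F", OF pdy_smooth z] by simp
qed

text \<open>Two Euler relations leave no freedom: the potential is determined by g. Thus everything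
  proved for functions equal to \<open>lag\<close> applies to an arbitrary Lagrangian.\<close>

lemma F_eq_lag:
  assumes z: "z \<in> D"
  shows "F z = lag z"
proof -
  have "2 * F z = (\<Sum>a\<in>UNIV. pdy a F z * snd z $ a)"
    using linear_pair_expansion[OF linear_frechet_derivative[OF smooth_on_differentiable[OF F_smooth z]], of 0 "snd z"]
      euler[OF z] by (simp add: pdy_def)
  also have "\<dots> = G z (snd z) (snd z)"
    by (subst bil_expand_left) (simp add: euler_pdy[OF z] bil_axis_left)
  finally show ?thesis by (simp add: lag_def)
qed

text \<open>Differentiating \<open>euler_pdy\<close> again shows that y annihilates the Cartan
  tensor; its symmetry is the interchange of derivatives of \<open>pdy a F\<close>.\<close>

lemma homogeneous_hessian_like: "hessian_like"
  unfolding hessian_like_def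
proof (intro ballI conjI)
  fix z assume z: "z \<in> D"
  have lin: "linear (\<lambda>r. dG z (0, r) p q)" for p q
    using dG_left(1)[OF z, of "(0, _)" "(0, _)"] dG_left(2)[OF z, of _ "(0, _)"] by (intro linearI) simp_all
  show "\<forall>p r. dG z (0, r) p (snd z) = 0"
  proof (intro allI)
    fix p r
    have "dG z (0, axis d 1) (axis c 1) (snd z) = 0" for c d
    proof -
      have "frechet_derivative (pdy c F) (at z) (0, axis d 1) = g d c z"
        using F_hess[OF z, of d c] by (simp add: hess_def pdy_def[of d])
      moreover have "frechet_derivative (pdy c F) (at z) = frechet_derivative (\<lambda>z. \<Sum>a\<in>UNIV. g c a z * snd z $ a) (at z)"
        by (rule frechet_derivative_cong_open[OF open_D z euler_pdy])
      ultimately show ?thesis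
        using snd_contraction_deriv[of "\<lambda>a. g c a", OF g_smooth z, of d] g_sym[OF z, of c d]
        by (simp add: bil_axis_left)
    qed
    then have "dG z (0, axis d 1) p (snd z) = 0" for d
      by (rule linear_eq_on_axes[OF linear_bil(1) linear_zero])
    then show "dG z (0, r) p (snd z) = 0"
      by (rule linear_eq_on_axes[OF lin linear_zero])
  qed
  have third: "frechet_derivative (g a b) (at z) (0, axis c 1) = frechet_derivative (g a c) (at z) (0, axis b 1)" for a b c
  proof -
    have g': "frechet_derivative (g a b) (at z) = frechet_derivative (\<lambda>z. frechet_derivative (pdy a F) (at z) (0, axis b 1)) (at z)" for b
    proof (rule frechet_derivative_cong_open[OF open_D z])
      show "g a b z = frechet_derivative (pdy a F) (at z) (0, axis b 1)" if "z \<in> D" for z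
        using F_hess[OF that, of b a] g_sym[OF that, of a b] by (simp add: hess_def pdy_def[of b])
    qed
    show ?thesis
      unfolding g' by (rule frechet_derivative_commute[OF open_D z pdy_smooth])
  qed
  show "\<forall>p q r. dG z (0, r) p q = dG z (0, q) p r"
  proof (intro allI)
    fix p q r
    have "dG z (0, axis c 1) (axis a 1) (axis b 1) = dG z (0, axis b 1) (axis a 1) (axis c 1)" for a b c
      using third[of a b c] by (simp add: bil_axis)
    then have "dG z (0, axis c 1) p (axis b 1) = dG z (0, axis b 1) p (axis c 1)" for b c
      by (rule linear_eq_on_axes[OF linear_bil(1) linear_bil(1)])
    then have "dG z (0, r) p (axis b 1) = dG z (0, axis b 1) p r" for b
      by (rule linear_eq_on_axes[OF lin linear_bil(2)])
    then show "dG z (0, r) p q = dG z (0, q) p r"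
      by (rule linear_eq_on_axes[OF linear_bil(2) lin])
  qed
qed

text \<open>The Cartan form is given relative to the Barthel connection \<open>Bv\<close>, whereas
  \<open>cartan_like\<close> refers to \<open>Nv\<close>, extracted from the form itself. The work
  lies in showing that the two agree.\<close>

lemma cartan_form_cartan_like:
  assumes w: "\<And>z a b u. z \<in> D \<Longrightarrow> w a b z u = cartan_form F a b z u"
  shows "cartan_like"
proof -
  note h = homogeneous_hessian_like
  have Wv: "Wv z u p = CW F z u p" if "z \<in> D" for z u p
    using w[OF that] by (simp add: Wv_def CW_def)
  have V: "G z (Wv z (0, r) p) q = 1/2 * dG z (0, r) p q" if "z \<in> D" for z p q r
    using G_CW_vertical[OF h F_eq_lag that] by (simp add: Wv[OF that])
  have H: "2 * G z (Wv z (r, - Bv F z r) p) q =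
      dG z (p, - Bv F z p) q r + dG z (r, - Bv F z r) q p - dG z (q, - Bv F z q) p r" if "z \<in> D" for z p q r
    using G_CW_horizontal[OF h F_eq_lag that, of r p q] by (simp add: Wv[OF that] christoffel_def)
  have V0: "Wv z (0, r) (snd z) = 0" if "z \<in> D" for z r
    by (rule G_eq0[OF that]) (simp add: V[OF that] hessian_likeD(3)[OF h that])
  have dG_snd: "dG z (p, - Bv F z p) r (snd z) = dG z (p, 0) r (snd z)"
      "dG z (p, - Bv F z p) (snd z) r = dG z (p, 0) (snd z) r"
    if "z \<in> D" for z p r
    using dG_Pair[OF that, of p "- Bv F z p" r "snd z"] dG_Pair[OF that, of p "- Bv F z p" "snd z" r]
    by (simp_all add: hessian_likeD(2,3)[OF h that])
  have N: "2 * G z (Nv z r) p = dG z (snd z, 0) p r - dG z (0, Bv F z (snd z)) p r + dG z (r, 0) p (snd z) - dG z (p, 0) (snd z) r"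
    if "z \<in> D" for z p r
    using H[OF that, of r "snd z" p] Wv_horizontal_snd[OF that V0[OF that], of r "- Bv F z r"]
      dG_Pair[OF that, of "snd z" "- Bv F z (snd z)" p r] dG_snd_minus[OF that]
    by (simp add: dG_snd[OF that])
  have spray: "G z (Nv z (snd z)) p = spray_form z p" if "z \<in> D" for z p
    using N[OF that, of "snd z" p] by (simp add: spray_form_def hessian_likeD(2)[OF h that])
  have B: "2 * G z (Bv F z r) p =
      dG z (snd z, 0) p r + dG z (r, 0) p (snd z) - dG z (p, 0) (snd z) r - dG z (0, r) (Nv z (snd z)) p"
    if z: "z \<in> D" for z p r
  proof -
    have "Bv F z r = (1/2) *\<^sub>R frechet_derivative (\<lambda>z. Nv z (snd z)) (at z) (0, r)"
      by (rule Bv_eq[OF h F_eq_lag z Nv_snd_differentiable[OF z] spray])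
    then show ?thesis
      using spray_vector_deriv[OF h z Nv_snd_differentiable[OF z] spray, of r p] by (simp add: bil_simps)
  qed
  \<comment> \<open>The formula for \<open>Nv\<close> contains \<open>Bv\<close> at y and the
    formula for \<open>Bv\<close> contains \<open>Nv\<close> at y. At r = y these terms vanish and
    both sides reduce to the spray; this case then settles the general one.\<close>
  have B_snd: "Bv F z (snd z) = Nv z (snd z)" if z: "z \<in> D" for z
  proof (rule G_eqI[OF z])
    show "G z (Bv F z (snd z)) p = G z (Nv z (snd z)) p" for p
      using B[OF z, of "snd z" p] hessian_likeD(1)[OF h z, of "snd z" "Nv z (snd z)" p]
      by (simp add: spray[OF z] spray_form_def hessian_likeD(2)[OF h z])
  qed
  have NB: "Nv z r = Bv F z r" if z: "z \<in> D" for z r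
  proof (rule G_eqI[OF z])
    fix p
    have "dG z (0, Nv z (snd z)) p r = dG z (0, r) (Nv z (snd z)) p"
      using hessian_likeD(1)[OF h z, of "Nv z (snd z)" p r] dG_sym[OF z] by metis
    then show "G z (Nv z r) p = G z (Bv F z r) p"
      using B[OF z, of r p] N[OF z, of r p] by (simp add: B_snd[OF z])
  qed
  have "metrical"
    unfolding metrical_def
  proof (intro ballI allI)
    fix z u p q assume z: "z \<in> D"
    have eq: "(fst u, - Bv F z (fst u)) + (0, snd u + Bv F z (fst u)) = u" by (simp add: prod_eq_iff)
    have Wu: "Wv z u p = Wv z (fst u, - Bv F z (fst u)) p + Wv z (0, snd u + Bv F z (fst u)) p" for p
      using Wv_left(1)[OF z, of "(fst u, - Bv F z (fst u))" "(0, snd u + Bv F z (fst u))" p] unfolding eq .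
    have du: "dG z u p q = dG z (fst u, - Bv F z (fst u)) p q + dG z (0, snd u + Bv F z (fst u)) p q"
      using dG_left(1)[OF z, of "(fst u, - Bv F z (fst u))" "(0, snd u + Bv F z (fst u))" p q] unfolding eq .
    show "dG z u p q = G z (Wv z u p) q + G z p (Wv z u q)"
      unfolding Wu[of p] Wu[of q] du
      using H[OF z, of "fst u" p q] H[OF z, of "fst u" q p] V[OF z, of "snd u + Bv F z (fst u)" p q]
        V[OF z, of "snd u + Bv F z (fst u)" q p] dG_sym[OF z, of _ q p] dG_sym[OF z, of _ q "fst u"]
        dG_sym[OF z, of _ p "fst u"] G_sym[OF z, of p]
      by (simp add: bil_simps)
  qed
  moreover have "Wv z (p, - Nv z p) q = Wv z (q, - Nv z q) p" if z: "z \<in> D" for z p q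
  proof (rule G_eqI[OF z])
    show "G z (Wv z (p, - Nv z p) q) s = G z (Wv z (q, - Nv z q) p) s" for s
      using H[OF z, of p q s] H[OF z, of q p s] dG_sym[OF z, of _ p q] by (simp add: NB[OF z])
  qed
  moreover have "G z (Wv z (0, r) p) q = G z (Wv z (0, r) q) p" "G z (Wv z (0, r) p) q = G z (Wv z (0, q) p) r"
    if z: "z \<in> D" for z p q r
    using dG_sym[OF z, of "(0, r)" p q] hessian_likeD(1)[OF h z, of r p q] by (simp_all add: V[OF z])
  ultimately show ?thesis
    unfolding cartan_like_def using V0 by blast
qed

end

end

section \<open>Global statements\<close>

locale finsler_metric = finsler A nab for A :: "('m, 'n::finite) mchart set" and nab +
  fixes g :: "('m, 'n) metric"
  assumes metric: "pullback_metric A g"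
begin

lemma
  assumes "X \<in> slit_bundle A"
    and "u \<in> tangent_space A (fst X)" "v \<in> tangent_space A (fst X)" "w \<in> tangent_space A (fst X)"
  shows metric_linear: "g X (\<lambda>c. r *\<^sub>R u c + v c) w = r * g X u w + g X v w"
    and metric_sym: "g X u v = g X v u"
  using metric assms unfolding pullback_metric_def by blast+

lemma metric_nondegenerate:
  assumes "X \<in> slit_bundle A" "u \<in> tangent_space A (fst X)" "\<And>v. v \<in> tangent_space A (fst X) \<Longrightarrow> g X u v = 0"
  shows "u = (\<lambda>_. 0)"
  using metric assms unfolding pullback_metric_def by blast

lemma metric_sum:
  assumes X: "X \<in> slit_bundle A" and v: "\<And>i. i \<in> I \<Longrightarrow> v i \<in> tangent_space A (fst X)"
    and w: "w \<in> tangent_space A (fst X)"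
  shows "g X (\<lambda>c. \<Sum>i\<in>I. f i *\<^sub>R v i c) w = (\<Sum>i\<in>I. f i * g X (v i) w)"
proof -
  have 0: "g X (\<lambda>c. 0) w = 0"
    using metric_linear[OF X zero_in_tangent_space zero_in_tangent_space w, of 1] by simp
  show ?thesis
    using v
  proof (induction I rule: infinite_finite_induct)
    case (insert i I)
    then have "(\<lambda>c. \<Sum>i\<in>I. f i *\<^sub>R v i c) \<in> tangent_space A (fst X)"
      by (intro tangent_space_sum) auto
    then show ?case using insert metric_linear[OF X _ _ w, of "v i"] by simp
  qed (simp_all add: 0)
qed

text \<open>Both arguments are expanded in the coordinate frame, so that the invariant g can be
  handled as a form \<open>bil\<close> in each chart.\<close>

lemma metric_expansion:
  assumes c: "c \<in> A" "X \<in> fst (lift_chart A c)"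
    and uv: "u \<in> tangent_space A (fst X)" "v \<in> tangent_space A (fst X)"
  shows "g X u v = bil (\<lambda>a b. metric_comp A g c a b (snd (lift_chart A c) X)) (u c) (v c)"
proof -
  have X: "X \<in> slit_bundle A" "fst X \<in> fst c" using c by (auto simp: fst_lift_chart)
  have e: "coord_frame A c a X \<in> tangent_space A (fst X)" for a
    using c(1) X(2) by (simp add: coord_frame_def coord_vector_in_tangent_space)
  have left: "g X u v = (\<Sum>a\<in>UNIV. u c $ a * g X (coord_frame A c a X) v)"
    if "u \<in> tangent_space A (fst X)" "v \<in> tangent_space A (fst X)" for u v
    using metric_sum[where I = UNIV and f = "\<lambda>a. u c $ a" and v = "\<lambda>a. coord_frame A c a X", OF X(1) e that(2)]
    by (simp only: frame_expansion[OF c(1) X(2) that(1), symmetric])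
  have right: "g X (coord_frame A c a X) v = (\<Sum>b\<in>UNIV. v c $ b * g X (coord_frame A c b X) (coord_frame A c a X))" for a
    using left[OF uv(2) e] metric_sym[OF X(1) e uv(2) e] by simp
  have "g X (coord_frame A c b X) (coord_frame A c a X) = metric_comp A g c a b (snd (lift_chart A c) X)" for a b
    using metric_sym[OF X(1) e e e] c by (simp add: metric_comp_def slit.chart_inv_left)
  then show ?thesis
    using left[OF uv] by (simp add: right bil_def sum_distrib_left mult_ac)
qed

lemma coords:
  assumes c: "c \<in> A"
  shows "finsler_coords (E_domain A c) (metric_comp A g c) (conn_form A nab c)"
proof (rule finsler_coords.intro)
  show "open (E_domain A c)" by (rule open_E_domain[OF c])
  show "smooth_on (E_domain A c) (metric_comp A g c a b)" for a b
    using metric c unfolding pullback_metric_def by blast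
  show "smooth_on (E_domain A c) (\<lambda>z. conn_form A nab c a b z u)" for a b u
    by (rule smooth_conn_form[OF c])
  show "linear (conn_form A nab c a b z)" if "z \<in> E_domain A c" for z a b
    by (rule linear_conn_form[OF c that])
  fix z assume z: "z \<in> E_domain A c"
  let ?X = "E_point A c z"
  have X: "?X \<in> fst (lift_chart A c)" by (rule E_point_in[OF z])
  have e: "coord_frame A c a ?X \<in> tangent_space A (fst ?X)" for a
    using c fst_E_point[OF z] by (simp add: coord_frame_def coord_vector_in_tangent_space)
  show "metric_comp A g c a b z = metric_comp A g c b a z" for a b
    using metric_sym[OF _ e e e] X by (simp add: metric_comp_def fst_lift_chart)
  fix p assume p: "\<And>b. (\<Sum>a\<in>UNIV. metric_comp A g c a b z * p $ a) = 0"
  let ?u = "coord_vector A c (fst ?X) p"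
  have u: "?u \<in> tangent_space A (fst ?X)" "?u c = p"
    using c fst_E_point[OF z] by (simp_all add: coord_vector_in_tangent_space coord_vector_self)
  have "bil (\<lambda>a b. metric_comp A g c a b z) p q = 0" for q
    by (rule linear_eq_on_axes[OF linear_bil(2) linear_zero]) (simp add: bil_axis_right p)
  then have "g ?X ?u v = 0" if "v \<in> tangent_space A (fst ?X)" for v
    using metric_expansion[OF c X u(1) that] u(2) by (simp add: E_point_coords[OF z])
  then have "?u = (\<lambda>_. 0)"
    using X u(1) by (intro metric_nondegenerate) (auto simp: fst_lift_chart)
  with u(2) show "p = 0" by metis
qed

section \<open>The global conditions read in one chart\<close>

context
  fixes c
  assumes c: "c \<in> A"
begin

interpretation C: finsler_coords "E_domain A c" "metric_comp A g c" "conn_form A nab c"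
  by (rule coords[OF c])

lemma torsion_coords: "torsion A nab c a z u v = C.tor z u v $ a"
  by (simp add: torsion_def wedge11_def dx_def C.tor_def C.Wv_def sum_subtractf)

lemma Dy_form_coords: "Dy_form A nab c a z u = C.om z u $ a"
  by (simp add: Dy_form_def dy_def C.om_def C.Wv_def)

lemma radial_coords:
  "C.radial \<longleftrightarrow> (\<forall>z\<in>E_domain A c. \<forall>u v.
     (\<Sum>a\<in>UNIV. \<Sum>b\<in>UNIV. snd z $ a * metric_comp A g c a b z * torsion A nab c b z u v) = 0)"
  unfolding C.radial_def torsion_coords by (simp only: bil_def mult_ac)

lemma wedge_coords:
  assumes "\<And>a z u v. \<tau> a z u v = t z u v $ a" "\<And>b z u. \<beta> b z u = f z u $ b"
  shows "(\<Sum>a\<in>UNIV. \<Sum>b\<in>UNIV. metric_comp A g c a b z * wedge21 (\<tau> a) (\<beta> b) z u v x) =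
    C.G z (t z u v) (f z x) + C.G z (t z v x) (f z u) + C.G z (t z x u) (f z v)"
  by (simp add: wedge21_def bil_def assms distrib_left sum.distrib mult_ac)

lemma cyclic_coords:
  "C.cyclic \<longleftrightarrow> (\<forall>z\<in>E_domain A c. \<forall>u v w.
     (\<Sum>a\<in>UNIV. \<Sum>b\<in>UNIV. metric_comp A g c a b z * wedge21 (torsion A nab c a) (dx b) z u v w) = 0)"
  unfolding C.cyclic_def wedge_coords[of "torsion A nab c" C.tor dx "\<lambda>z u. fst u", OF torsion_coords dx_def] ..

lemma symmetric_coords:
  "C.symmetric \<longleftrightarrow> (\<forall>z\<in>E_domain A c. \<forall>u v w.
     (\<Sum>a\<in>UNIV. \<Sum>b\<in>UNIV. metric_comp A g c a b z * wedge21 (torsion A nab c a) (Dy_form A nab c b) z u v w) = 0)"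
  unfolding C.symmetric_def wedge_coords[of "torsion A nab c" C.tor "Dy_form A nab c" C.om, OF torsion_coords Dy_form_coords] ..

lemma curvature_coords:
  "(\<Sum>d\<in>UNIV. curvature A nab c b d z u v * p $ d) = C.curv z u v p $ b"
proof -
  have 1: "C.Wv z u (C.Wv z v p) $ b =
      (\<Sum>d\<in>UNIV. (\<Sum>e\<in>UNIV. conn_form A nab c b e z u * conn_form A nab c e d z v) * p $ d)" for u v
    unfolding C.Wv_def by (simp add: sum_distrib_left sum_distrib_right mult_ac) (rule sum.swap)
  show ?thesis
    by (simp add: C.curv_def 1 curvature_def wedge11_def ext_deriv1_def C.dW_def algebra_simps sum.distrib sum_subtractf)
qed

lemma radial_curv_coords:
  "C.radial_curv \<longleftrightarrow> (\<forall>z\<in>E_domain A c. \<forall>u v w.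
     (\<Sum>a\<in>UNIV. \<Sum>b\<in>UNIV. \<Sum>d\<in>UNIV. snd z $ a * metric_comp A g c a b z *
        wedge21 (curvature A nab c b d) (dx d) z u v w) = 0)"
proof -
  have *: "(\<Sum>d\<in>UNIV. snd z $ a * metric_comp A g c a b z * wedge21 (curvature A nab c b d) (dx d) z u v w) =
      metric_comp A g c a b z * snd z $ a *
      (C.curv z u v (fst w) + C.curv z v w (fst u) + C.curv z w u (fst v)) $ b" for z u v w a b
    by (simp add: wedge21_def dx_def sum.distrib sum_distrib_left algebra_simps flip: curvature_coords)
  show ?thesis unfolding C.radial_curv_def * bil_def ..
qed

lemma metrical_coords:
  "C.metrical \<longleftrightarrow> (\<forall>z\<in>E_domain A c. \<forall>a b u. Dg_form A g nab c a b z u = 0)"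
proof -
  have Dg: "Dg_form A g nab c a b z u = C.dG z u (axis a 1) (axis b 1)
      - (C.G z (C.Wv z u (axis a 1)) (axis b 1) + C.G z (axis a 1) (C.Wv z u (axis b 1)))" for a b z u
    unfolding bil_axis
    by (simp add: Dg_form_def ext_deriv0_def bil_axis_right bil_axis_left C.Wv_def sum_axis mult.commute)
  have lin: "linear (\<lambda>p. C.G z (C.Wv z u p) q + C.G z p (C.Wv z u q))"
      "linear (\<lambda>q. C.G z (C.Wv z u p) q + C.G z p (C.Wv z u q))" for z u p q
    by (rule linearI; simp add: bil_simps C.Wv_right algebra_simps)+
  show ?thesis
    unfolding C.metrical_def
  proof (intro iffI ballI allI)
    fix z u a b
    assume "\<forall>z\<in>E_domain A c. \<forall>u p q. C.dG z u p q = C.G z (C.Wv z u p) q + C.G z p (C.Wv z u q)"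
      and "z \<in> E_domain A c"
    then show "Dg_form A g nab c a b z u = 0" unfolding Dg right_minus_eq by blast
  next
    fix z u p q
    assume "\<forall>z\<in>E_domain A c. \<forall>a b u. Dg_form A g nab c a b z u = 0" and z: "z \<in> E_domain A c"
    then have "C.dG z u (axis a 1) (axis b 1) =
        C.G z (C.Wv z u (axis a 1)) (axis b 1) + C.G z (axis a 1) (C.Wv z u (axis b 1))" for a b
      unfolding Dg right_minus_eq by blast
    then have "C.dG z u p (axis b 1) = C.G z (C.Wv z u p) (axis b 1) + C.G z p (C.Wv z u (axis b 1))" for b
      by (rule linear_eq_on_axes[OF linear_bil(1) lin(1)])
    then show "C.dG z u p q = C.G z (C.Wv z u p) q + C.G z p (C.Wv z u q)"
      by (rule linear_eq_on_axes[OF linear_bil(2) lin(2)])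
  qed
qed

lemma strong_coords: "C.strong \<longleftrightarrow> (\<forall>z\<in>E_domain A c. \<forall>w a. Dy_form A nab c a z (0, w) = w $ a)"
  unfolding C.strong_def Dy_form_coords by (simp add: vec_eq_iff)

text \<open>The disjunctions cover both systems and both options at once. In the curvature case the
  radial condition is demanded alongside, because the contracted Bianchi identity comes from
  differentiating it.\<close>

lemma cartan_like_coords:
  assumes "strongly_regular A nab \<or> radial_torsion_free A g nab" "almost_torsion_free A g nab"
    "metric_compatible A g nab"
    and "torsion_symmetric A g nab \<or> radial_torsion_free A g nab \<and> radial_curvature_condition A g nab"
  shows "C.cartan_like"
proof (rule C.cartan_likeI)
  show cyc: "C.cyclic" using assms(2) c unfolding cyclic_coords almost_torsion_free_def by blast
  show met: "C.metrical" using assms(3) c unfolding metrical_coords metric_compatible_def by blast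
  have rad: "C.radial" if "radial_torsion_free A g nab"
    using that c unfolding radial_coords radial_torsion_free_def by blast
  show "C.strong"
    using assms(1) c rad C.strong_if_radial[OF _ cyc] unfolding strong_coords strongly_regular_iff by blast
  show "C.symmetric"
    using assms(4)
  proof
    assume "torsion_symmetric A g nab"
    then show ?thesis using c unfolding symmetric_coords torsion_symmetric_def by blast
  next
    assume *: "radial_torsion_free A g nab \<and> radial_curvature_condition A g nab"
    then have "C.radial_curv" using c unfolding radial_curv_coords radial_curvature_condition_def by blast
    then show ?thesis using C.radial_curv_iff[OF rad met] * by blast
  qed
qed

end

lemma conditions_if_cartan_like:
  assumes C: "\<And>c. c \<in> A \<Longrightarrow> finsler_coords.cartan_like (E_domain A c) (metric_comp A g c) (conn_form A nab c)"
  shows "strongly_regular A nab" "cartan_conditions A g nab" "cartan_curvature_conditions A g nab"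
proof -
  note I = finsler_coords.cartan_like_imp[OF coords C]
  show strong: "strongly_regular A nab"
    unfolding strongly_regular_iff using I(1) strong_coords by blast
  have rad: "radial_torsion_free A g nab"
    unfolding radial_torsion_free_def using I(2) radial_coords by blast
  have cyc: "almost_torsion_free A g nab"
    unfolding almost_torsion_free_def using I(3) cyclic_coords by blast
  have sym: "torsion_symmetric A g nab"
    unfolding torsion_symmetric_def using I(4) symmetric_coords by blast
  have m: "finsler_coords.metrical (E_domain A c) (metric_comp A g c) (conn_form A nab c)" if "c \<in> A" for c
    using C[OF that] finsler_coords.cartan_like_def[OF coords[OF that]] by blast
  then have met: "metric_compatible A g nab"
    unfolding metric_compatible_def using metrical_coords by blast
  have "finsler_coords.radial_curv (E_domain A c) (metric_comp A g c) (conn_form A nab c)" if "c \<in> A" for c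
    using finsler_coords.radial_curv_iff[OF coords[OF that] I(2)[OF that that] m[OF that]] I(4)[OF that that] by blast
  then have curv: "radial_curvature_condition A g nab"
    unfolding radial_curvature_condition_def using radial_curv_coords by blast
  show "cartan_conditions A g nab"
    unfolding cartan_conditions_def using strong cyc sym met by blast
  show "cartan_curvature_conditions A g nab"
    unfolding cartan_curvature_conditions_def
    using strongly_regular_imp_regular[OF strong] rad cyc curv met by blast
qed

end

text \<open>The local potentials \<open>lag\<close> are the representatives of this one function, so
  nothing has to be glued.\<close>

definition energy :: "('m, 'n::finite) metric \<Rightarrow> ('m, 'n) epoint \<Rightarrow> real" where
  "energy g X = 1/2 * g X (snd X) (snd X)"

context finsler_metric
begin

lemma energy_coords:
  assumes c: "c \<in> A" and z: "z \<in> E_domain A c"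
  shows "(energy g \<circ> E_point A c) z = finsler_coords.lag (metric_comp A g c) z"
proof -
  have "snd (E_point A c z) \<in> tangent_space A (fst (E_point A c z))"
    using E_point_in[OF z] by (auto simp: fst_lift_chart slit_bundle_def)
  then show ?thesis
    using metric_expansion[OF c E_point_in[OF z]] E_point_components[OF z]
    by (simp add: energy_def E_point_coords[OF z] finsler_coords.lag_def[OF coords[OF c]])
qed

lemma E_point_scaleR:
  assumes "c \<in> A" "(x, y) \<in> E_domain A c" "s > 0"
  shows "E_point A c (x, s *\<^sub>R y) = (fst (E_point A c (x, y)), \<lambda>c'. s *\<^sub>R snd (E_point A c (x, y)) c')"
    and "(x, s *\<^sub>R y) \<in> E_domain A c"
proof -
  have "x \<in> chart_image c" "y \<noteq> 0" using assms by (auto simp: E_domain_eq)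
  then show "E_point A c (x, s *\<^sub>R y) = (fst (E_point A c (x, y)), \<lambda>c'. s *\<^sub>R snd (E_point A c (x, y)) c')"
    "(x, s *\<^sub>R y) \<in> E_domain A c"
    using assms by (simp_all add: E_domain_eq E_point_eq coord_vector_scaleR chart_inv_in)
qed

lemma cartan_connection_of_energy:
  assumes C: "\<And>c. c \<in> A \<Longrightarrow> finsler_coords.cartan_like (E_domain A c) (metric_comp A g c) (conn_form A nab c)"
  shows "finsler_lagrangian A g (energy g)" "is_cartan_connection A (energy g) nab"
proof -
  note h = finsler_coords.cartan_like_hessian_like[OF coords C]
  have smooth: "smooth_map_on (slit_atlas A) (slit_bundle A) (energy g)"
    unfolding smooth_map_on_def slit_atlas_def
  proof (intro ballI, elim imageE)
    fix k c assume k: "k = lift_chart A c" and c: "c \<in> A"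
    have "smooth_on (E_domain A c) (energy g \<circ> E_point A c)"
      by (rule smooth_on_eq[OF open_E_domain[OF c] finsler_coords.smooth_lag[OF coords[OF c]] energy_coords[OF c]])
    moreover have "snd k ` (slit_bundle A \<inter> fst k) = E_domain A c"
      unfolding k chart_image_def fst_lift_chart by (intro arg_cong[where f = "\<lambda>S. _ ` S"]) auto
    ultimately show "smooth_on (snd k ` (slit_bundle A \<inter> fst k)) (energy g \<circ> chart_inv k)"
      by (simp add: k)
  qed
  have hom: "pos_homogeneous2 A (energy g)"
    unfolding pos_homogeneous2_def
  proof (intro ballI, clarify)
    fix p v and s :: real assume pv: "(p, v) \<in> slit_bundle A" and s: "s > 0"
    obtain c where c: "c \<in> A" "(p, v) \<in> fst (lift_chart A c)" using slit_bundle_chart[OF pv] .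
    let ?x = "snd c p" and ?y = "v c"
    have z: "(?x, ?y) \<in> E_domain A c" "E_point A c (?x, ?y) = (p, v)"
      using c slit.chart_inv_left[OF lift_in_slit_atlas[OF c(1)] c(2)]
      by (auto simp: chart_image_def snd_lift_chart image_iff intro!: bexI[of _ "(p, v)"])
    \<comment> \<open>The chart domain contains the whole positive ray through \<open>?y\<close>, as
      \<open>lag_homogeneous\<close> requires.\<close>
    have "finsler_coords.lag (metric_comp A g c) (?x, s *\<^sub>R ?y) = s\<^sup>2 * finsler_coords.lag (metric_comp A g c) (?x, ?y)"
      using E_point_scaleR(2)[OF c(1) z(1)] s
      by (intro finsler_coords.lag_homogeneous[OF coords[OF c(1)] h[OF c(1) c(1)]])
    then show "energy g (p, \<lambda>c. s *\<^sub>R v c) = s\<^sup>2 * energy g (p, v)"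
      using energy_coords[OF c(1) z(1)] energy_coords[OF c(1) E_point_scaleR(2)[OF c(1) z(1) s]]
        E_point_scaleR(1)[OF c(1) z(1) s] z(2) by simp
  qed
  have "is_vertical_hessian A g (energy g)"
    unfolding is_vertical_hessian_def
  proof (intro ballI allI)
    fix c z a b assume c: "c \<in> A" and z: "z \<in> E_domain A c"
    show "metric_comp A g c a b z = hess (energy g \<circ> E_point A c) a b z"
      by (rule finsler_coords.hess_F[OF coords[OF c] h[OF c c] energy_coords[OF c] z, symmetric])
  qed
  with smooth hom show "finsler_lagrangian A g (energy g)"
    by (simp add: finsler_lagrangian_def)
  show "is_cartan_connection A (energy g) nab"
    unfolding is_cartan_connection_def
  proof (intro conjI connection ballI allI)
    fix c z a b u assume c: "c \<in> A" and z: "z \<in> E_domain A c"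
    show "conn_form A nab c a b z u = cartan_form (energy g \<circ> E_point A c) a b z u"
      by (rule finsler_coords.cartan_like_cartan_form[OF coords[OF c] C[OF c] energy_coords[OF c] z])
  qed
qed

lemma cartan_like_if_cartan_connection:
  assumes L: "finsler_lagrangian A g L" and nab: "is_cartan_connection A L nab" and c: "c \<in> A"
  shows "finsler_coords.cartan_like (E_domain A c) (metric_comp A g c) (conn_form A nab c)"
proof (rule finsler_coords.cartan_form_cartan_like[OF coords[OF c]])
  have "snd (lift_chart A c) ` (slit_bundle A \<inter> fst (lift_chart A c)) = E_domain A c"
    unfolding chart_image_def fst_lift_chart by (intro arg_cong[where f = "\<lambda>S. _ ` S"]) auto
  then show "smooth_on (E_domain A c) (L \<circ> E_point A c)"
    using L c unfolding finsler_lagrangian_def smooth_map_on_def by (metis lift_in_slit_atlas)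
  show "(L \<circ> E_point A c) (x, s *\<^sub>R y) = s\<^sup>2 * (L \<circ> E_point A c) (x, y)"
    if z: "(x, y) \<in> E_domain A c" and s: "s > 0" for x y s
  proof -
    have "E_point A c (x, y) \<in> slit_bundle A" using E_point_in[OF z] by (simp add: fst_lift_chart)
    then show ?thesis
      using L s E_point_scaleR(1)[OF c z s]
      unfolding finsler_lagrangian_def pos_homogeneous2_def by (cases "E_point A c (x, y)") auto
  qed
  show "hess (L \<circ> E_point A c) a b z = metric_comp A g c a b z" if "z \<in> E_domain A c" for z a b
    using L c that by (simp add: finsler_lagrangian_def is_vertical_hessian_def)
  show "conn_form A nab c a b z u = cartan_form (L \<circ> E_point A c) a b z u" if "z \<in> E_domain A c" for z a b u
    using nab c that unfolding is_cartan_connection_def by blast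
qed

lemma cartan_conditions_energy:
  assumes "cartan_conditions A g nab \<or> cartan_curvature_conditions A g nab"
  shows "finsler_lagrangian A g (energy g) \<and> is_cartan_connection A (energy g) nab"
proof -
  have "finsler_coords.cartan_like (E_domain A c) (metric_comp A g c) (conn_form A nab c)" if "c \<in> A" for c
    using assms by (intro cartan_like_coords[OF that])
      (auto simp: cartan_conditions_def cartan_curvature_conditions_def)
  then show ?thesis using cartan_connection_of_energy by blast
qed

end

text \<open>The last conjunct closes the circle: combined with the others it shows that the two
  systems, and both options of the first, are satisfied by the same connections, which is the sense
  in which the curvature condition replaces the torsion symmetry.\<close>

theorem theorem3p21:
  fixes A :: "('m, 'n::finite) mchart set"
    and g :: "('m, 'n) metric"
  assumes "smooth_manifold A"
    and "connected_space (atlas_topology A)"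
    and "pullback_metric A g"
  shows "(\<forall>nab nab'. finsler_connection A nab \<and> cartan_conditions A g nab \<and>
        finsler_connection A nab' \<and> cartan_conditions A g nab' \<longrightarrow> same_connection A nab nab') \<and>
    (\<forall>nab. finsler_connection A nab \<and> cartan_conditions A g nab \<longrightarrow>
        (\<exists>L. finsler_lagrangian A g L \<and> is_cartan_connection A L nab)) \<and>
    (\<forall>nab nab'. finsler_connection A nab \<and> cartan_curvature_conditions A g nab \<and>
        finsler_connection A nab' \<and> cartan_curvature_conditions A g nab' \<longrightarrow>
        same_connection A nab nab') \<and>
    (\<forall>nab. finsler_connection A nab \<and> cartan_curvature_conditions A g nab \<longrightarrow>
        (\<exists>L. finsler_lagrangian A g L \<and> is_cartan_connection A L nab)) \<and>
    (\<forall>L nab. finsler_lagrangian A g L \<and> is_cartan_connection A L nab \<longrightarrow>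
        strongly_regular A nab \<and> cartan_conditions A g nab \<and> cartan_curvature_conditions A g nab)"
proof -
  have atlas: "atlas A" using assms(1) by (simp add: atlas_def smooth_manifold_def)
  have loc: "finsler A nab" "finsler_metric A nab g" if "finsler_connection A nab" for nab
    using atlas assms(3) that
    by (simp_all add: finsler_metric_def finsler_metric_axioms_def finsler_def finsler_axioms_def slit_def)
  have energy: "finsler_lagrangian A g (energy g) \<and> is_cartan_connection A (energy g) nab"
    if "finsler_connection A nab" "cartan_conditions A g nab \<or> cartan_curvature_conditions A g nab" for nab
    using finsler_metric.cartan_conditions_energy[OF loc(2)] that by blast
  \<comment> \<open>Both connections have the Cartan forms of \<open>energy g\<close>, which depends
    on g alone; mixed assumptions on the two are covered as well.\<close>
  have unique: "same_connection A nab nab'"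
    if prems: "finsler_connection A nab" "cartan_conditions A g nab \<or> cartan_curvature_conditions A g nab"
      "finsler_connection A nab'" "cartan_conditions A g nab' \<or> cartan_curvature_conditions A g nab'" for nab nab'
  proof (rule same_connectionI[OF loc(1)[OF prems(1)] loc(1)[OF prems(3)]])
    show "conn_form A nab c a b z u = conn_form A nab' c a b z u" if "c \<in> A" "z \<in> E_domain A c" for c z a b u
      using energy[OF prems(1,2)] energy[OF prems(3,4)] that
      unfolding is_cartan_connection_def by metis
  qed
  have converse: "strongly_regular A nab \<and> cartan_conditions A g nab \<and> cartan_curvature_conditions A g nab"
    if L: "finsler_lagrangian A g L" and nab: "is_cartan_connection A L nab" for L nab
  proof -
    interpret finsler_metric A nab g
      using nab by (intro loc) (simp add: is_cartan_connection_def)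
    show ?thesis
      using conditions_if_cartan_like[OF cartan_like_if_cartan_connection[OF L nab]] by blast
  qed
  show ?thesis
    using energy unique converse by blast
qed

end
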